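(* Let $R$ be a commutative ring and $a\in R$. Let $T_R[x,\hat x,r,y]$ be the free unital associative graded $R$-algebra on generators of degrees $\deg(x)=\deg(\hat x)=1$, $\deg(r)=2$, $\deg(y)=3$, with the differential $d$ (a derivation in the graded sense) determined by $d(x)=d(\hat x)=a$, $d(r)=\hat x-x$, $d(y)=2x\hat x-2ar$. Equip it with the involution $\sigma_{\updownarrow}=\mathrm{id}$ and with the anti-involution $\sigma_{\leftrightarrow}$ (the $R$-linear map with $\sigma_{\leftrightarrow}(uv)=\sigma_{\leftrightarrow}(v)\sigma_{\leftrightarrow}(u)$) which interchanges $x$ and $\hat x$ and fixes $r$ and $y$. Then there is a weak equivalence (quasi-isomorphism) of differential graded $R$-algebras $$\varphi\colon (T_R[x,\hat x,r,y],d)\xrightarrow{\ \sim\ } L(4;R,a),$$ commuting with both $\sigma_{\updownarrow}$ and $\sigma_{\leftrightarrow}$, which is given on generators by $$\varphi(x)=U\,|\,N,\qquad \varphi(\hat x)=N\,|\,U,\qquad \varphi(r)=U\,|\,\beta_{2,2}\,|\,U,$$ $$\varphi(y)=U|\beta_{2,1}|\beta_{1,2}|U\;+\;U|\beta_{2,3}|\beta_{3,2}|U\;-\;U|\beta_{2,1}|\beta_{3,2}|U\;-\;U|\beta_{2,3}|\beta_{1,2}|U .$$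
   Context: Temperley--Lieb diagrams. A Temperley--Lieb $(m,k)$-diagram is a non-crossing perfect matching (up to isotopy) by arcs in the unit square of $m$ nodes on the left edge and $k$ nodes on the right edge. $\mathrm{TL}(m,k)$ is the free $R$-module on these diagrams; composition $\mathrm{TL}(m,k)\otimes\mathrm{TL}(k,l)\to\mathrm{TL}(m,l)$, written $\beta\beta'$, is left-to-right concatenation, each closed loop formed being removed and replaced by a factor $a$. $\mathrm{TL}(0,0)=R\{\emptyset\}=R$, and $\mathrm{TL}_4=\mathrm{TL}(4,4)$. The dga of planar loops $L(4)=L(4;R,a)$. Set $L(4)_0=R\{\emptyset\}$ and, for $p\ge1$, $L(4)_p=\mathrm{TL}(0,4)\otimes_R\mathrm{TL}_4^{\otimes (p-1)}\otimes_R\mathrm{TL}(4,0)$, with $R$-basis the symbols $\beta_0|\beta_1|\cdots|\beta_p$ where $\beta_0$ is a $(0,4)$-diagram, $\beta_1,\dots,\beta_{p-1}$ are $(4,4)$-diagrams and $\beta_p$ is a $(4,0)$-diagram. (Such a symbol is pictured as a system of disjoint loops in the plane pinned by $p$ vertical bars with 4 nodes each, bar $i$ lying between $\beta_i$ and $\beta_{i+1}$, $0\le i\le p-1$.) The differential is $d=\sum_{i=0}^{p-1}(-1)^i d_i$ where $d_i$ deletes bar $i$: $d_i(\beta_0|\cdots|\beta_p)=\beta_0|\cdots|\beta_i\beta_{i+1}|\cdots|\beta_p$ (for $p=1$ this is $\beta_0\beta_1\in\mathrm{TL}(0,0)=R\{\emptyset\}$). The product is juxtaposition: $(\beta_0|\cdots|\beta_p)\cdot(\gamma_0|\cdots|\gamma_q)=\beta_0|\cdots|\beta_{p-1}|\beta_p\gamma_0|\gamma_1|\cdots|\gamma_q$,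 where $\beta_p\gamma_0\in\mathrm{TL}(4,4)$ is the composite through the object $0$; the unit is $\emptyset$. Involutions on $L(4)$. $\sigma_{\updownarrow}$ reflects pictures top-to-bottom (node $j$ of each bar goes to node $5-j$); it is an algebra automorphism. $\sigma_{\leftrightarrow}$ reflects pictures left-to-right (reverse the order of the tensor factors and reflect each diagram left-to-right); it is an algebra anti-automorphism, with no signs. They satisfy $d\sigma_{\updownarrow}=\sigma_{\updownarrow}d$ and $d\sigma_{\leftrightarrow}(u)=(-1)^{\deg(u)+1}\sigma_{\leftrightarrow}d(u)$. Notation for diagrams. Nodes on a bar are numbered $1,2,3,4$ from top to bottom. $U$ denotes the matching $\{1,2\},\{3,4\}$ and $N$ the matching $\{1,4\},\{2,3\}$, regarded as a $(0,4)$-diagram when in the first position of a symbol and as a $(4,0)$-diagram when in the last position. For $i,j\in\{1,2,3\}$, $\beta_{i,j}$ is the $(4,4)$-diagram with one arc joining left nodes $i,i+1$, one arc joining right nodes $j,j+1$, and the remaining two left nodes joined to the remaining two right nodes in order (upper to upper, lower to lower). *)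

theory Defs
  imports Complex_Main "HOL-Library.Poly_Mapping" "HOL-Library.Disjoint_Sets"
begin

section \<open>Differential graded algebras\<close>

text \<open>An algebra is carried by the span of its homogeneous parts inside an ambient module, so
  that the type of the ambient module may contain elements which are not part of the algebra.\<close>

record ('r, 'v) dga =
  homog :: "nat \<Rightarrow> 'v set"
  scal :: "'r \<Rightarrow> 'v \<Rightarrow> 'v"
  prd :: "'v \<Rightarrow> 'v \<Rightarrow> 'v"
  unt :: 'v
  diff :: "'v \<Rightarrow> 'v"

definition total :: "('r::comm_ring_1, 'v::ab_group_add) dga \<Rightarrow> 'v set" where
  "total A = module.span (scal A) (\<Union>n. homog A n)"

locale dg_algebra =
  fixes A :: "('r::comm_ring_1, 'v::ab_group_add) dga"
  assumes module_scal: "module (scal A)"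
    and subspace_homog: "module.subspace (scal A) (homog A n)"
    and direct_sum: "\<lbrakk>\<And>n. f n \<in> homog A n; (\<Sum>n\<le>N. f n) = 0; n \<le> N\<rbrakk> \<Longrightarrow> f n = 0"
    and prd_add_left: "\<lbrakk>u \<in> total A; v \<in> total A; w \<in> total A\<rbrakk>
      \<Longrightarrow> prd A (u + v) w = prd A u w + prd A v w"
    and prd_add_right: "\<lbrakk>u \<in> total A; v \<in> total A; w \<in> total A\<rbrakk>
      \<Longrightarrow> prd A u (v + w) = prd A u v + prd A u w"
    and prd_scal_left: "\<lbrakk>u \<in> total A; v \<in> total A\<rbrakk> \<Longrightarrow> prd A (scal A c u) v = scal A c (prd A u v)"
    and prd_scal_right: "\<lbrakk>u \<in> total A; v \<in> total A\<rbrakk> \<Longrightarrow> prd A u (scal A c v) = scal A c (prd A u v)"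
    and prd_homog: "\<lbrakk>u \<in> homog A m; v \<in> homog A n\<rbrakk> \<Longrightarrow> prd A u v \<in> homog A (m + n)"
    and prd_assoc: "\<lbrakk>u \<in> total A; v \<in> total A; w \<in> total A\<rbrakk>
      \<Longrightarrow> prd A (prd A u v) w = prd A u (prd A v w)"
    and unt_homog: "unt A \<in> homog A 0"
    and unt_left: "u \<in> total A \<Longrightarrow> prd A (unt A) u = u"
    and unt_right: "u \<in> total A \<Longrightarrow> prd A u (unt A) = u"
    and diff_add: "\<lbrakk>u \<in> total A; v \<in> total A\<rbrakk> \<Longrightarrow> diff A (u + v) = diff A u + diff A v"
    and diff_scal: "u \<in> total A \<Longrightarrow> diff A (scal A c u) = scal A c (diff A u)"
    and diff_homog_0: "u \<in> homog A 0 \<Longrightarrow> diff A u = 0"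
    and diff_homog_Suc: "u \<in> homog A (Suc n) \<Longrightarrow> diff A u \<in> homog A n"
    and diff_diff: "u \<in> total A \<Longrightarrow> diff A (diff A u) = 0"
    and leibniz: "\<lbrakk>u \<in> homog A m; v \<in> total A\<rbrakk>
      \<Longrightarrow> diff A (prd A u v) = prd A (diff A u) v + scal A ((-1) ^ m) (prd A u (diff A v))"

locale dga_hom = A: dg_algebra A + B: dg_algebra B
  for A :: "('r::comm_ring_1, 'v::ab_group_add) dga"
  and B :: "('r, 'w::ab_group_add) dga" +
  fixes f :: "'v \<Rightarrow> 'w"
  assumes hom_homog: "u \<in> homog A n \<Longrightarrow> f u \<in> homog B n"
    and hom_add: "\<lbrakk>u \<in> total A; v \<in> total A\<rbrakk> \<Longrightarrow> f (u + v) = f u + f v"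
    and hom_scal: "u \<in> total A \<Longrightarrow> f (scal A c u) = scal B c (f u)"
    and hom_prd: "\<lbrakk>u \<in> total A; v \<in> total A\<rbrakk> \<Longrightarrow> f (prd A u v) = prd B (f u) (f v)"
    and hom_unt: "f (unt A) = unt B"
    and hom_diff: "u \<in> total A \<Longrightarrow> f (diff A u) = diff B (f u)"

definition cycles :: "('r, 'v::ab_group_add) dga \<Rightarrow> nat \<Rightarrow> 'v set" where
  "cycles A n = {z \<in> homog A n. diff A z = 0}"

definition boundaries :: "('r, 'v::ab_group_add) dga \<Rightarrow> nat \<Rightarrow> 'v set" where
  "boundaries A n = diff A ` homog A (Suc n)"

definition homologous :: "('r, 'v::ab_group_add) dga \<Rightarrow> nat \<Rightarrow> ('v \<times> 'v) set" where
  "homologous A n = {(u, v). u \<in> cycles A n \<and> v \<in> cycles A n \<and> u - v \<in> boundaries A n}"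

definition homology :: "('r, 'v::ab_group_add) dga \<Rightarrow> nat \<Rightarrow> 'v set set" where
  "homology A n = cycles A n // homologous A n"

text \<open>The map sending the class of a cycle \<open>z\<close> to the class of \<open>f z\<close>.\<close>

definition homology_map ::
    "('r, 'w::ab_group_add) dga \<Rightarrow> ('v \<Rightarrow> 'w) \<Rightarrow> nat \<Rightarrow> 'v set \<Rightarrow> 'w set" where
  "homology_map B f n c = homologous B n `` (f ` c)"

definition dga_quasi_iso ::
    "('r::comm_ring_1, 'v::ab_group_add) dga \<Rightarrow> ('r, 'w::ab_group_add) dga \<Rightarrow> ('v \<Rightarrow> 'w) \<Rightarrow> bool"
  where "dga_quasi_iso A B f \<longleftrightarrow>
    dga_hom A B f \<and> (\<forall>n. bij_betw (homology_map B f n) (homology A n) (homology B n))"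


section \<open>Free modules\<close>

definition scale :: "'r::comm_ring_1 \<Rightarrow> ('k \<Rightarrow>\<^sub>0 'r) \<Rightarrow> ('k \<Rightarrow>\<^sub>0 'r)" where
  "scale c u = Poly_Mapping.map ((*) c) u"

definition lin :: "('k \<Rightarrow> ('l \<Rightarrow>\<^sub>0 'r)) \<Rightarrow> ('k \<Rightarrow>\<^sub>0 'r::comm_ring_1) \<Rightarrow> ('l \<Rightarrow>\<^sub>0 'r)" where
  "lin f u = (\<Sum>k\<in>Poly_Mapping.keys u. scale (Poly_Mapping.lookup u k) (f k))"

abbreviation basis :: "'k \<Rightarrow> ('k \<Rightarrow>\<^sub>0 'r::comm_ring_1)" where
  "basis k \<equiv> Poly_Mapping.single k 1"


section \<open>The free differential graded algebra\<close>

text \<open>The free algebra is the monoid algebra of the free monoid, whose multiplication is that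
  of \<^theory>\<open>HOL-Library.Poly_Mapping\<close>; this requires the free monoid to be written additively.\<close>

datatype 'a word = Word (letters: "'a list")

instantiation word :: (type) monoid_add
begin

definition zero_word :: "'a word" where "0 = Word []"

definition plus_word :: "'a word \<Rightarrow> 'a word \<Rightarrow> 'a word" where
  "v + w = Word (letters v @ letters w)"

instance
  by standard (simp_all add: zero_word_def plus_word_def)

end

datatype gen = X | Xhat | R | Y

primrec gen_deg :: "gen \<Rightarrow> nat" where
  "gen_deg X = 1"
| "gen_deg Xhat = 1"
| "gen_deg R = 2"
| "gen_deg Y = 3"

definition word_deg :: "gen word \<Rightarrow> nat" where
  "word_deg w = sum_list (map gen_deg (letters w))"

type_synonym 'r free_alg = "gen word \<Rightarrow>\<^sub>0 'r"

definition gen :: "gen \<Rightarrow> 'r::comm_ring_1 free_alg" where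
  "gen g = basis (Word [g])"

primrec diff_gen :: "'r::comm_ring_1 \<Rightarrow> gen \<Rightarrow> 'r free_alg" where
  "diff_gen a X = scale a 1"
| "diff_gen a Xhat = scale a 1"
| "diff_gen a R = gen Xhat - gen X"
| "diff_gen a Y = scale 2 (gen X * gen Xhat) - scale (2 * a) (gen R)"

text \<open>The extension of the values on generators by \<open>d(g w) = d(g) w + (-1)\<^bsup>|g|\<^esup> g d(w)\<close>.\<close>

primrec diff_letters :: "'r::comm_ring_1 \<Rightarrow> gen list \<Rightarrow> 'r free_alg" where
  "diff_letters a [] = 0"
| "diff_letters a (g # w) =
    diff_gen a g * basis (Word w) + scale ((-1) ^ gen_deg g) (gen g * diff_letters a w)"

definition free_dga :: "'r::comm_ring_1 \<Rightarrow> ('r, 'r free_alg) dga" where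
  "free_dga a = \<lparr>
    homog = (\<lambda>n. {u. Poly_Mapping.keys u \<subseteq> {w. word_deg w = n}}),
    scal = scale,
    prd = (*),
    unt = 1,
    diff = lin (\<lambda>w. diff_letters a (letters w))\<rparr>"

primrec swap_gen :: "gen \<Rightarrow> gen" where
  "swap_gen X = Xhat"
| "swap_gen Xhat = X"
| "swap_gen R = R"
| "swap_gen Y = Y"

definition free_ud :: "'r::comm_ring_1 free_alg \<Rightarrow> 'r free_alg" where
  "free_ud u = u"

definition free_lr :: "'r::comm_ring_1 free_alg \<Rightarrow> 'r free_alg" where
  "free_lr = lin (\<lambda>w. basis (Word (rev (map swap_gen (letters w)))))"


section \<open>Temperley--Lieb diagrams\<close>

text \<open>Nodes are numbered from top to bottom, starting from 1. Nodes \<open>Mid j\<close> do not occur in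
  diagrams; they are the nodes along which two diagrams are glued.\<close>

datatype node = Lft nat | Mid nat | Rgt nat

type_synonym diagram = "node set set"

definition nodes :: "nat \<Rightarrow> nat \<Rightarrow> node set" where
  "nodes m k = Lft ` {1..m} \<union> Rgt ` {1..k}"

text \<open>The linear order of positions, read cyclically, is the order of the nodes along the
  boundary of the square: up the right edge, then down the left edge.\<close>

primrec bpos :: "node \<Rightarrow> int" where
  "bpos (Lft i) = int i"
| "bpos (Mid i) = 0"
| "bpos (Rgt i) = - int i"

definition noncrossing :: "diagram \<Rightarrow> bool" where
  "noncrossing D \<longleftrightarrow> \<not> (\<exists>p q r s. {p, r} \<in> D \<and> {q, s} \<in> D \<and>
     bpos p < bpos q \<and> bpos q < bpos r \<and> bpos r < bpos s)"

definition tl_diagrams :: "nat \<Rightarrow> nat \<Rightarrow> diagram set" where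
  "tl_diagrams m k = {D. partition_on (nodes m k) D \<and> (\<forall>A\<in>D. card A = 2) \<and> noncrossing D}"

primrec right_to_mid :: "node \<Rightarrow> node" where
  "right_to_mid (Lft i) = Lft i"
| "right_to_mid (Mid i) = Mid i"
| "right_to_mid (Rgt i) = Mid i"

primrec left_to_mid :: "node \<Rightarrow> node" where
  "left_to_mid (Lft i) = Mid i"
| "left_to_mid (Mid i) = Mid i"
| "left_to_mid (Rgt i) = Rgt i"

definition glued :: "diagram \<Rightarrow> diagram \<Rightarrow> node set set" where
  "glued D E = (`) right_to_mid ` D \<union> (`) left_to_mid ` E"

definition linked :: "diagram \<Rightarrow> diagram \<Rightarrow> (node \<times> node) set" where
  "linked D E = {(p, q). {p, q} \<in> glued D E}\<^sup>*"

text \<open>The diagram underlying the concatenation of \<open>D\<close> and \<open>E\<close>, and the number of closed loops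
  formed; the composite in the Temperley--Lieb category is
  \<open>a ^ loops D E\<close> times \<open>join D E\<close>.\<close>

definition join :: "diagram \<Rightarrow> diagram \<Rightarrow> diagram" where
  "join D E = {{p, q} | p q. p \<noteq> q \<and> p \<notin> range Mid \<and> q \<notin> range Mid \<and> (p, q) \<in> linked D E}"

definition loops :: "diagram \<Rightarrow> diagram \<Rightarrow> nat" where
  "loops D E = card {C \<in> \<Union>(glued D E) // linked D E. C \<subseteq> range Mid}"


section \<open>The algebra of planar loops\<close>

text \<open>The symbol \<open>\<beta>\<^sub>0|\<dots>|\<beta>\<^sub>p\<close> is the list \<open>[\<beta>\<^sub>0, \<dots>, \<beta>\<^sub>p]\<close>. For \<open>p = 0\<close> the only symbol is \<open>[{}]\<close>,
  which represents \<open>\<emptyset>\<close>, the empty \<open>(0,0)\<close>-diagram.\<close>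

type_synonym symb = "diagram list"

definition symbols :: "nat \<Rightarrow> symb set" where
  "symbols p = {s. length s = p + 1 \<and>
     (\<forall>i\<le>p. s ! i \<in> tl_diagrams (if i = 0 then 0 else 4) (if i = p then 0 else 4))}"

definition delete_bar :: "'r::comm_ring_1 \<Rightarrow> nat \<Rightarrow> symb \<Rightarrow> (symb \<Rightarrow>\<^sub>0 'r)" where
  "delete_bar a i s = scale (a ^ loops (s ! i) (s ! (i + 1)))
     (basis (take i s @ [join (s ! i) (s ! (i + 1))] @ drop (i + 2) s))"

definition diff_symb :: "'r::comm_ring_1 \<Rightarrow> symb \<Rightarrow> (symb \<Rightarrow>\<^sub>0 'r)" where
  "diff_symb a s = (\<Sum>i<length s - 1. scale ((-1) ^ i) (delete_bar a i s))"

text \<open>The diagrams \<open>last s\<close> and \<open>hd t\<close> are composed through the object \<open>0\<close>, so no loops are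
  formed. If \<open>s\<close> or \<open>t\<close> is \<open>[{}]\<close>, this yields the other symbol.\<close>

definition juxtapose :: "symb \<Rightarrow> symb \<Rightarrow> symb" where
  "juxtapose s t = butlast s @ [join (last s) (hd t)] @ tl t"

definition planar_loops :: "'r::comm_ring_1 \<Rightarrow> ('r, symb \<Rightarrow>\<^sub>0 'r) dga" where
  "planar_loops a = \<lparr>
    homog = (\<lambda>p. {u. Poly_Mapping.keys u \<subseteq> symbols p}),
    scal = scale,
    prd = (\<lambda>u v. lin (\<lambda>s. lin (\<lambda>t. basis (juxtapose s t)) v) u),
    unt = basis [{}],
    diff = lin (diff_symb a)\<rparr>"

primrec flip_ud :: "node \<Rightarrow> node" where
  "flip_ud (Lft i) = Lft (5 - i)"
| "flip_ud (Mid i) = Mid (5 - i)"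
| "flip_ud (Rgt i) = Rgt (5 - i)"

primrec flip_lr :: "node \<Rightarrow> node" where
  "flip_lr (Lft i) = Rgt i"
| "flip_lr (Mid i) = Mid i"
| "flip_lr (Rgt i) = Lft i"

definition loops_ud :: "(symb \<Rightarrow>\<^sub>0 'r::comm_ring_1) \<Rightarrow> (symb \<Rightarrow>\<^sub>0 'r)" where
  "loops_ud = lin (\<lambda>s. basis (map (image (image flip_ud)) s))"

definition loops_lr :: "(symb \<Rightarrow>\<^sub>0 'r::comm_ring_1) \<Rightarrow> (symb \<Rightarrow>\<^sub>0 'r)" where
  "loops_lr = lin (\<lambda>s. basis (rev (map (image (image flip_lr)) s)))"


section \<open>Particular diagrams\<close>

text \<open>The argument of \<open>dU\<close> and \<open>dN\<close> is \<open>Rgt\<close> for a \<open>(0,4)\<close>-diagram (first position of a symbol)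
  and \<open>Lft\<close> for a \<open>(4,0)\<close>-diagram (last position).\<close>

definition dU :: "(nat \<Rightarrow> node) \<Rightarrow> diagram" where
  "dU c = {{c 1, c 2}, {c 3, c 4}}"

definition dN :: "(nat \<Rightarrow> node) \<Rightarrow> diagram" where
  "dN c = {{c 1, c 4}, {c 2, c 3}}"

definition d\<beta> :: "nat \<Rightarrow> nat \<Rightarrow> diagram" where
  "d\<beta> i j = (let I = {1..4} - {i, i + 1}; J = {1..4} - {j, j + 1} in
     {{Lft i, Lft (i + 1)}, {Rgt j, Rgt (j + 1)},
      {Lft (Min I), Rgt (Min J)}, {Lft (Max I), Rgt (Max J)}})"

end

theory Submission
  imports Defs "HOL-Library.Product_Lexorder"
begin

text \<open>Cutting the symbols at their diagrams without through strands exhibits the algebra of planar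
  loops \<open>L\<close> as a free algebra on the symbols that cannot be cut, the letters. The leading letters of
  the images of \<open>x\<close>, \<open>x\<close>-hat, \<open>r\<close> and \<open>y\<close> are critical; all other letters are matched in pairs
  \<open>v\<close>, \<open>up v\<close> such that \<open>v\<close> is, up to sign, the leading term of \<open>d (up v)\<close>. Here \<open>up v\<close> inserts into
  \<open>v\<close> a diagram that fixes its neighbour: an identity next to an identity, or one of the
  idempotents \<open>\<beta>\<^sub>1\<^sub>2\<close>, \<open>\<beta>\<^sub>2\<^sub>1\<close>, \<open>\<beta>\<^sub>3\<^sub>2\<close>; a first diagram \<open>N = U \<beta>\<^sub>2\<^sub>2\<close> is split instead. If \<open>Q\<close> is spanned by the products \<open>\<phi>(t) (up v) w\<close>, it follows that
  \<open>L = \<phi>(T) + Q + dQ\<close> and that \<open>q \<in> Q\<close> vanishes as soon as \<open>dq \<in> \<phi>(T) + Q\<close>. So the complement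
  \<open>Q + dQ\<close> of the subcomplex \<open>\<phi>(T)\<close> is acyclic.\<close>

section \<open>Linear maps between free modules\<close>

text \<open>The coefficient of \<open>v\<close> in \<open>d (up v)\<close> is a sign because the
  inserted diagram is absorbed without closing a loop; so the argument works over every ring and for
  every \<open>a\<close>. The generator \<open>y\<close> comes from an ambiguity: the cup
  \<open>U\<close> is fixed by \<open>\<beta>\<^sub>1\<^sub>2\<close> and by
  \<open>\<beta>\<^sub>3\<^sub>2\<close>, and the matching can use only one of them. Preferring row
  1 leaves \<open>U|\<beta>\<^sub>2\<^sub>3|\<beta>\<^sub>3\<^sub>2|U\<close> without a partner, and
  this is the leading letter of \<open>\<phi>(y)\<close>. Two obstacles forbid working letter by
  letter. The differential does not respect the cuts: a right arc in row 1 meeting a left arc in row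
  3 severs both through strands and breaks a letter in two. And \<open>\<phi>(T)\<close> is not
  spanned by symbols, since \<open>\<phi>(y)\<close> has four terms. Hence symbols are classified by
  their first letter alone, whatever follows it, and the three further terms of
  \<open>\<phi>(y)\<close> are arranged to be of the form \<open>up v\<close>, so that they are
  absorbed by \<open>Q\<close>.\<close>

abbreviation keys :: "('k \<Rightarrow>\<^sub>0 'r::zero) \<Rightarrow> 'k set" where "keys \<equiv> Poly_Mapping.keys"

lemma lookup_scale [simp]: "Poly_Mapping.lookup (scale c u) k = c * Poly_Mapping.lookup u k"
  unfolding scale_def by (simp add: Poly_Mapping.map.rep_eq when_def)

interpretation scale: module "scale :: 'r::comm_ring_1 \<Rightarrow> ('k \<Rightarrow>\<^sub>0 'r) \<Rightarrow> ('k \<Rightarrow>\<^sub>0 'r)"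
  by standard (rule poly_mapping_eqI, simp add: lookup_add algebra_simps)+

lemma keys_scale:
  fixes u :: "'k \<Rightarrow>\<^sub>0 'r::comm_ring_1"
  shows "keys (scale c u) \<subseteq> keys u"
  by (auto simp: in_keys_iff)

lemma scale_eq_mult: "scale c u = Poly_Mapping.single 0 c * (u :: 'k::monoid_add \<Rightarrow>\<^sub>0 'r::comm_ring_1)"
  by (rule poly_mapping_eqI)
    (simp add: lookup_mult lookup_single when_mult mult_when)

abbreviation linear_map :: "(('k \<Rightarrow>\<^sub>0 'r::comm_ring_1) \<Rightarrow> ('l \<Rightarrow>\<^sub>0 'r)) \<Rightarrow> bool" where
  "linear_map \<equiv> module_hom scale scale"

lemma linear_mapI:
  assumes "\<And>u v. h (u + v) = h u + h v" and "\<And>c u. h (scale c u) = scale c (h u)"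
  shows "linear_map h"
  using assms by unfold_locales auto

lemma lin_superset:
  fixes u :: "'k \<Rightarrow>\<^sub>0 'r::comm_ring_1"
  assumes "finite K" "keys u \<subseteq> K"
  shows "lin f u = (\<Sum>k\<in>K. scale (Poly_Mapping.lookup u k) (f k))"
  unfolding lin_def using assms
  by (intro sum.mono_neutral_left) (auto simp: in_keys_iff)

lemma linear_map_lin:
  fixes f :: "'k \<Rightarrow> ('l \<Rightarrow>\<^sub>0 'r::comm_ring_1)"
  shows "linear_map (lin f)"
proof (rule linear_mapI)
  fix u v :: "'k \<Rightarrow>\<^sub>0 'r" and c :: 'r
  let ?K = "keys u \<union> keys v"
  have "lin f (u + v) = (\<Sum>k\<in>?K. scale (Poly_Mapping.lookup (u + v) k) (f k))"
    using keys_add[of u v] by (intro lin_superset) auto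
  then show "lin f (u + v) = lin f u + lin f v"
    by (simp add: lin_superset[of ?K] lookup_add scale.scale_left_distrib sum.distrib)
  have "lin f (scale c u) = (\<Sum>k\<in>keys u. scale (Poly_Mapping.lookup (scale c u) k) (f k))"
    by (intro lin_superset keys_scale) simp
  then show "lin f (scale c u) = scale c (lin f u)"
    by (simp add: lin_def scale.scale_sum_right)
qed

lemmas lin_add = module_hom.add[OF linear_map_lin]
  and lin_scale = module_hom.scale[OF linear_map_lin]
  and lin_diff = module_hom.diff[OF linear_map_lin]
  and lin_uminus = module_hom.neg[OF linear_map_lin]
  and lin_zero = module_hom.zero[OF linear_map_lin]
  and lin_sum = module_hom.sum[OF linear_map_lin]

lemmas lin_simps = lin_add lin_scale lin_diff lin_uminus lin_zero

lemma lin_basis [simp]: "lin f (basis k) = f k"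
  \<comment> \<open>Over the zero ring \<open>basis k\<close> is \<open>0\<close> and has no keys,
    hence the case distinction.\<close>
  by (cases "(0::'b) = 1") (auto simp: lin_def intro: poly_mapping_eqI)

lemma lin_basis_id: "lin basis u = u"
proof (rule poly_mapping_eqI)
  fix k
  show "Poly_Mapping.lookup (lin basis u) k = Poly_Mapping.lookup u k"
    by (auto simp: lin_def lookup_sum lookup_single when_def if_distrib cong: if_cong
        simp: in_keys_iff)
qed

lemma scale_mult_left: "scale c u * v = scale c (u * v)"
  and scale_mult_right: "u * scale c v = scale c (u * v)"
  for u v :: "'k::monoid_add \<Rightarrow>\<^sub>0 'r::comm_ring_1"
proof -
  show "scale c u * v = scale c (u * v)"
    by (simp add: scale_eq_mult mult.assoc)
  \<comment> \<open>Scalars sit at the unit \<open>0\<close> of the monoid, so they commute with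
    every basis element although the monoid is not commutative.\<close>
  have "lin basis u * Poly_Mapping.single 0 c = Poly_Mapping.single 0 c * lin basis u"
    by (simp add: lin_def scale_eq_mult mult_single sum_distrib_left sum_distrib_right mult.commute)
  then show "u * scale c v = scale c (u * v)"
    by (simp add: scale_eq_mult lin_basis_id mult.assoc[symmetric])
qed

lemma linear_map_eq_lin:
  assumes "linear_map h"
  shows "h u = lin (\<lambda>k. h (basis k)) u"
proof -
  have "h u = h (lin basis u)" by (simp add: lin_basis_id)
  also have "\<dots> = lin (\<lambda>k. h (basis k)) u"
    unfolding lin_def by (simp add: module_hom.sum[OF assms] module_hom.scale[OF assms])
  finally show ?thesis .
qed

lemma lin_cong:
  fixes u :: "'k \<Rightarrow>\<^sub>0 'r::comm_ring_1"
  shows "(\<And>k. k \<in> keys u \<Longrightarrow> f k = g k) \<Longrightarrow> lin f u = lin g u"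
  unfolding lin_def by (rule sum.cong) auto

text \<open>Agreement is required only on the keys of \<open>u\<close>, so that an assumption on the
  support of \<open>u\<close>, such as homogeneity, can be used.\<close>

lemma linear_map_eqI:
  fixes u :: "'k \<Rightarrow>\<^sub>0 'r::comm_ring_1"
  assumes "linear_map h" "linear_map h'"
    and "\<And>k. k \<in> keys u \<Longrightarrow> h (basis k) = h' (basis k)"
  shows "h u = h' u"
  using assms(3) by (subst (1 2) linear_map_eq_lin) (auto intro: assms lin_cong)

lemma linear_map_comp: "linear_map h \<Longrightarrow> linear_map h' \<Longrightarrow> linear_map (\<lambda>u. h (h' u))"
  by (intro linear_mapI) (simp_all add: module_hom.add module_hom.scale)

lemma linear_map_add: "linear_map h \<Longrightarrow> linear_map h' \<Longrightarrow> linear_map (\<lambda>u. h u + h' u)"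
  by (intro linear_mapI) (simp_all add: module_hom.add module_hom.scale scale.scale_right_distrib
      scale.scale_right_diff_distrib mult.commute)

lemma linear_map_diff: "linear_map h \<Longrightarrow> linear_map h' \<Longrightarrow> linear_map (\<lambda>u. h u - h' u)"
  by (intro linear_mapI) (simp_all add: module_hom.add module_hom.scale scale.scale_right_distrib
      scale.scale_right_diff_distrib mult.commute)

lemma linear_map_scale: "linear_map h \<Longrightarrow> linear_map (\<lambda>u. scale c (h u))"
  by (intro linear_mapI) (simp_all add: module_hom.add module_hom.scale scale.scale_right_distrib
      scale.scale_right_diff_distrib mult.commute)

lemma linear_map_id: "linear_map (\<lambda>u. u)"
  by (intro linear_mapI) simp_all

lemma linear_map_zero: "linear_map (\<lambda>u. 0)"
  by (intro linear_mapI) simp_all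

lemma linear_map_mult_left: "linear_map h \<Longrightarrow> linear_map (\<lambda>u. v * h u)"
  and linear_map_mult_right: "linear_map h \<Longrightarrow> linear_map (\<lambda>u. h u * v)"
  for v :: "'k::monoid_add \<Rightarrow>\<^sub>0 'r::comm_ring_1"
  by (auto intro!: linear_mapI simp: module_hom.add module_hom.scale distrib_left distrib_right
      scale_mult_left scale_mult_right)

lemmas linear_intros = linear_map_lin linear_map_comp[OF linear_map_lin] linear_map_add
  linear_map_diff linear_map_scale linear_map_mult_left linear_map_mult_right
  linear_map_id linear_map_zero

lemma lin_lin: "lin f (lin g u) = lin (\<lambda>k. lin f (g k)) u"
  by (rule linear_map_eqI[of "\<lambda>u. lin f (lin g u)" "lin (\<lambda>k. lin f (g k))"])
    (intro linear_intros, intro linear_intros, simp)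

lemma lin_diff_fun: "lin (\<lambda>k. f k - g k) u = lin f u - lin g u"
  by (rule linear_map_eqI[of "lin (\<lambda>k. f k - g k)" "\<lambda>u. lin f u - lin g u"])
    (intro linear_intros, intro linear_intros, simp)

lemma lin_scale_fun: "lin (\<lambda>k. scale c (f k)) u = scale c (lin f u)"
  by (rule linear_map_eqI[of "lin (\<lambda>k. scale c (f k))" "\<lambda>u. scale c (lin f u)"])
    (intro linear_intros, intro linear_intros, simp)

section \<open>Supports and gradings\<close>

lemma keys_sum_subset:
  "(\<And>i. i \<in> I \<Longrightarrow> keys (f i) \<subseteq> A) \<Longrightarrow> keys (sum f I) \<subseteq> A"
proof (induction I rule: infinite_finite_induct)
  case (insert i I)
  then show ?case using Poly_Mapping.keys_add[of "f i" "sum f I"] by auto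
qed simp_all

lemma keys_lin:
  fixes u :: "'k \<Rightarrow>\<^sub>0 'r::comm_ring_1"
  shows "keys (lin f u) \<subseteq> (\<Union>k\<in>keys u. keys (f k))"
  unfolding lin_def
proof (rule keys_sum_subset)
  fix k assume "k \<in> keys u"
  then show "keys (scale (Poly_Mapping.lookup u k) (f k))
      \<subseteq> (\<Union>k\<in>keys u. keys (f k))"
    using keys_scale[of "Poly_Mapping.lookup u k" "f k"] by blast
qed

lemma basis_mult: "basis v * basis w = (basis (v + w) :: 'k::monoid_add \<Rightarrow>\<^sub>0 'r::comm_ring_1)"
  by (simp add: mult_single)

lemma keys_basis: "keys (basis k :: 'k \<Rightarrow>\<^sub>0 'r::comm_ring_1) \<subseteq> {k}"
  by auto

lemma keys_lin_subset:
  fixes u :: "'k \<Rightarrow>\<^sub>0 'r::comm_ring_1"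
  shows "keys u \<subseteq> A \<Longrightarrow> (\<And>k. k \<in> A \<Longrightarrow> keys (f k) \<subseteq> B) \<Longrightarrow>
    keys (lin f u) \<subseteq> B"
  using keys_lin[of f u] by blast

lemma keys_add_subset:
  fixes u :: "'k \<Rightarrow>\<^sub>0 'r::comm_ring_1"
  shows "keys u \<subseteq> A \<Longrightarrow> keys v \<subseteq> A \<Longrightarrow> keys (u + v) \<subseteq> A"
  using Poly_Mapping.keys_add[of u v] by blast

lemma keys_diff_subset:
  "keys u \<subseteq> A \<Longrightarrow> keys v \<subseteq> A \<Longrightarrow>
    keys (u - v :: 'k \<Rightarrow>\<^sub>0 'r::comm_ring_1) \<subseteq> A"
  using keys_add_subset[of u A "- v"] by simp

lemma keys_scale_subset:
  fixes u :: "'k \<Rightarrow>\<^sub>0 'r::comm_ring_1"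
  shows "keys u \<subseteq> A \<Longrightarrow> keys (scale c u) \<subseteq> A"
  using keys_scale[of c u] by blast

lemma keys_mult_subset:
  fixes u v :: "'k::monoid_add \<Rightarrow>\<^sub>0 'r::comm_ring_1"
  assumes "keys u \<subseteq> A" "keys v \<subseteq> B"
    and "\<And>x y. x \<in> A \<Longrightarrow> y \<in> B \<Longrightarrow> x + y \<in> C"
  shows "keys (u * v) \<subseteq> C"
proof -
  have "keys (u * v) \<subseteq> {x + y |x y. x \<in> keys u \<and> y \<in> keys v}"
    by (rule Poly_Mapping.keys_mult)
  with assms show ?thesis by blast
qed

lemma subspace_keys: "scale.subspace {u :: 'k \<Rightarrow>\<^sub>0 'r::comm_ring_1. keys u \<subseteq> A}"
  by (simp add: scale.subspace_def keys_add_subset keys_scale_subset)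

lemma span_keys: "scale.span (\<Union>n. {u. keys u \<subseteq> A n})
    = {u :: 'k \<Rightarrow>\<^sub>0 'r::comm_ring_1. keys u \<subseteq> (\<Union>n. A n)}"
proof (intro equalityI subsetI)
  fix u :: "'k \<Rightarrow>\<^sub>0 'r"
  assume "u \<in> scale.span (\<Union>n. {u. keys u \<subseteq> A n})"
  then show "u \<in> {u. keys u \<subseteq> (\<Union>n. A n)}"
    by (rule scale.span_induct) (auto simp: subspace_keys)
next
  fix u :: "'k \<Rightarrow>\<^sub>0 'r"
  assume u: "u \<in> {u. keys u \<subseteq> (\<Union>n. A n)}"
  have "lin basis u \<in> scale.span (\<Union>n. {u. keys u \<subseteq> A n})"
    unfolding lin_def
  proof (intro scale.span_sum scale.span_scale scale.span_base)
    fix k assume "k \<in> keys u"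
    then obtain n where "k \<in> A n" using u by auto
    then show "basis k \<in> (\<Union>n. {u. keys u \<subseteq> A n})" by auto
  qed
  then show "u \<in> scale.span (\<Union>n. {u. keys u \<subseteq> A n})"
    by (simp add: lin_basis_id)
qed

lemma graded_sum_eq_0:
  assumes "\<And>n. keys (f n) \<subseteq> A n" and "disjoint_family A"
    and "(\<Sum>n\<le>N. f n) = (0 :: 'k \<Rightarrow>\<^sub>0 'r::comm_ring_1)" and "n \<le> (N::nat)"
  shows "f n = 0"
proof (rule ccontr)
  assume "f n \<noteq> 0"
  then obtain k where k: "k \<in> keys (f n)" by fastforce
  have "Poly_Mapping.lookup (f m) k = 0" if "m \<noteq> n" for m
  proof -
    have "k \<notin> keys (f m)"
      using k assms(1)[of n] assms(1)[of m] disjoint_family_onD[OF assms(2), of m n] that by auto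
    then show ?thesis by (simp add: in_keys_iff)
  qed
  then have "(\<Sum>m\<le>N. Poly_Mapping.lookup (f m) k) = Poly_Mapping.lookup (f n) k"
    using assms(4) by (subst sum.remove[of _ n]) (auto intro: sum.neutral)
  with assms(3) k show False by (metis in_keys_iff lookup_sum lookup_zero)
qed


section \<open>Monoid algebras with a graded derivation\<close>

text \<open>The common shape of the free algebra and of the model of planar loops: both are graded
  monoid algebras, so the laws of a dg algebra reduce to statements about basis elements.\<close>

definition monoid_dga ::
    "('k::monoid_add \<Rightarrow> nat) \<Rightarrow> ('k \<Rightarrow> ('k \<Rightarrow>\<^sub>0 'r)) \<Rightarrow> ('r::comm_ring_1, 'k \<Rightarrow>\<^sub>0 'r) dga" where
  "monoid_dga deg \<delta> = \<lparr>homog = (\<lambda>n. {u. keys u \<subseteq> {w. deg w = n}}), scal = scale,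
     prd = (*), unt = 1, diff = lin \<delta>\<rparr>"

lemma monoid_dga_simps [simp]:
  "homog (monoid_dga deg \<delta>) n = {u. keys u \<subseteq> {w. deg w = n}}"
  "scal (monoid_dga deg \<delta>) = scale"
  "prd (monoid_dga deg \<delta>) = (*)"
  "unt (monoid_dga deg \<delta>) = 1"
  "diff (monoid_dga deg \<delta>) = lin \<delta>"
  by (simp_all add: monoid_dga_def)

lemma total_monoid_dga [simp]: "total (monoid_dga deg \<delta>) = UNIV"
proof -
  have "(\<Union>n. {w. deg w = n}) = UNIV" by auto
  then show ?thesis by (simp only: total_def monoid_dga_simps span_keys) simp
qed

locale graded_derivation =
  fixes deg :: "'k::monoid_add \<Rightarrow> nat" and \<delta> :: "'k \<Rightarrow> ('k \<Rightarrow>\<^sub>0 'r::comm_ring_1)"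
  assumes deg_zero: "deg 0 = 0"
    and deg_add: "deg (v + w) = deg v + deg w"
    and keys_\<delta>: "keys (\<delta> w) \<subseteq> {v. Suc (deg v) = deg w}"
    and \<delta>_add: "\<delta> (v + w) = \<delta> v * basis w + scale ((-1) ^ deg v) (basis v * \<delta> w)"
begin

lemma lin_\<delta>_mult:
  assumes "keys u \<subseteq> {w. deg w = n}"
  shows "lin \<delta> (u * v) = lin \<delta> u * v + scale ((-1) ^ n) (u * lin \<delta> v)"
proof -
  have "lin \<delta> (basis w * v) = \<delta> w * v + scale ((-1) ^ deg w) (basis w * lin \<delta> v)" for w
    by (rule linear_map_eqI[of "\<lambda>v. lin \<delta> (basis w * v)"
          "\<lambda>v. \<delta> w * v + scale ((-1) ^ deg w) (basis w * lin \<delta> v)"])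
      (intro linear_intros, intro linear_intros, simp add: basis_mult \<delta>_add)
  then show ?thesis
    using assms by - (rule linear_map_eqI[of "\<lambda>u. lin \<delta> (u * v)"
          "\<lambda>u. lin \<delta> u * v + scale ((-1) ^ n) (u * lin \<delta> v)"], intro linear_intros,
        intro linear_intros, auto)
qed

lemma dg_algebra_monoid_dga:
  assumes "\<And>w. lin \<delta> (\<delta> w) = 0"
  shows "dg_algebra (monoid_dga deg \<delta>)"
proof
  fix u :: "'k \<Rightarrow>\<^sub>0 'r"
  show "diff (monoid_dga deg \<delta>) u = 0" if "u \<in> homog (monoid_dga deg \<delta>) 0"
  proof -
    have "keys (lin \<delta> u) \<subseteq> {}"
      using that keys_\<delta> by (intro keys_lin_subset[where A = "{w. deg w = 0}"]) fastforce+
    then show ?thesis by simp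
  qed
  show "diff (monoid_dga deg \<delta>) u \<in> homog (monoid_dga deg \<delta>) n"
    if "u \<in> homog (monoid_dga deg \<delta>) (Suc n)" for n
  proof -
    have "keys (lin \<delta> u) \<subseteq> {w. deg w = n}"
      using that keys_\<delta> by (intro keys_lin_subset[where A = "{w. deg w = Suc n}"]) fastforce+
    then show ?thesis by simp
  qed
  show "diff (monoid_dga deg \<delta>) (diff (monoid_dga deg \<delta>) u) = 0"
    by (simp add: lin_lin assms) (simp add: lin_def)
next
  fix f :: "nat \<Rightarrow> 'k \<Rightarrow>\<^sub>0 'r" and N n
  assume "\<And>n. f n \<in> homog (monoid_dga deg \<delta>) n" "(\<Sum>n\<le>N. f n) = 0" "n \<le> N"
  then show "f n = 0"
    by (intro graded_sum_eq_0[of f "\<lambda>n. {w. deg w = n}"]) (auto simp: disjoint_family_on_def)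
next
  fix u v :: "'k \<Rightarrow>\<^sub>0 'r" and m n
  assume "u \<in> homog (monoid_dga deg \<delta>) m" "v \<in> homog (monoid_dga deg \<delta>) n"
  then have "keys (u * v) \<subseteq> {w. deg w = m + n}"
    by (intro keys_mult_subset[of u "{w. deg w = m}" v "{w. deg w = n}"]) (simp_all add: deg_add)
  then show "prd (monoid_dga deg \<delta>) u v \<in> homog (monoid_dga deg \<delta>) (m + n)"
    by simp
qed (simp_all add: scale.scale_left_distrib scale.scale_right_distrib distrib_left distrib_right mult.assoc lin_simps scale_mult_left
    scale_mult_right lin_\<delta>_mult deg_zero subspace_keys scale.module_axioms)

end

section \<open>Rows and cups\<close>

datatype cup = U | N

datatype row = R1 | R2 | R3

text \<open>The cup closing off the two through strands of a diagram whose other arc is in row \<open>i\<close>.\<close>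

primrec row_cup :: "row \<Rightarrow> cup" where
  "row_cup R1 = U" | "row_cup R2 = N" | "row_cup R3 = U"

text \<open>Arcs in rows 1 and 3 share no node, so each of them joins the two through strands of the
  other factor, and the composite has no through strands.\<close>

fun far :: "row \<Rightarrow> row \<Rightarrow> bool" where
  "far R1 R3 = True" | "far R3 R1 = True" | "far _ _ = False"

definition row_loops :: "row \<Rightarrow> row \<Rightarrow> nat" where
  "row_loops j k = (if j = k then 1 else 0)"

text \<open>The cup \<open>row_cup j\<close> contains the arc of row \<open>j\<close>, which then
  closes up; the other cup joins this arc to the through strands.\<close>

definition row_cup_loops :: "row \<Rightarrow> cup \<Rightarrow> nat" where
  "row_cup_loops j c = (if row_cup j = c then 1 else 0)"

definition cup_loops :: "cup \<Rightarrow> cup \<Rightarrow> nat" where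
  "cup_loops c k = (if c = k then 2 else 1)"

section \<open>Computing with diagrams\<close>

definition diag :: "('a \<times> 'a) list \<Rightarrow> 'a set set" where
  "diag ps = set (map (\<lambda>(p, q). {p, q}) ps)"

fun opp :: "('a \<times> 'a) list \<Rightarrow> ('a \<times> 'a) list" where
  "opp [] = []"
| "opp ((p, q) # ps) = (p, q) # (q, p) # opp ps"

lemma in_opp: "(p, q) \<in> set (opp ps) \<longleftrightarrow> {p, q} \<in> diag ps"
  by (induction ps rule: opp.induct) (auto simp: diag_def doubleton_eq_iff)

definition nbrs :: "('a \<times> 'a) list \<Rightarrow> 'a \<Rightarrow> 'a list" where
  "nbrs es p = map snd (filter (\<lambda>e. fst e = p) es)"

lemma in_nbrs: "q \<in> set (nbrs es p) \<longleftrightarrow> (p, q) \<in> set es"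
  by (force simp: nbrs_def)

text \<open>The first argument of \<open>reach\<close> and \<open>classes\<close> is fuel; that it suffices is tested by
  \<open>good_classes\<close>.\<close>

fun reach :: "nat \<Rightarrow> ('a \<times> 'a) list \<Rightarrow> 'a list \<Rightarrow> 'a list \<Rightarrow> 'a list" where
  "reach 0 es done todo = done @ todo"
| "reach (Suc n) es done [] = done"
| "reach (Suc n) es done (p # todo) = reach n es (p # done)
     (todo @ filter (\<lambda>q. \<not> List.member (done @ p # todo) q) (nbrs es p))"

fun classes :: "nat \<Rightarrow> ('a \<times> 'a) list \<Rightarrow> 'a list \<Rightarrow> 'a list list" where
  "classes 0 es ps = []"
| "classes (Suc n) es [] = []"
| "classes (Suc n) es (p # ps) = (let c = reach 20 es [] [p] in
     c # classes n es (filter (\<lambda>q. \<not> List.member c q) ps))"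

definition good_classes :: "('a \<times> 'a) list \<Rightarrow> 'a list \<Rightarrow> 'a list list \<Rightarrow> bool" where
  "good_classes es ps cs \<longleftrightarrow>
     list_all (\<lambda>c. list_all (\<lambda>p. list_all (\<lambda>q. List.member c q) (nbrs es p)) c) cs \<and>
     list_all (\<lambda>p. list_ex (\<lambda>c. List.member c p) cs) ps"

lemma reach_sound:
  "\<forall>q\<in>set done \<union> set todo. (p, q) \<in> (set es)\<^sup>* \<Longrightarrow> q \<in> set (reach n es done todo) \<Longrightarrow>
    (p, q) \<in> (set es)\<^sup>*"
proof (induction n es "done" todo rule: reach.induct)
  case (3 n es "done" r todo)
  then show ?case by (auto simp: in_nbrs intro: rtrancl_into_rtrancl)
qed auto

lemma reach_start: "p \<in> set done \<union> set todo \<Longrightarrow> p \<in> set (reach n es done todo)"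
  by (induction n es "done" todo rule: reach.induct) auto

lemma classes_sound:
  "c \<in> set (classes n es ps) \<Longrightarrow> \<exists>p\<in>set ps. p \<in> set c \<and> (\<forall>q\<in>set c. (p, q) \<in> (set es)\<^sup>*)"
proof (induction n es ps rule: classes.induct)
  case (3 n es p ps)
  show ?case
  proof (cases "c = reach 20 es [] [p]")
    case True
    then show ?thesis using reach_sound[of "[]" "[p]" p es _ 20] reach_start[of p "[]" "[p]" 20 es]
      by auto
  next
    case False
    then show ?thesis using 3 by (auto simp: Let_def)
  qed
qed auto

text \<open>Each component starts at a node missing from all earlier ones. Distinctness lets the
  number of loops be read off as the length of a list.\<close>

lemma classes_distinct: "distinct (map set (classes n es ps))"
proof (induction n es ps rule: classes.induct)
  case (3 n es p ps)
  let ?c = "reach 20 es [] [p]"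
  have "set ?c \<noteq> set d" if d: "d \<in> set (classes n es (filter (\<lambda>q. \<not> List.member ?c q) ps))" for d
    using classes_sound[OF d] by (auto simp: List.member_iff)
  then show ?case using 3 by (auto simp: Let_def)
qed auto

text \<open>By construction a class lies in the orbit of its starting node; the test makes it closed
  under edges, so it is the whole orbit.\<close>

lemma good_classes_eq:
  assumes "good_classes es ps (classes n es ps)" and "c \<in> set (classes n es ps)"
  obtains p where "p \<in> set ps" "p \<in> set c" "set c = (set es)\<^sup>* `` {p}"
proof -
  obtain p where p: "p \<in> set ps" "p \<in> set c" "\<forall>q\<in>set c. (p, q) \<in> (set es)\<^sup>*"
    using classes_sound[OF assms(2)] by blast
  have step: "r \<in> set c" if "q \<in> set c" "(q, r) \<in> set es" for q r
    using assms that by (auto simp: good_classes_def list_all_iff List.member_iff in_nbrs)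
  have "q \<in> set c" if "(p, q) \<in> (set es)\<^sup>*" for q
    using that by (induction rule: rtrancl_induct) (auto intro: p step)
  with p that show ?thesis by blast
qed

context
  fixes es :: "('a \<times> 'a) list" and n :: nat and ps :: "'a list" and cs :: "'a list list"
  assumes cs: "cs = classes n (opp es) ps" and good: "good_classes (opp es) ps cs"
    and ps: "set ps = \<Union>(diag es)"
begin

lemma equiv_opp: "equiv UNIV ((set (opp es))\<^sup>*)"
proof -
  have "sym (set (opp es))"
    by (auto simp: sym_def in_opp insert_commute)
  then show ?thesis
    by (auto simp: equiv_def refl_rtrancl sym_rtrancl trans_rtrancl)
qed

lemma quotient_eq_classes: "\<Union>(diag es) // (set (opp es))\<^sup>* = set (map set cs)"
proof (intro equalityI subsetI)
  fix C assume "C \<in> \<Union>(diag es) // (set (opp es))\<^sup>*"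
  then obtain p where p: "p \<in> set ps" "C = (set (opp es))\<^sup>* `` {p}"
    by (auto simp: quotient_def ps)
  then obtain c where c: "c \<in> set cs" "p \<in> set c"
    using good by (auto simp: good_classes_def list_all_iff list_ex_iff List.member_iff)
  obtain q where q: "set c = (set (opp es))\<^sup>* `` {q}"
    using good_classes_eq good c unfolding cs by metis
  with c p have "C = set c" using equiv_opp
    by (metis (no_types, lifting) equiv_class_eq Image_singleton_iff)
  with c show "C \<in> set (map set cs)" by auto
next
  fix C assume "C \<in> set (map set cs)"
  then obtain c where c: "c \<in> set cs" "C = set c" by auto
  then obtain p where "p \<in> set ps" "set c = (set (opp es))\<^sup>* `` {p}"
    using good_classes_eq good unfolding cs by metis
  with c show "C \<in> \<Union>(diag es) // (set (opp es))\<^sup>*"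
    by (auto simp: ps intro: quotientI)
qed

text \<open>The condition \<open>p \<noteq> q\<close> is on both sides because the reflexive closure
  also relates nodes off the graph to themselves.\<close>

lemma related_iff_classes:
  "p \<noteq> q \<and> (p, q) \<in> (set (opp es))\<^sup>* \<longleftrightarrow> p \<noteq> q \<and> (\<exists>c\<in>set cs. p \<in> set c \<and> q \<in> set c)"
proof (intro iffI; elim conjE; intro conjI)
  assume pq: "p \<noteq> q" "(p, q) \<in> (set (opp es))\<^sup>*"
  then obtain r where "(p, r) \<in> set (opp es)" by (metis converse_rtranclE)
  then have "p \<in> \<Union>(diag es)" by (auto simp: in_opp)
  then have "(set (opp es))\<^sup>* `` {p} \<in> set (map set cs)"
    by (subst quotient_eq_classes[symmetric]) (rule quotientI)
  with pq show "\<exists>c\<in>set cs. p \<in> set c \<and> q \<in> set c" by auto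
next
  assume "\<exists>c\<in>set cs. p \<in> set c \<and> q \<in> set c"
  then obtain c where c: "c \<in> set cs" "p \<in> set c" "q \<in> set c" by auto
  obtain r where "set c = (set (opp es))\<^sup>* `` {r}"
    using good_classes_eq good c unfolding cs by metis
  with c show "(p, q) \<in> (set (opp es))\<^sup>*"
    using equiv_opp by (metis Image_singleton_iff equiv_class_eq)
qed auto

end

section \<open>Concatenation of diagrams by evaluation\<close>

fun is_mid :: "node \<Rightarrow> bool" where
  "is_mid (Mid i) = True"
| "is_mid _ = False"

lemma is_mid_iff: "is_mid p \<longleftrightarrow> p \<in> range Mid"
  by (cases p) auto

definition eq_pair :: "'a \<times> 'a \<Rightarrow> 'a list \<Rightarrow> bool" where
  "eq_pair e xs \<longleftrightarrow> xs = [fst e, snd e] \<or> xs = [snd e, fst e]"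

definition concat_edges :: "(node \<times> node) list \<Rightarrow> (node \<times> node) list \<Rightarrow> (node \<times> node) list" where
  "concat_edges ds es = map (map_prod right_to_mid right_to_mid) ds
     @ map (map_prod left_to_mid left_to_mid) es"

text \<open>A component of the glued graph meets the boundary either in nothing, and is then a
  closed loop, or in the two ends of an arc of the composite.\<close>

definition check_join ::
    "(node \<times> node) list \<Rightarrow> (node \<times> node) list \<Rightarrow> (node \<times> node) list \<Rightarrow> nat \<Rightarrow> bool" where
  "check_join ds es fs l \<longleftrightarrow> (let os = opp (concat_edges ds es); ps = map fst os;
     cs = classes 20 os ps; ends = map (filter (\<lambda>p. \<not> is_mid p)) cs in
     good_classes os ps cs \<and> list_all (\<lambda>b. b = [] \<or> list_ex (\<lambda>f. eq_pair f b) fs) ends \<and>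
     list_all (\<lambda>f. fst f \<noteq> snd f \<and> list_ex (eq_pair f) ends) fs \<and>
     length (filter (list_all is_mid) cs) = l)"

lemma check_joinD:
  assumes "check_join ds es fs l"
  shows "join (diag ds) (diag es) = diag fs" and "loops (diag ds) (diag es) = l"
proof -
  define os where "os = opp (concat_edges ds es)"
  define ps where "ps = map fst os"
  define cs where "cs = classes 20 os ps"
  define ends where "ends = map (filter (\<lambda>p. \<not> is_mid p)) cs"
  note defs = os_def[symmetric] ps_def[symmetric] cs_def[symmetric] ends_def[symmetric]
  have "good_classes os ps cs \<and> list_all (\<lambda>b. b = [] \<or> list_ex (\<lambda>f. eq_pair f b) fs) ends \<and>
     list_all (\<lambda>f. fst f \<noteq> snd f \<and> list_ex (eq_pair f) ends) fs \<and>
     length (filter (list_all is_mid) cs) = l"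
    using assms unfolding check_join_def Let_def defs .
  note checked = this[unfolded list_all_iff[of _ fs] list_all_iff[of _ ends] list_ex_iff]
  have good: "good_classes os ps cs" using checked by (rule conjunct1)
  have ends: "b = [] \<or> (\<exists>f\<in>set fs. eq_pair f b)" if "b \<in> set ends" for b
    using checked[THEN conjunct2, THEN conjunct1] that by (rule bspec)
  have fs: "fst f \<noteq> snd f \<and> (\<exists>b\<in>set ends. eq_pair f b)" if "f \<in> set fs" for f
    using checked[THEN conjunct2, THEN conjunct2, THEN conjunct1] that by (rule bspec)
  have l: "length (filter (list_all is_mid) cs) = l"
    using checked[THEN conjunct2, THEN conjunct2, THEN conjunct2] .
  have glued: "glued (diag ds) (diag es) = diag (concat_edges ds es)"
    by (simp add: glued_def diag_def concat_edges_def image_Un image_image split_def)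
  have linked: "linked (diag ds) (diag es) = (set os)\<^sup>*"
    unfolding linked_def glued os_def by (rule arg_cong[where f = rtrancl]) (auto simp: in_opp)
  have ps: "set ps = \<Union>(diag (concat_edges ds es))"
  proof -
    have "p \<in> set ps \<longleftrightarrow> (\<exists>q. {p, q} \<in> diag (concat_edges ds es))" for p
      by (simp add: ps_def os_def image_iff Bex_def split_paired_Ex in_opp)
    moreover have "\<exists>p q. A = {p, q}" if "A \<in> diag (concat_edges ds es)" for A
      using that by (auto simp: diag_def)
    ultimately show ?thesis by (auto, metis insert_iff insert_commute singletonD)
  qed
  note facts = cs_def[unfolded os_def] good[unfolded os_def] ps
  have "join (diag ds) (diag es) = {{p, q} |p q. p \<noteq> q \<and> \<not> is_mid p \<and> \<not> is_mid q \<and>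
      (\<exists>c\<in>set cs. p \<in> set c \<and> q \<in> set c)}"
    unfolding join_def linked os_def is_mid_iff
    by (intro Collect_cong ex_cong1) (use related_iff_classes[OF facts] in blast)
  also have "\<dots> = {{p, q} |p q. p \<noteq> q \<and> (\<exists>b\<in>set ends. p \<in> set b \<and> q \<in> set b)}"
    unfolding ends_def by (intro Collect_cong ex_cong1) auto
  also have "\<dots> = diag fs"
  proof (intro equalityI subsetI)
    fix A assume "A \<in> {{p, q} |p q. p \<noteq> q \<and> (\<exists>b\<in>set ends. p \<in> set b \<and> q \<in> set b)}"
    then obtain p q b where b: "A = {p, q}" "p \<noteq> q" "b \<in> set ends" "p \<in> set b" "q \<in> set b"
      by blast
    then obtain f where "f \<in> set fs" "eq_pair f b" using ends[of b] by auto
    then have "A = {fst f, snd f}" using b by (auto simp: eq_pair_def)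
    with \<open>f \<in> set fs\<close> show "A \<in> diag fs"
      by (auto simp: diag_def)
  next
    fix A assume "A \<in> diag fs"
    then obtain f where f: "f \<in> set fs" "A = {fst f, snd f}" by (auto simp: diag_def)
    then obtain b where "fst f \<noteq> snd f" "b \<in> set ends" "eq_pair f b" using fs by blast
    moreover from this have "fst f \<in> set b" "snd f \<in> set b" by (auto simp: eq_pair_def)
    ultimately have "fst f \<noteq> snd f \<and> (\<exists>b\<in>set ends. fst f \<in> set b \<and> snd f \<in> set b)"
      by blast
    with f show "A \<in> {{p, q} |p q. p \<noteq> q \<and> (\<exists>b\<in>set ends. p \<in> set b \<and> q \<in> set b)}"
      by blast
  qed
  finally show "join (diag ds) (diag es) = diag fs" .
  have "{C \<in> \<Union>(glued (diag ds) (diag es)) // linked (diag ds) (diag es). C \<subseteq> range Mid}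
      = set (map set (filter (list_all is_mid) cs))"
    unfolding glued linked os_def quotient_eq_classes[OF facts]
    by (auto simp: list_all_iff is_mid_iff)
  moreover have "distinct (map set (filter (list_all is_mid) cs))"
    using classes_distinct[of 20 os ps] unfolding cs_def by (simp add: distinct_map_filter)
  ultimately show "loops (diag ds) (diag es) = l"
    unfolding loops_def by (simp only: distinct_card length_map l)
qed

section \<open>Enumeration of noncrossing matchings\<close>

lemma length_remove1_less [termination_simp]: "length (remove1 y xs) < Suc (length xs)"
  by (auto simp: length_remove1)

fun matchings :: "'a list \<Rightarrow> ('a \<times> 'a) list list" where
  "matchings [] = [[]]"
| "matchings (x # xs) = concat (map (\<lambda>y. map ((#) (x, y)) (matchings (remove1 y xs))) xs)"

lemma diag_Cons: "diag ((p, q) # ps) = insert {p, q} (diag ps)"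
  by (simp add: diag_def)

lemma matchings_sound:
  "distinct xs \<Longrightarrow> M \<in> set (matchings xs) \<Longrightarrow>
    partition_on (set xs) (diag M) \<and> (\<forall>A\<in>diag M. card A = 2)"
proof (induction xs arbitrary: M rule: matchings.induct)
  case 1
  then show ?case by (simp add: diag_def partition_on_empty)
next
  case (2 x xs)
  then obtain y M' where M: "y \<in> set xs" "M = (x, y) # M'" "M' \<in> set (matchings (remove1 y xs))"
    by auto
  then have IH: "partition_on (set xs - {y}) (diag M')" "\<forall>A\<in>diag M'. card A = 2"
    using "2.IH"[of y M'] "2.prems" by simp_all
  have "partition_on ({x, y} \<union> (set xs - {y})) (insert {x, y} (diag M'))"
  proof (subst partition_on_insert)
    show "disjnt {x, y} (\<Union>(diag M'))"
      using "2.prems" M partition_onD1[OF IH(1), symmetric] by (auto simp: disjnt_def)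
    have "{x, y} \<union> (set xs - {y}) - {x, y} = set xs - {y}"
      using "2.prems" by auto
    then show "partition_on ({x, y} \<union> (set xs - {y}) - {x, y}) (diag M')
        \<and> {x, y} \<subseteq> {x, y} \<union> (set xs - {y}) \<and> {x, y} \<noteq> {}"
      using IH by simp
  qed
  moreover have "{x, y} \<union> (set xs - {y}) = set (x # xs)"
    using M by auto
  moreover have "x \<noteq> y" using "2.prems" M by auto
  ultimately show ?case using IH M by (simp add: diag_Cons)
qed

lemma matchings_complete:
  "distinct xs \<Longrightarrow> partition_on (set xs) D \<Longrightarrow> \<forall>A\<in>D. card A = 2 \<Longrightarrow>
    \<exists>M\<in>set (matchings xs). D = diag M"
proof (induction xs arbitrary: D rule: matchings.induct)
  case 1
  then show ?case by (simp add: diag_def partition_on_empty)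
next
  case (2 x xs)
  have "x \<in> \<Union>D" using partition_onD1[OF "2.prems"(2)] by auto
  then obtain A where A: "A \<in> D" "x \<in> A" by auto
  with "2.prems"(3) have "card A = 2" by simp
  then obtain y where y: "A = {x, y}" "x \<noteq> y"
    using A(2) by (auto simp: card_2_iff)
  have "A \<subseteq> set (x # xs)" using A(1) partition_onD1[OF "2.prems"(2)] by auto
  then have yxs: "y \<in> set xs" using y by auto
  have D: "D = insert A (D - {A})" using A(1) by auto
  have "partition_on (set (x # xs) - A) (D - {A})"
    using "2.prems"(2) A(1) unfolding partition_on_def
    by (auto simp: disjoint_def, blast+)
  moreover have "set (x # xs) - A = set (remove1 y xs)"
    using "2.prems"(1) y by auto
  ultimately obtain M where "M \<in> set (matchings (remove1 y xs))" "D - {A} = diag M"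
    using "2.IH"[of y "D - {A}"] "2.prems" yxs by auto
  then show ?case using D yxs y
    by (intro bexI[of _ "(x, y) # M"]) (auto simp: diag_Cons)
qed

definition check_noncrossing :: "(node \<times> node) list \<Rightarrow> bool" where
  "check_noncrossing M \<longleftrightarrow> list_all (\<lambda>(p, r). list_all (\<lambda>(q, s).
     \<not> (bpos p < bpos q \<and> bpos q < bpos r \<and> bpos r < bpos s)) (opp M)) (opp M)"

lemma noncrossing_diag: "noncrossing (diag M) \<longleftrightarrow> check_noncrossing M"
  by (auto simp: noncrossing_def check_noncrossing_def list_all_iff in_opp[symmetric])

definition same_diag :: "(node \<times> node) list \<Rightarrow> (node \<times> node) list \<Rightarrow> bool" where
  "same_diag M M' \<longleftrightarrow> list_all (List.member (opp M')) M \<and> list_all (List.member (opp M)) M'"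

lemma same_diagD:
  assumes "same_diag M M'"
  shows "diag M = diag M'"
proof -
  have sub: "diag M \<subseteq> diag M'" if "\<forall>e\<in>set M. e \<in> set (opp M')" for M M' :: "(node \<times> node) list"
  proof
    fix A assume "A \<in> diag M"
    then obtain p q where "(p, q) \<in> set M" "A = {p, q}" by (auto simp: diag_def)
    with that show "A \<in> diag M'" by (auto simp: in_opp)
  qed
  show ?thesis
    using assms by (intro equalityI sub) (auto simp: same_diag_def list_all_iff List.member_iff)
qed

definition check_diagrams :: "node list \<Rightarrow> (node \<times> node) list list \<Rightarrow> bool" where
  "check_diagrams ns Ds \<longleftrightarrow> (let Ms = filter check_noncrossing (matchings ns) in
     list_all (\<lambda>M. list_ex (same_diag M) Ds) Ms \<and> list_all (\<lambda>M. list_ex (same_diag M) Ms) Ds)"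

lemma check_diagramsD:
  assumes "check_diagrams ns Ds" and "distinct ns" and "set ns = nodes m k"
  shows "tl_diagrams m k = diag ` set Ds"
proof -
  have "tl_diagrams m k = diag ` set (filter check_noncrossing (matchings ns))"
    using matchings_sound[OF assms(2)] matchings_complete[OF assms(2)] assms(3)
    by (fastforce simp: tl_diagrams_def noncrossing_diag)
  also have "\<dots> = diag ` set Ds"
  proof (intro equalityI subsetI)
    fix D assume "D \<in> diag ` set (filter check_noncrossing (matchings ns))"
    then obtain M where M: "M \<in> set (matchings ns)" "check_noncrossing M" "D = diag M" by auto
    then obtain M' where "M' \<in> set Ds" "same_diag M M'"
      using assms(1) by (auto simp: check_diagrams_def list_all_iff list_ex_iff)
    with M same_diagD show "D \<in> diag ` set Ds" by auto
  next
    fix D assume "D \<in> diag ` set Ds"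
    then obtain M where M: "M \<in> set Ds" "D = diag M" by auto
    then obtain M' where "M' \<in> set (filter check_noncrossing (matchings ns))" "same_diag M M'"
      using assms(1) by (auto simp: check_diagrams_def list_all_iff list_ex_iff Let_def)
    with M same_diagD show "D \<in> diag ` set (filter check_noncrossing (matchings ns))" by auto
  qed
  finally show ?thesis .
qed

section \<open>The multiplication table of the diagrams\<close>

primrec row_index :: "row \<Rightarrow> nat" where
  "row_index R1 = 1" | "row_index R2 = 2" | "row_index R3 = 3"

primrec row_others :: "row \<Rightarrow> nat \<times> nat" where
  "row_others R1 = (3, 4)" | "row_others R2 = (1, 4)" | "row_others R3 = (1, 2)"

primrec cup_arcs :: "(nat \<Rightarrow> node) \<Rightarrow> cup \<Rightarrow> (node \<times> node) list" where
  "cup_arcs c U = [(c 1, c 2), (c 3, c 4)]"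
| "cup_arcs c N = [(c 1, c 4), (c 2, c 3)]"

text \<open>The three kinds have four, two and no through strands. There are 1 + 9 + 4 = 14 of them,
  the Catalan number that counts noncrossing matchings of 8 nodes.\<close>

datatype mid = MId | MBe row row | MCl cup cup

primrec mid_arcs :: "mid \<Rightarrow> (node \<times> node) list" where
  "mid_arcs MId = [(Lft 1, Rgt 1), (Lft 2, Rgt 2), (Lft 3, Rgt 3), (Lft 4, Rgt 4)]"
| "mid_arcs (MBe i j) = [(Lft (row_index i), Lft (row_index i + 1)),
     (Rgt (row_index j), Rgt (row_index j + 1)),
     (Lft (fst (row_others i)), Rgt (fst (row_others j))),
     (Lft (snd (row_others i)), Rgt (snd (row_others j)))]"
| "mid_arcs (MCl c k) = cup_arcs Lft c @ cup_arcs Rgt k"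

fun mid_mult :: "mid \<Rightarrow> mid \<Rightarrow> mid \<times> nat" where
  "mid_mult MId n = (n, 0)"
| "mid_mult m MId = (m, 0)"
| "mid_mult (MBe i j) (MBe k l) =
     (if far j k then MCl (row_cup i) (row_cup l) else MBe i l, row_loops j k)"
| "mid_mult (MBe i j) (MCl c k) = (MCl (row_cup i) k, row_cup_loops j c)"
| "mid_mult (MCl c k) (MBe i j) = (MCl c (row_cup j), row_cup_loops i k)"
| "mid_mult (MCl c k) (MCl c' k') = (MCl c k', cup_loops k c')"

definition cups :: "cup list" where "cups = [U, N]"

definition mids :: "mid list" where
  "mids = MId # [MBe i j. i \<leftarrow> [R1, R2, R3], j \<leftarrow> [R1, R2, R3]] @ [MCl c k. c \<leftarrow> cups, k \<leftarrow> cups]"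

text \<open>Symbolic evaluation is much faster on unary numbers.\<close>

lemma cup_arcs_unary [code]:
  "cup_arcs c U = [(c (Suc 0), c (Suc (Suc 0))), (c (Suc (Suc (Suc 0))), c (Suc (Suc (Suc (Suc 0)))))]"
  "cup_arcs c N = [(c (Suc 0), c (Suc (Suc (Suc (Suc 0))))), (c (Suc (Suc 0)), c (Suc (Suc (Suc 0))))]"
  by (simp_all add: eval_nat_numeral)

lemma row_index_unary [code]:
  "row_index R1 = Suc 0" "row_index R2 = Suc (Suc 0)" "row_index R3 = Suc (Suc (Suc 0))"
  by (simp_all add: eval_nat_numeral)

lemma row_others_unary [code]:
  "row_others R1 = (Suc (Suc (Suc 0)), Suc (Suc (Suc (Suc 0))))"
  "row_others R2 = (Suc 0, Suc (Suc (Suc (Suc 0))))"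
  "row_others R3 = (Suc 0, Suc (Suc 0))"
  by (simp_all add: eval_nat_numeral)

lemma mid_arcs_unary [code]:
  "mid_arcs MId = [(Lft (Suc 0), Rgt (Suc 0)), (Lft (Suc (Suc 0)), Rgt (Suc (Suc 0))),
     (Lft (Suc (Suc (Suc 0))), Rgt (Suc (Suc (Suc 0)))),
     (Lft (Suc (Suc (Suc (Suc 0)))), Rgt (Suc (Suc (Suc (Suc 0)))))]"
  "mid_arcs (MBe i j) = [(Lft (row_index i), Lft (Suc (row_index i))),
     (Rgt (row_index j), Rgt (Suc (row_index j))),
     (Lft (fst (row_others i)), Rgt (fst (row_others j))),
     (Lft (snd (row_others i)), Rgt (snd (row_others j)))]"
  "mid_arcs (MCl c k) = cup_arcs Lft c @ cup_arcs Rgt k"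
  by (simp_all add: eval_nat_numeral)

definition check_mult :: "mid list \<Rightarrow> mid list \<Rightarrow> bool" where
  "check_mult ms ns \<longleftrightarrow> list_all (\<lambda>m. list_all (\<lambda>n. check_join (mid_arcs m) (mid_arcs n)
     (mid_arcs (fst (mid_mult m n))) (snd (mid_mult m n))) ns) ms"

lemma check_mid_mult: "check_mult mids mids"
proof -
  have "check_mult [MId] mids" by code_simp
  moreover have "check_mult [MBe R1 R1, MBe R1 R2, MBe R1 R3] mids" by code_simp
  moreover have "check_mult [MBe R2 R1, MBe R2 R2, MBe R2 R3] mids" by code_simp
  moreover have "check_mult [MBe R3 R1, MBe R3 R2, MBe R3 R3] mids" by code_simp
  moreover have "check_mult [MCl U U, MCl U N, MCl N U, MCl N N] mids" by code_simp
  ultimately show ?thesis by (simp add: check_mult_def mids_def[of] cups_def)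
qed

lemma set_cups: "set cups = UNIV"
  by (auto simp: cups_def intro: cup.exhaust)

lemma set_mids: "set mids = UNIV"
proof -
  have "m \<in> set mids" for m
  proof (cases m)
    case (MBe i j)
    then show ?thesis by (cases i; cases j) (simp_all add: mids_def)
  next
    case (MCl c k)
    then show ?thesis by (cases c; cases k) (simp_all add: mids_def cups_def)
  qed (simp add: mids_def)
  then show ?thesis by auto
qed

lemma join_mid: "join (diag (mid_arcs m)) (diag (mid_arcs n)) = diag (mid_arcs (fst (mid_mult m n)))"
  and loops_mid: "loops (diag (mid_arcs m)) (diag (mid_arcs n)) = snd (mid_mult m n)"
  using check_mid_mult check_joinD unfolding check_mult_def list_all_iff set_mids by blast+

fun cup_mult :: "cup \<Rightarrow> mid \<Rightarrow> cup \<times> nat" where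
  "cup_mult c MId = (c, 0)"
| "cup_mult c (MBe i j) = (row_cup j, row_cup_loops i c)"
| "cup_mult c (MCl k l) = (l, cup_loops c k)"

fun mult_cup :: "mid \<Rightarrow> cup \<Rightarrow> cup \<times> nat" where
  "mult_cup MId c = (c, 0)"
| "mult_cup (MBe i j) c = (row_cup i, row_cup_loops j c)"
| "mult_cup (MCl k l) c = (k, cup_loops l c)"

definition check_cups :: bool where
  "check_cups \<longleftrightarrow>
     list_all (\<lambda>c. list_all (\<lambda>m.
       check_join (cup_arcs Rgt c) (mid_arcs m) (cup_arcs Rgt (fst (cup_mult c m))) (snd (cup_mult c m))
       \<and> check_join (mid_arcs m) (cup_arcs Lft c) (cup_arcs Lft (fst (mult_cup m c))) (snd (mult_cup m c)))
       mids) cups \<and>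
     list_all (\<lambda>c. list_all (\<lambda>k. check_join (cup_arcs Rgt c) (cup_arcs Lft k) [] (cup_loops c k)
       \<and> check_join (cup_arcs Lft c) (cup_arcs Rgt k) (mid_arcs (MCl c k)) 0) cups) cups \<and>
     list_all (\<lambda>c. check_join (cup_arcs Lft c) [] (cup_arcs Lft c) 0
       \<and> check_join [] (cup_arcs Rgt c) (cup_arcs Rgt c) 0) cups \<and> check_join [] [] [] 0"

lemma check_cups: check_cups
  by code_simp

lemma join_cup_mid:
  "join (diag (cup_arcs Rgt c)) (diag (mid_arcs m)) = diag (cup_arcs Rgt (fst (cup_mult c m)))"
  "loops (diag (cup_arcs Rgt c)) (diag (mid_arcs m)) = snd (cup_mult c m)"
  "join (diag (mid_arcs m)) (diag (cup_arcs Lft c)) = diag (cup_arcs Lft (fst (mult_cup m c)))"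
  "loops (diag (mid_arcs m)) (diag (cup_arcs Lft c)) = snd (mult_cup m c)"
  using check_cups check_joinD unfolding check_cups_def list_all_iff set_mids set_cups by blast+

lemma join_cup_cup:
  "join (diag (cup_arcs Rgt c)) (diag (cup_arcs Lft k)) = {}"
  "loops (diag (cup_arcs Rgt c)) (diag (cup_arcs Lft k)) = cup_loops c k"
  "join (diag (cup_arcs Lft c)) (diag (cup_arcs Rgt k)) = diag (mid_arcs (MCl c k))"
  "join (diag (cup_arcs Lft c)) {} = diag (cup_arcs Lft c)"
  "join {} (diag (cup_arcs Rgt c)) = diag (cup_arcs Rgt c)"
  "join {} {} = {}"
proof -
  have nil: "diag [] = {}" by (simp add: diag_def)
  note checks = check_cups[unfolded check_cups_def list_all_iff set_cups]
  show "join (diag (cup_arcs Rgt c)) (diag (cup_arcs Lft k)) = {}"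
    "loops (diag (cup_arcs Rgt c)) (diag (cup_arcs Lft k)) = cup_loops c k"
    "join (diag (cup_arcs Lft c)) (diag (cup_arcs Rgt k)) = diag (mid_arcs (MCl c k))"
    "join (diag (cup_arcs Lft c)) {} = diag (cup_arcs Lft c)"
    "join {} (diag (cup_arcs Rgt c)) = diag (cup_arcs Rgt c)"
    "join {} {} = {}"
    using checks check_joinD nil by (metis UNIV_I)+
qed

lemma nodes_1_4: "{1..4} = {1, 2, 3, 4 :: nat}"
  by auto

lemma tl_4_4: "tl_diagrams 4 4 = range (\<lambda>m. diag (mid_arcs m))"
proof -
  have "check_diagrams (map Lft [1,2,3,4] @ map Rgt [1,2,3,4]) (map mid_arcs mids)"
    by code_simp
  then show ?thesis
    by (subst check_diagramsD) (auto simp: set_mids nodes_def nodes_1_4)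
qed

lemma tl_0_4: "tl_diagrams 0 4 = range (\<lambda>c. diag (cup_arcs Rgt c))"
  and tl_4_0: "tl_diagrams 4 0 = range (\<lambda>c. diag (cup_arcs Lft c))"
  and tl_0_0: "tl_diagrams 0 0 = {{}}"
proof -
  have "check_diagrams (map Rgt [1,2,3,4]) (map (cup_arcs Rgt) cups)"
    and "check_diagrams (map Lft [1,2,3,4]) (map (cup_arcs Lft) cups)"
    and "check_diagrams [] [[]]"
    by code_simp+
  note sets = this[THEN check_diagramsD]
  show "tl_diagrams 0 4 = range (\<lambda>c. diag (cup_arcs Rgt c))"
    by (subst sets(1)) (auto simp: nodes_def nodes_1_4 set_cups)
  show "tl_diagrams 4 0 = range (\<lambda>c. diag (cup_arcs Lft c))"
    by (subst sets(2)) (auto simp: nodes_def nodes_1_4 set_cups)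
  show "tl_diagrams 0 0 = {{}}"
    by (subst sets(3)) (auto simp: nodes_def diag_def)
qed

lemma dU_eq: "dU c = diag (cup_arcs c U)" and dN_eq: "dN c = diag (cup_arcs c N)"
  by (simp_all add: dU_def dN_def diag_def)

lemma d\<beta>_eq: "d\<beta> (row_index i) (row_index j) = diag (mid_arcs (MBe i j))"
proof -
  have "Min ({1..4} - {row_index i, row_index i + 1}) = fst (row_others i) \<and>
      Max ({1..4} - {row_index i, row_index i + 1}) = snd (row_others i)" for i
  proof -
    have "{1..4} - {row_index i, row_index i + 1} = {fst (row_others i), snd (row_others i)}"
      by (cases i) auto
    then show ?thesis by (cases i) simp_all
  qed
  then show ?thesis
    unfolding d\<beta>_def Let_def by (simp add: diag_def)
qed

section \<open>A model of the algebra of planar loops\<close>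

text \<open>The symbol with first diagram \<open>c\<close> is \<open>Sy c t\<close>. A tail records the diagrams behind the first
  bar; a diagram \<open>k \<otimes> l\<close> without through strands, and the last diagram, is recorded as \<open>Cl k\<close>
  followed by the remaining symbol, so that juxtaposition is free.\<close>

datatype tail = Cl cup sy | Idt tail | Be row row tail
  and sy = Emp | Sy cup tail

instantiation sy :: monoid_add
begin

definition "zero_sy = Emp"

primrec plus_tail :: "tail \<Rightarrow> sy \<Rightarrow> tail" and plus_sy :: "sy \<Rightarrow> sy \<Rightarrow> sy" where
  "plus_tail (Cl c w) v = Cl c (plus_sy w v)"
| "plus_tail (Idt t) v = Idt (plus_tail t v)"
| "plus_tail (Be i j t) v = Be i j (plus_tail t v)"
| "plus_sy Emp v = v"
| "plus_sy (Sy c t) v = Sy c (plus_tail t v)"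

instance
proof
  have "plus_tail (plus_tail t v) v' = plus_tail t (v + v')" and "(w + v) + v' = w + (v + v')"
    for t and w v v' :: sy
    by (induction t and w) simp_all
  then show "(w + v) + v' = w + (v + v')" for w v v' :: sy by blast
  have "plus_tail t Emp = t" and "w + Emp = w" for t w
    by (induction t and w) simp_all
  then show "0 + w = w" "w + 0 = w" for w :: sy by (simp_all add: zero_sy_def)
qed

end

text \<open>This is the number of bars. A \<open>Cl c\<close> followed by \<open>Sy k t\<close>
  stands for a single diagram, so \<open>Sy\<close> itself contributes nothing.\<close>

primrec tail_deg :: "tail \<Rightarrow> nat" and sy_deg :: "sy \<Rightarrow> nat" where
  "tail_deg (Cl c w) = Suc (sy_deg w)"
| "tail_deg (Idt t) = Suc (tail_deg t)"
| "tail_deg (Be i j t) = Suc (tail_deg t)"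
| "sy_deg Emp = 0"
| "sy_deg (Sy c t) = tail_deg t"

lemma deg_plus: "tail_deg (plus_tail t v) = tail_deg t + sy_deg v"
  "sy_deg (w + v) = sy_deg w + sy_deg v"
  by (induction t and w) simp_all

context
  fixes a :: "'r::comm_ring_1"
begin

text \<open>Left multiplication of the first diagram of a tail by \<open>MBe i j\<close>. One clause
  for \<open>Cl\<close> serves both for a last diagram and for one without through strands, since
  only the left half of the diagram is touched.\<close>

primrec be_act :: "row \<Rightarrow> row \<Rightarrow> tail \<Rightarrow> (tail \<Rightarrow>\<^sub>0 'r)" where
  "be_act i j (Cl c w) = scale (a ^ row_cup_loops j c) (basis (Cl (row_cup i) w))"
| "be_act i j (Idt t) = basis (Be i j t)"
| "be_act i j (Be k l t) = (if far j k then basis (Cl (row_cup i) (Sy (row_cup l) t))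
     else scale (a ^ row_loops j k) (basis (Be i l t)))"

primrec cup_act :: "cup \<Rightarrow> tail \<Rightarrow> (sy \<Rightarrow>\<^sub>0 'r)" where
  "cup_act c (Cl k w) = scale (a ^ cup_loops c k) (basis w)"
| "cup_act c (Idt t) = basis (Sy c t)"
| "cup_act c (Be k l t) = scale (a ^ row_cup_loops k c) (basis (Sy (row_cup l) t))"

text \<open>The bar in front of a tail is left to \<open>be_act\<close> and \<open>cup_act\<close>.
  The clause for \<open>Cl c w\<close> has no sign because \<open>c\<close> and the first cup of
  \<open>w\<close> belong to the same diagram.\<close>

primrec tail_diff :: "tail \<Rightarrow> (tail \<Rightarrow>\<^sub>0 'r)" and sy_diff :: "sy \<Rightarrow> (sy \<Rightarrow>\<^sub>0 'r)" where
  "tail_diff (Cl c w) = lin (\<lambda>v. basis (Cl c v)) (sy_diff w)"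
| "tail_diff (Idt t) = basis t - lin (\<lambda>s. basis (Idt s)) (tail_diff t)"
| "tail_diff (Be i j t) = be_act i j t - lin (\<lambda>s. basis (Be i j s)) (tail_diff t)"
| "sy_diff Emp = 0"
| "sy_diff (Sy c t) = cup_act c t - lin (\<lambda>s. basis (Sy c s)) (tail_diff t)"

lemma keys_be_act: "keys (be_act i j t) \<subseteq> {s. tail_deg s = tail_deg t}"
  by (cases t) (auto intro!: keys_scale_subset)

lemma keys_cup_act: "keys (cup_act c t) \<subseteq> {w. Suc (sy_deg w) = tail_deg t}"
  by (cases t) (auto intro!: keys_scale_subset)

lemma keys_sy_diff: "keys (tail_diff t) \<subseteq> {s. Suc (tail_deg s) = tail_deg t}"
  "keys (sy_diff w) \<subseteq> {v. Suc (sy_deg v) = sy_deg w}"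
proof (induction t and w)
  case (Cl c w)
  then show ?case by (auto intro!: keys_lin_subset[OF Cl])
next
  case (Idt t)
  have "keys (lin (\<lambda>s. basis (Idt s)) (tail_diff t)) \<subseteq> {s. Suc (tail_deg s) = tail_deg (Idt t)}"
    by (rule keys_lin_subset[OF Idt]) auto
  then show ?case unfolding tail_diff.simps by (intro keys_diff_subset) auto
next
  case (Be i j t)
  have "keys (lin (\<lambda>s. basis (Be i j s)) (tail_diff t)) \<subseteq> {s. Suc (tail_deg s) = tail_deg (Be i j t)}"
    by (rule keys_lin_subset[OF Be]) auto
  then show ?case unfolding tail_diff.simps using keys_be_act[of i j t] by (intro keys_diff_subset) auto
next
  case (Sy c t)
  have "keys (lin (\<lambda>s. basis (Sy c s)) (tail_diff t)) \<subseteq> {s. Suc (sy_deg s) = sy_deg (Sy c t)}"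
    by (rule keys_lin_subset[OF Sy]) auto
  then show ?case unfolding sy_diff.simps using keys_cup_act[of c t] by (intro keys_diff_subset) auto
qed simp

definition tail_mult :: "(tail \<Rightarrow>\<^sub>0 'r) \<Rightarrow> sy \<Rightarrow> (tail \<Rightarrow>\<^sub>0 'r)" where
  "tail_mult u v = lin (\<lambda>t. basis (plus_tail t v)) u"

lemma be_act_plus: "be_act i j (plus_tail t v) = tail_mult (be_act i j t) v"
  by (cases t) (simp_all add: tail_mult_def lin_simps)

lemma cup_act_plus: "cup_act c (plus_tail t v) = cup_act c t * basis v"
  by (cases t) (simp_all add: basis_mult scale_mult_left)

lemma mult_basis: "u * basis v = lin (\<lambda>w. basis (w + v)) u" for u :: "sy \<Rightarrow>\<^sub>0 'r"
  by (rule linear_map_eqI[of "\<lambda>u. u * basis v"], intro linear_intros, rule linear_map_lin)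
    (simp add: basis_mult)

lemma basis_mult_lin: "basis v * u = lin (\<lambda>w. basis (v + w)) u" for u :: "sy \<Rightarrow>\<^sub>0 'r"
  by (rule linear_map_eqI[of "\<lambda>u. basis v * u"], intro linear_intros, rule linear_map_lin)
    (simp add: basis_mult)

lemma diff_plus:
  "tail_diff (plus_tail t v) = tail_mult (tail_diff t) v
     - scale ((-1) ^ tail_deg t) (lin (\<lambda>w. basis (plus_tail t w)) (sy_diff v))"
  "sy_diff (w + v) = sy_diff w * basis v + scale ((-1) ^ sy_deg w) (basis w * sy_diff v)"
proof (induction t and w)
  case (Sy c t)
  then show ?case
    by (simp add: cup_act_plus left_diff_distrib) (simp add: mult_basis basis_mult_lin tail_mult_def lin_lin lin_simps)
qed (simp_all add: be_act_plus mult_basis basis_mult_lin tail_mult_def lin_simps lin_lin lin_basis_id)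

text \<open>Associativity of composition, as seen on tails. In the \<open>far\<close> case the
  product of the two diagrams ends in the cup \<open>row_cup l\<close>, which acts on
  \<open>t\<close> instead.\<close>

lemma be_act_be_act:
  "lin (be_act i j) (be_act k l t) =
     (if far j k then lin (\<lambda>w. basis (Cl (row_cup i) w)) (cup_act (row_cup l) t)
      else scale (a ^ row_loops j k) (be_act i l t))"
proof (cases t)
  case (Be m n s)
  then show ?thesis
    by (cases j; cases k; cases l; cases m; simp add: lin_simps row_loops_def row_cup_loops_def)
qed (cases j; cases k; cases l; auto simp: lin_simps row_loops_def row_cup_loops_def cup_loops_def
    power2_eq_square)+

lemma cup_act_be_act:
  "lin (cup_act c) (be_act k l t) = scale (a ^ row_cup_loops k c) (cup_act (row_cup l) t)"
proof (cases t)
  case (Be m n s)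
  then show ?thesis
    by (cases c; cases k; cases l; cases m; simp add: lin_simps row_loops_def row_cup_loops_def
        cup_loops_def power2_eq_square)
qed (cases c; cases k; cases l; auto simp: lin_simps row_cup_loops_def cup_loops_def
    power2_eq_square)+

text \<open>Deleting a bar of the tail commutes with multiplying its first diagram from the left;
  only the bar next to that diagram needs associativity. With the analogue for cups this yields
  \<open>d d = 0\<close>.\<close>

lemma diff_be_act: "lin tail_diff (be_act i j t) = lin (be_act i j) (tail_diff t)"
  by (cases t) (simp_all add: lin_simps lin_lin be_act_be_act lin_diff_fun lin_scale_fun
      scale.scale_right_diff_distrib)

lemma diff_cup_act: "lin sy_diff (cup_act c t) = lin (cup_act c) (tail_diff t)"
  by (cases t) (simp_all add: lin_simps lin_lin cup_act_be_act lin_diff_fun lin_scale_fun lin_basis_id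
      scale.scale_right_diff_distrib)

lemma diff_diff: "lin tail_diff (tail_diff t) = 0" "lin sy_diff (sy_diff w) = 0"
proof (induction t and w)
  case (Cl c w)
  have "lin (\<lambda>v. lin (\<lambda>v. basis (Cl c v)) (sy_diff v)) (sy_diff w) = 
     lin (\<lambda>v. basis (Cl c v)) (lin sy_diff (sy_diff w))" by (simp add: lin_lin)
  then show ?case by (simp add: Cl lin_lin lin_zero)
next
  case (Idt t)
  have "lin (\<lambda>v. lin (\<lambda>v. basis (Idt v)) (tail_diff v)) (tail_diff t) = 
     lin (\<lambda>v. basis (Idt v)) (lin tail_diff (tail_diff t))" by (simp add: lin_lin)
  then show ?case by (simp add: Idt lin_diff lin_lin lin_zero lin_diff_fun lin_basis_id)
next
  case (Be i j t)
  have "lin (\<lambda>v. lin (\<lambda>v. basis (Be i j v)) (tail_diff v)) (tail_diff t) = 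
     lin (\<lambda>v. basis (Be i j v)) (lin tail_diff (tail_diff t))" by (simp add: lin_lin)
  then show ?case by (simp add: Be lin_diff lin_lin lin_zero lin_diff_fun diff_be_act)
next
  case (Sy c t)
  have "lin (\<lambda>v. lin (\<lambda>v. basis (Sy c v)) (tail_diff v)) (tail_diff t) = 
     lin (\<lambda>v. basis (Sy c v)) (lin tail_diff (tail_diff t))" by (simp add: lin_lin)
  then show ?case by (simp add: Sy lin_diff lin_lin lin_zero lin_diff_fun diff_cup_act)
qed (simp add: lin_zero)

lemma graded_derivation_sy: "graded_derivation sy_deg sy_diff"
proof
  show "keys (sy_diff w) \<subseteq> {v. Suc (sy_deg v) = sy_deg w}" for w
    by (rule keys_sy_diff)
qed (simp_all add: deg_plus diff_plus zero_sy_def)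

lemma dg_algebra_sy: "dg_algebra (monoid_dga sy_deg sy_diff)"
  by (rule graded_derivation.dg_algebra_monoid_dga[OF graded_derivation_sy diff_diff(2)])

end

section \<open>A matching on the symbols\<close>

text \<open>A row adjacent to the given one. For row 2 the choice of row 1 over row 3 is arbitrary;
  because of it symbols starting with \<open>Be R2 R3\<close> need a treatment of their own.\<close>

primrec ecol :: "row \<Rightarrow> row" where
  "ecol R1 = R2" | "ecol R2 = R1" | "ecol R3 = R2"

text \<open>The diagram \<open>\<beta>\<close> with rows \<open>k\<close> and \<open>ecol k\<close> is idempotent and fixes every diagram whose left
  row is \<open>k\<close>. The parity of a run of copies of it decides between the two sides of the matching.\<close>

primrec fixed_parity :: "row \<Rightarrow> tail \<Rightarrow> bool" where
  "fixed_parity k (Cl c w) \<longleftrightarrow> c = row_cup k"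
| "fixed_parity k (Idt t) \<longleftrightarrow> False"
| "fixed_parity k (Be i j t) \<longleftrightarrow> i = k \<and> (j = ecol k \<longrightarrow> \<not> fixed_parity k t)"

text \<open>Serves as a tie-breaker in \<open>rank\<close>: at equal length a longer run counts as
  smaller.\<close>

primrec run :: "row \<Rightarrow> tail \<Rightarrow> nat" where
  "run k (Cl c w) = 0"
| "run k (Idt t) = 0"
| "run k (Be i j t) = (if i = k \<and> j = ecol k then Suc (run k t) else 0)"

primrec first_len :: "tail \<Rightarrow> nat" where
  "first_len (Cl c w) = 0"
| "first_len (Idt t) = Suc (first_len t)"
| "first_len (Be i j t) = Suc (first_len t)"

primrec id_run :: "tail \<Rightarrow> nat" where
  "id_run (Cl c w) = 0"
| "id_run (Idt t) = Suc (id_run t)"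
| "id_run (Be i j t) = 0"

primrec first_id_run :: "tail \<Rightarrow> nat" where
  "first_id_run (Cl c w) = 0"
| "first_id_run (Idt t) = Suc (id_run t)"
| "first_id_run (Be i j t) = first_id_run t"

primrec dup_id :: "tail \<Rightarrow> tail" where
  "dup_id (Cl c w) = Cl c w"
| "dup_id (Idt t) = Idt (Idt t)"
| "dup_id (Be i j t) = Be i j (dup_id t)"

text \<open>The row whose idempotent is inserted in front of a tail. For the cup \<open>U\<close>,
  rows 1 and 3 are both possible and row 1 is chosen; the value at \<open>Idt\<close> is a
  dummy.\<close>

primrec head_row :: "tail \<Rightarrow> row" where
  "head_row (Cl c w) = (case c of U \<Rightarrow> R1 | N \<Rightarrow> R2)"
| "head_row (Idt t) = R1"
| "head_row (Be i j t) = i"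

text \<open>What remains of a left row \<open>i\<close> under composition from the right: either the
  arc stays with two through strands, or these are closed off and the cup \<open>row_cup i\<close>
  appears.\<close>

primrec row_head :: "row \<Rightarrow> tail \<Rightarrow> bool" where
  "row_head i (Cl c w) \<longleftrightarrow> c = row_cup i"
| "row_head i (Idt t) \<longleftrightarrow> False"
| "row_head i (Be k j t) \<longleftrightarrow> k = i"

text \<open>A symbol is classified by its first letter, the part up to the first \<open>Cl\<close>. The map \<open>up\<close> takes
  \<open>lower\<close> symbols to \<open>upper\<close> ones; the remaining symbols are \<open>Emp\<close> and those with critical first
  letter.\<close>

fun lower :: "sy \<Rightarrow> bool" where
  "lower Emp \<longleftrightarrow> False"
| "lower (Sy c t) \<longleftrightarrow> (if first_id_run t \<noteq> 0 then odd (first_id_run t)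
     else if c = N then \<not> (\<exists>w. t = Cl U w)
     else \<not> fixed_parity R2 t \<or> (\<exists>q. t = Be R2 R3 q \<and> fixed_parity (head_row q) q))"

fun upper :: "sy \<Rightarrow> bool" where
  "upper Emp \<longleftrightarrow> False"
| "upper (Sy c t) \<longleftrightarrow> (if first_id_run t \<noteq> 0 then even (first_id_run t)
     else c = U \<and> (\<exists>j q. t = Be R2 j q \<and> (case j of
       R1 \<Rightarrow> \<not> fixed_parity R2 q
     | R2 \<Rightarrow> \<not> (\<exists>w. q = Cl U w)
     | R3 \<Rightarrow> \<not> fixed_parity (head_row q) q \<and> \<not> (\<exists>w. q = Be R3 R2 (Cl U w)))))"

fun up :: "sy \<Rightarrow> sy" where
  "up Emp = Emp"
| "up (Sy c t) = (if first_id_run t \<noteq> 0 then Sy c (dup_id t)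
     else if c = N then Sy U (Be R2 R2 t)
     else if \<not> fixed_parity R2 t then Sy U (Be R2 R1 t)
     else case t of Be i j q \<Rightarrow> Sy U (Be R2 R3 (Be (head_row q) (ecol (head_row q)) q)) | _ \<Rightarrow> Emp)"

text \<open>Compared lexicographically. The middle entry orders symbols with first letters of equal
  length: those with first cup \<open>N\<close> produce ones with first cup \<open>U\<close>; among
  these a general tail can produce one starting with \<open>Be R2 R3\<close>, and that in turn one
  starting with \<open>Be R1 R2\<close> or \<open>Be R3 R2\<close>. The last entry decreases when a
  run of idempotents replaces other diagrams.\<close>

fun rank :: "sy \<Rightarrow> nat \<times> nat \<times> nat" where
  "rank Emp = (0, 0, 0)"
| "rank (Sy c t) = (first_len t,
     if c = N then (3, 0) else case t of
       Be R2 R3 q \<Rightarrow> (1, first_len q - run (head_row q) q)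
     | Be R1 R2 q \<Rightarrow> (0, 0)
     | Be R3 R2 q \<Rightarrow> (0, 0)
     | _ \<Rightarrow> (2, first_len t - run R2 t))"

section \<open>Supports of differentials of tails\<close>

lemma keys_lin_basis: "keys (lin (\<lambda>s. basis (F s)) u) \<subseteq> F ` keys u"
  for u :: "'k \<Rightarrow>\<^sub>0 'r::comm_ring_1"
  by (rule keys_lin_subset[OF order.refl]) auto

lemma keys_lin_basisI:
  fixes u :: "'k \<Rightarrow>\<^sub>0 'r::comm_ring_1"
  assumes "keys u \<subseteq> A" "\<And>s. s \<in> A \<Longrightarrow> F s \<in> B"
  shows "keys (lin (\<lambda>s. basis (F s)) u) \<subseteq> B"
  using keys_lin_basis[of F u] assms by blast

lemma tail_induct [case_names Cl Idt Be]:
  assumes "\<And>c w. P (Cl c w)" "\<And>t. P t \<Longrightarrow> P (Idt t)" "\<And>i j t. P t \<Longrightarrow> P (Be i j t)"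
  shows "P t"
  by (rule tail.induct[where ?P1.0 = P and ?P2.0 = "\<lambda>_. True"]) (simp_all add: assms)

lemma keys_be_act_head: "keys (be_act a i j t) \<subseteq> {s. row_head i s}"
  by (cases t) (auto intro!: keys_scale_subset)

lemma keys_be_act_no_id:
  "first_id_run t = 0 \<Longrightarrow> keys (be_act a i j t) \<subseteq> {s. first_id_run s = 0 \<and> first_len s \<le> first_len t}"
  by (cases t) (auto intro!: keys_scale_subset)

text \<open>A product of diagrams other than the identity is never the identity, and merging can
  only shorten or cut the first letter.\<close>

lemma keys_diff_no_id:
  "first_id_run t = 0 \<Longrightarrow> keys (tail_diff a t) \<subseteq> {s. first_id_run s = 0 \<and> first_len s \<le> first_len t}"
proof (induction t rule: tail_induct)
  case (Cl c w)
  then show ?case using keys_lin_basis[of "Cl c" "sy_diff a w"] by auto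
next
  case (Be i j t)
  then have "keys (be_act a i j t) \<subseteq> {s. first_id_run s = 0 \<and> first_len s \<le> first_len (Be i j t)}"
    using keys_be_act_no_id[of t a i j] by auto
  moreover have "keys (lin (\<lambda>s. basis (Be i j s)) (tail_diff a t))
      \<subseteq> {s. first_id_run s = 0 \<and> first_len s \<le> first_len (Be i j t)}"
    using Be by (intro keys_lin_basisI[of _ "{s. first_id_run s = 0 \<and> first_len s \<le> first_len t}"]) auto
  ultimately show ?case by (simp add: keys_diff_subset)
qed auto

lemma keys_diff_head: "keys (tail_diff a (Be i j t)) \<subseteq> {s. row_head i s}"
proof -
  have "keys (lin (\<lambda>s. basis (Be i j s)) (tail_diff a t)) \<subseteq> {s. row_head i s}"
    using keys_lin_basis[of "Be i j" "tail_diff a t"] by auto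
  with keys_be_act_head[of a i j t] show ?thesis by (simp add: keys_diff_subset)
qed

lemma keys_diff_Cl: "keys (tail_diff a (Cl c w)) \<subseteq> range (Cl c)"
  using keys_lin_basis[of "Cl c" "sy_diff a w"] by auto

text \<open>The row \<open>ecol k\<close> is adjacent to \<open>k\<close>, and its cup differs from
  \<open>row_cup k\<close>; hence no loop closes and the left end of the tail is restored.\<close>

lemma be_act_fixed: "fixed_parity k t \<Longrightarrow> be_act a k (ecol k) t = basis t"
  by (cases t; cases k) (auto simp: row_cup_loops_def row_loops_def)

text \<open>Copies of the idempotent cancel in pairs, so deleting bars inside a run leaves nothing
  as long as its parity is the fixed one. Other deletions either keep that parity or shorten the
  first letter without shortening the run. The second claim is the first one for
  \<open>Be k (ecol k) t\<close>, in the form the induction needs.\<close>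

lemma keys_diff_parity:
  assumes "first_id_run t = 0"
  shows "fixed_parity k t \<Longrightarrow> keys (tail_diff a t) \<subseteq>
      {s. fixed_parity k s \<or> first_len s < first_len t \<and> run k t \<le> run k s}"
    and "\<not> fixed_parity k t \<Longrightarrow> keys (tail_diff a (Be k (ecol k) t)) \<subseteq>
      {s. fixed_parity k s \<or> first_len s < Suc (first_len t) \<and> Suc (run k t) \<le> run k s}"
  using assms
proof (induction t rule: tail_induct)
  case (Cl c w)
  { case 1
    then show ?case using keys_diff_Cl[of a c w] by auto
  next
    case 2
    have "keys (be_act a k (ecol k) (Cl c w)) \<subseteq> {s. fixed_parity k s}"
      by (auto intro!: keys_scale_subset)
    moreover have "keys (lin (\<lambda>s. basis (Be k (ecol k) s)) (tail_diff a (Cl c w))) \<subseteq> {s. fixed_parity k s}"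
      using 2 by (intro keys_lin_basisI[OF keys_diff_Cl]) auto
    ultimately have "keys (tail_diff a (Be k (ecol k) (Cl c w))) \<subseteq> {s. fixed_parity k s}"
      unfolding tail_diff.simps(3) by (rule keys_diff_subset)
    then show ?case by auto }
next
  case (Be i j t)
  have no_id: "first_id_run t = 0" if "first_id_run (Be i j t) = 0" using that by simp
  have act: "fixed_parity k s \<or> first_len s \<le> n \<and> Suc 0 \<le> run k s"
    if "s \<in> keys (be_act a k l u)" "first_id_run u = 0" "first_len u = n" for l u s n
    using keys_be_act_head[of a k l u] keys_be_act_no_id[of u a k l] that
    by (cases s) (auto)
  { case 1
    show ?case
    proof (cases "j = ecol k")
      case True
      then show ?thesis using Be(2) 1 by auto
    next
      case False
      have "keys (be_act a k j t) \<subseteq> {s. fixed_parity k s \<or> first_len s < Suc (first_len t) \<and> 0 \<le> run k s}"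
        using act[of _ j t "first_len t"] 1 by fastforce
      moreover have "keys (lin (\<lambda>s. basis (Be k j s)) (tail_diff a t)) \<subseteq>
          {s. fixed_parity k s \<or> first_len s < Suc (first_len t) \<and> 0 \<le> run k s}"
        using keys_lin_basis[of "Be k j" "tail_diff a t"] False by auto
      ultimately show ?thesis using 1 False by (simp add: keys_diff_subset)
    qed
  next
    case 2
    show ?case
    proof (cases "i = k")
      case True
      with 2 have j: "j = ecol k" and t: "fixed_parity k t" by auto
      \<comment> \<open>Merging the two copies and absorbing the second one into \<open>t\<close>
        give the same tail with opposite signs.\<close>
      have "tail_diff a (Be k (ecol k) (Be k (ecol k) t))
          = lin (\<lambda>s. basis (Be k (ecol k) s)) (lin (\<lambda>s. basis (Be k (ecol k) s)) (tail_diff a t))"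
        using t be_act_fixed[OF t, of a]
        by (simp add: lin_simps) (cases k; simp add: row_loops_def)
      then show ?thesis
        using keys_lin_basis[of "Be k (ecol k)" "tail_diff a t"] True j
          keys_lin_basis[of "Be k (ecol k)" "lin (\<lambda>s. basis (Be k (ecol k) s)) (tail_diff a t)"]
          Be(1)[OF t] 2 by fastforce
    next
      case False
      have "keys (be_act a k (ecol k) (Be i j t)) \<subseteq> {s. fixed_parity k s \<or>
          first_len s < Suc (first_len (Be i j t)) \<and> Suc (run k (Be i j t)) \<le> run k s}"
        using act[of _ "ecol k" "Be i j t" "Suc (first_len t)"] 2 False by fastforce
      moreover have "keys (lin (\<lambda>s. basis (Be k (ecol k) s)) (tail_diff a (Be i j t))) \<subseteq> {s. fixed_parity k s \<or>
          first_len s < Suc (first_len (Be i j t)) \<and> Suc (run k (Be i j t)) \<le> run k s}"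
      proof -
        have "fixed_parity k (Be k (ecol k) s) \<or> first_len (Be k (ecol k) s) < Suc (first_len (Be i j t))
          \<and> Suc (run k (Be i j t)) \<le> run k (Be k (ecol k) s)" if "row_head i s" for s
          using that False by (cases s) auto
        then show ?thesis
          using keys_lin_basis[of "Be k (ecol k)" "tail_diff a (Be i j t)"] keys_diff_head[of a i j t]
          by blast
      qed
      ultimately show ?thesis unfolding tail_diff.simps(3)[of a k "ecol k"] by (rule keys_diff_subset)
    qed }
qed auto

text \<open>The two mergers of a pair of adjacent identities with what follows cancel, so the pair
  passes through the differential and only the parity of a run matters.\<close>

lemma keys_diff_id_run:
  "even (id_run t) \<Longrightarrow> keys (tail_diff a t) \<subseteq> {s. even (id_run s)}"
  "odd (id_run t) \<Longrightarrow> keys (tail_diff a (Idt t)) \<subseteq> {s. even (id_run s) \<and> id_run s > 0}"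
proof (induction t rule: tail_induct)
  case (Cl c w)
  { case 1
    then show ?case using keys_diff_Cl[of a c w] by auto
  next
    case 2
    then show ?case by simp }
next
  case (Idt t)
  { case 1
    then show ?case using Idt(2) by auto
  next
    case 2
    have "tail_diff a (Idt (Idt t)) = lin (\<lambda>s. basis (Idt s)) (lin (\<lambda>s. basis (Idt s)) (tail_diff a t))"
      by (simp add: lin_simps)
    then show ?case
      using keys_lin_basis[of "Idt" "tail_diff a t"] 2 Idt(1)
        keys_lin_basis[of "Idt" "lin (\<lambda>s. basis (Idt s)) (tail_diff a t)"] by fastforce }
next
  case (Be i j t)
  { case 1
    have "even (id_run s)" if "row_head i s" for s using that by (cases s) auto
    then show ?case using keys_diff_head[of a i j t] by blast
  next
    case 2
    then show ?case by simp }
qed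

lemma first_id_run_dup_id: "odd (first_id_run t) \<Longrightarrow> first_id_run (dup_id t) = Suc (first_id_run t)"
  by (induction t rule: tail_induct) auto

text \<open>Tails of symbols that are negligible when a run of identities is extended: not
  \<open>lower\<close> because their run is even, or of smaller \<open>rank\<close> because they are
  shorter.\<close>

definition id_lower :: "nat \<Rightarrow> tail set" where
  "id_lower n = {s. first_id_run s \<noteq> 0 \<and> even (first_id_run s) \<or> first_len s < n}"

lemma keys_diff_Idt:
  assumes "odd (id_run t)"
  shows "keys (tail_diff a (Idt t)) \<subseteq> {s. first_id_run s \<noteq> 0 \<and> even (first_id_run s)}"
proof -
  have "first_id_run s = id_run s" if "id_run s > 0" for s
    using that by (cases s) auto
  then show ?thesis using keys_diff_id_run(2)[OF assms, of a] by auto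
qed

text \<open>The surviving term deletes the bar in front of the identities; every diagram before that
  bar changes its sign once, which accounts for \<epsilon>.\<close>

lemma tail_diff_dup_id:
  "odd (first_id_run (Be i j t)) \<Longrightarrow> \<exists>\<epsilon>\<in>{1, -1}. \<exists>r. tail_diff a (dup_id (Be i j t)) =
     scale \<epsilon> (basis (Be i j t)) + r \<and> keys r \<subseteq> id_lower (Suc (first_len t))"
proof (induction t arbitrary: i j rule: tail_induct)
  case (Cl c w)
  then show ?case by simp
next
  case (Idt t)
  let ?r = "- lin (\<lambda>s. basis (Be i j s)) (tail_diff a (Idt (Idt t)))"
  have "keys (lin (\<lambda>s. basis (Be i j s)) (tail_diff a (Idt (Idt t)))) \<subseteq> id_lower (Suc (first_len (Idt t)))"
    by (rule keys_lin_basisI[OF keys_diff_Idt]) (use Idt in \<open>auto simp: id_lower_def\<close>)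
  then have "tail_diff a (dup_id (Be i j (Idt t))) = scale 1 (basis (Be i j (Idt t))) + ?r \<and>
      keys ?r \<subseteq> id_lower (Suc (first_len (Idt t)))"
    by simp
  then show ?case by blast
next
  case (Be k l t)
  then have odd: "odd (first_id_run t)" by simp
  obtain \<epsilon> r where r: "\<epsilon> \<in> {1, -1}" "tail_diff a (dup_id (Be k l t)) = scale \<epsilon> (basis (Be k l t)) + r"
    "keys r \<subseteq> id_lower (Suc (first_len t))"
    using Be.IH[of k l] odd unfolding first_id_run.simps by blast
  let ?r = "be_act a i j (Be k l (dup_id t)) - lin (\<lambda>s. basis (Be i j s)) r"
  have "tail_diff a (dup_id (Be i j (Be k l t))) =
      be_act a i j (Be k l (dup_id t)) - lin (\<lambda>s. basis (Be i j s)) (tail_diff a (dup_id (Be k l t)))"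
    by (simp only: dup_id.simps tail_diff.simps(3)[of a i j "Be k l (dup_id t)"])
  then have eq: "tail_diff a (dup_id (Be i j (Be k l t))) = scale (- \<epsilon>) (basis (Be i j (Be k l t))) + ?r"
    unfolding r(2) by (simp add: lin_simps)
  have "keys (be_act a i j (Be k l (dup_id t))) \<subseteq> id_lower (Suc (first_len (Be k l t)))"
    using odd first_id_run_dup_id[of t] by (auto intro!: keys_scale_subset simp: id_lower_def)
  moreover have "keys (lin (\<lambda>s. basis (Be i j s)) r) \<subseteq> id_lower (Suc (first_len (Be k l t)))"
    by (rule keys_lin_basisI[OF r(3)]) (auto simp: id_lower_def)
  ultimately have "keys ?r \<subseteq> id_lower (Suc (first_len (Be k l t)))"
    by (rule keys_diff_subset)
  moreover have "- \<epsilon> \<in> {1, -1}" using r(1) by auto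
  ultimately show ?case using eq by blast
qed

definition below :: "sy \<Rightarrow> sy set" where
  "below w = {v. lower v \<longrightarrow> rank v < rank w}"

lemma sy_diff_dup_id:
  assumes "odd (first_id_run t)"
  shows "\<exists>\<epsilon>\<in>{1, -1}. \<exists>r. sy_diff a (Sy c (dup_id t)) = scale \<epsilon> (basis (Sy c t)) + r \<and> keys r \<subseteq> below (Sy c t)"
proof -
  have below: "Sy k s \<in> below (Sy c t)" if "s \<in> id_lower (first_len t)" for k s
    using that by (auto simp: below_def id_lower_def)
  show ?thesis
  proof (cases t)
    case (Cl k w)
    then show ?thesis using assms by simp
  next
    case (Idt t1)
    let ?r = "- lin (\<lambda>s. basis (Sy c s)) (tail_diff a (Idt (Idt t1)))"
    have "keys (lin (\<lambda>s. basis (Sy c s)) (tail_diff a (Idt (Idt t1)))) \<subseteq> below (Sy c t)"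
      by (rule keys_lin_basisI[OF keys_diff_Idt])
        (use assms Idt in \<open>auto simp: below_def\<close>)
    then have "sy_diff a (Sy c (dup_id t)) = scale 1 (basis (Sy c t)) + ?r \<and> keys ?r \<subseteq> below (Sy c t)"
      using Idt by simp
    then show ?thesis by blast
  next
    case (Be i j t1)
    then obtain \<epsilon> r where r: "\<epsilon> \<in> {1, -1}" "tail_diff a (dup_id t) = scale \<epsilon> (basis t) + r"
      "keys r \<subseteq> id_lower (first_len t)"
      using tail_diff_dup_id[of i j t1 a] assms unfolding Be first_len.simps by blast
    let ?r = "cup_act a c (dup_id t) - lin (\<lambda>s. basis (Sy c s)) r"
    have eq: "sy_diff a (Sy c (dup_id t)) = scale (- \<epsilon>) (basis (Sy c t)) + ?r"
      by (simp add: r(2) lin_simps)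
    have "keys (cup_act a c (dup_id t)) \<subseteq> below (Sy c t)"
      using assms Be first_id_run_dup_id[of t1]
      by (auto intro!: keys_scale_subset simp: below_def)
    moreover have "keys (lin (\<lambda>s. basis (Sy c s)) r) \<subseteq> below (Sy c t)"
      by (rule keys_lin_basisI[OF r(3)]) (rule below)
    ultimately have "keys ?r \<subseteq> below (Sy c t)"
      by (rule keys_diff_subset)
    moreover have "- \<epsilon> \<in> {1, -1}" using r(1) by auto
    ultimately show ?thesis using eq by blast
  qed
qed

text \<open>The cup \<open>U\<close> composed with \<open>MBe R2 R2\<close> is \<open>N\<close>
  without a loop, so deleting the first bar gives back \<open>Sy N t\<close>. All other terms start
  with \<open>U\<close> and are either not \<open>lower\<close> or smaller in
  \<open>rank\<close>.\<close>

lemma sy_diff_up_N: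
  assumes t: "first_id_run t = 0"
  shows "\<exists>r. sy_diff a (Sy U (Be R2 R2 t)) = basis (Sy N t) + r \<and> keys r \<subseteq> below (Sy N t)"
proof -
  let ?r = "lin (\<lambda>s. basis (Sy U (Be R2 R2 s))) (tail_diff a t) - lin (\<lambda>s. basis (Sy U s)) (be_act a R2 R2 t)"
  have "sy_diff a (Sy U (Be R2 R2 t)) = basis (Sy N t) + ?r"
    by (simp add: lin_simps lin_lin row_cup_loops_def)
  moreover have "keys (lin (\<lambda>s. basis (Sy U (Be R2 R2 s))) (tail_diff a t)) \<subseteq> below (Sy N t)"
    by (rule keys_lin_basisI[OF keys_diff_no_id[OF t]]) (auto simp: below_def)
  moreover have "keys (lin (\<lambda>s. basis (Sy U s)) (be_act a R2 R2 t)) \<subseteq> below (Sy N t)"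
    by (rule keys_lin_basisI[OF keys_be_act_no_id[OF t]])
      (auto simp: below_def less_prod_def' split: tail.split row.split)
  ultimately show ?thesis by (meson keys_diff_subset)
qed

lemma run_le_first_len: "run k t \<le> first_len t"
  by (induction t rule: tail_induct) auto

lemma first_len_minus_run_less:
  assumes "first_len s < first_len t" "run k t \<le> run k s"
  shows "first_len s - run k s < first_len t - run k t"
  using assms run_le_first_len[of k s] by linarith

lemma keys_diff_no_id_head:
  assumes "first_id_run (Be i j t) = 0"
  shows "keys (tail_diff a (Be i j t)) \<subseteq> {s. row_head i s \<and> first_id_run s = 0}"
  using keys_diff_no_id[OF assms, of a] keys_diff_head[of a i j t] by blast

text \<open>The cup \<open>U\<close> absorbs \<open>MBe R2 R1\<close> without a loop, which gives
  the leading term. The other terms are compared by the left row of \<open>t\<close>, since only row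
  2 can prolong a run that is already there.\<close>

lemma sy_diff_up_U:
  assumes t: "first_id_run t = 0" "\<not> fixed_parity R2 t"
  shows "\<exists>r. sy_diff a (Sy U (Be R2 R1 t)) = basis (Sy U t) + r \<and> keys r \<subseteq> below (Sy U t)"
proof -
  let ?D = "\<lambda>t. lin (\<lambda>s. basis (Sy U (Be R2 R1 s))) (tail_diff a t)"
  let ?A = "lin (\<lambda>s. basis (Sy U s)) (be_act a R2 R1 t)"
  have eq: "sy_diff a (Sy U (Be R2 R1 t)) = basis (Sy U t) + (?D t - ?A)"
    by (simp add: lin_simps lin_lin row_cup_loops_def)
  have *: ?thesis if "keys (?D t) \<subseteq> below (Sy U t)" "keys ?A \<subseteq> below (Sy U t)"
    using eq keys_diff_subset[OF that] by blast
  have run_below: "Sy U (Be R2 R1 s) \<in> below (Sy U t)" if "row_head i s" "i \<noteq> R2" "first_id_run s = 0" for i s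
    using that by (cases s; cases i) (auto simp: below_def)
  show ?thesis
  proof (cases t)
    case (Cl c w)
    with t have c: "c = U" by (cases c) auto
    have "keys (?D t) \<subseteq> below (Sy U t)"
      unfolding Cl c lin_lin by (rule keys_lin_basisI[OF keys_diff_Cl]) (auto simp: below_def)
    moreover have "keys ?A \<subseteq> below (Sy U t)"
      unfolding Cl c by (auto simp: below_def lin_simps intro!: keys_scale_subset)
    ultimately show ?thesis by (rule *)
  next
    case (Be i j q)
    show ?thesis
    proof (cases i)
      case R1
      have "keys (?D t) \<subseteq> below (Sy U t)"
        unfolding Be R1
        by (rule keys_lin_basisI[OF keys_diff_no_id_head])
          (use t(1) Be R1 run_below[of R1] in auto)
      moreover have "keys ?A \<subseteq> below (Sy U t)"
        using t(1) R1 unfolding Be by (cases j) (auto simp: below_def lin_simps intro!: keys_scale_subset)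
      ultimately show ?thesis by (rule *)
    next
      case R3
      have "keys (?D t) \<subseteq> below (Sy U t)"
        unfolding Be R3
        by (rule keys_lin_basisI[OF keys_diff_no_id_head])
          (use t(1) Be R3 run_below[of R3] in auto)
      moreover have "keys ?A \<subseteq> below (Sy U t)"
        using t(1) R3 unfolding Be by (auto simp: below_def lin_simps)
      ultimately show ?thesis by (rule *)
    next
      case R2
      with t Be have j: "j = R1" and q: "fixed_parity R2 q" "first_id_run q = 0" by auto
      have act: "be_act a R2 R1 q = basis q" using be_act_fixed[OF q(1), of a] by simp
      let ?r = "lin (\<lambda>s. basis (Sy U (Be R2 R1 (Be R2 R1 s)))) (tail_diff a q)"
      \<comment> \<open>Deleting the bar between the two copies and deleting the bar behind them
        cancel; the first bar is left over.\<close>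
      have "sy_diff a (Sy U (Be R2 R1 t)) = basis (Sy U t) - ?r"
        unfolding Be R2 j by (simp add: lin_simps lin_lin row_cup_loops_def row_loops_def act)
      moreover have "keys ?r \<subseteq> below (Sy U t)"
      proof (rule keys_lin_basisI)
        show "keys (tail_diff a q) \<subseteq> {s. first_id_run s = 0 \<and>
            (fixed_parity R2 s \<or> first_len s < first_len q \<and> run R2 q \<le> run R2 s)}"
          using keys_diff_no_id[OF q(2), of a] keys_diff_parity(1)[OF q(2,1), of a] by blast
      next
        fix s assume "s \<in> {s. first_id_run s = 0 \<and>
            (fixed_parity R2 s \<or> first_len s < first_len q \<and> run R2 q \<le> run R2 s)}"
        \<comment> \<open>Two copies in front of a shorter \<open>s\<close> may be as long as
          \<open>t\<close>, which has one copy in front of \<open>q\<close>; in that case the longer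
          run decides.\<close>
        then show "Sy U (Be R2 R1 (Be R2 R1 s)) \<in> below (Sy U t)"
          using first_len_minus_run_less[of s q R2] by (auto simp: below_def Be R2 j)
      qed
      ultimately show ?thesis by (intro exI[of _ "- ?r"]) simp
    qed
  qed (use t in simp)
qed

text \<open>The leading term deletes the bar between the new idempotent and \<open>q\<close>. The
  terms of the two bars before it cancel for row 2; for rows 1 and 3 one of them starts with
  \<open>Be k R2\<close>, to which \<open>rank\<close> gives the least middle entry, and the other
  is not \<open>lower\<close>.\<close>

lemma sy_diff_up_z:
  assumes q: "first_id_run q = 0" "fixed_parity k q" "head_row q = k"
  shows "\<exists>r. sy_diff a (Sy U (Be R2 R3 (Be k (ecol k) q))) = basis (Sy U (Be R2 R3 q)) + r \<and>
    keys r \<subseteq> below (Sy U (Be R2 R3 q))"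
proof -
  let ?B = "below (Sy U (Be R2 R3 q))"
  let ?A = "basis (Sy U (Be k (ecol k) q)) - lin (\<lambda>s. basis (Sy U s)) (be_act a R2 R3 (Be k (ecol k) q))"
  let ?D = "lin (\<lambda>s. basis (Sy U (Be R2 R3 (Be k (ecol k) s)))) (tail_diff a q)"
  have "sy_diff a (Sy U (Be R2 R3 (Be k (ecol k) q))) = basis (Sy U (Be R2 R3 q)) + (?A - ?D)"
    by (simp add: lin_simps lin_lin row_cup_loops_def be_act_fixed[OF q(2)] del: be_act.simps)
  moreover have "keys ?A \<subseteq> ?B"
  proof (cases k)
    case R2
    then have "?A = 0" by (simp add: row_loops_def)
    then show ?thesis by simp
  next
    case R1
    show ?thesis
      by (rule keys_diff_subset) (use q R1 in \<open>auto simp: below_def lin_simps\<close>)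
  next
    case R3
    show ?thesis
      by (rule keys_diff_subset)
        (use q R3 in \<open>auto simp: below_def lin_simps row_loops_def intro!: keys_scale_subset\<close>)
  qed
  moreover have "keys ?D \<subseteq> ?B"
  proof (rule keys_lin_basisI)
    show "keys (tail_diff a q) \<subseteq> {s. first_id_run s = 0 \<and>
        (fixed_parity k s \<or> first_len s < first_len q \<and> run k q \<le> run k s)}"
      using keys_diff_no_id[OF q(1), of a] keys_diff_parity(1)[OF q(1,2), of a] by blast
  next
    fix s assume "s \<in> {s. first_id_run s = 0 \<and>
        (fixed_parity k s \<or> first_len s < first_len q \<and> run k q \<le> run k s)}"
    then show "Sy U (Be R2 R3 (Be k (ecol k) s)) \<in> ?B"
      using first_len_minus_run_less[of s q k] q(3) by (auto simp: below_def)
  qed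
  ultimately show ?thesis by (meson keys_diff_subset)
qed

theorem sy_diff_up:
  assumes "lower w"
  shows "\<exists>\<epsilon>\<in>{1, -1}. \<exists>r. sy_diff a (up w) = scale \<epsilon> (basis w) + r \<and> keys r \<subseteq> below w"
proof (cases w)
  case (Sy c t)
  show ?thesis
  proof (cases "first_id_run t = 0")
    case False
    then show ?thesis using sy_diff_dup_id[of t a c] assms Sy by auto
  next
    case True
    consider "c = N" | "c = U" "\<not> fixed_parity R2 t"
      | q where "c = U" "fixed_parity R2 t" "t = Be R2 R3 q" "fixed_parity (head_row q) q"
      using assms Sy True by (cases c) (auto split: if_splits)
    then show ?thesis
    proof cases
      case 1
      then show ?thesis using sy_diff_up_N[OF True, of a] Sy True by simp
    next
      case 2
      then show ?thesis using sy_diff_up_U[OF True, of a] Sy True by simp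
    next
      case 3
      then show ?thesis using sy_diff_up_z[of q "head_row q" a] Sy True by simp
    qed
  qed
qed (use assms in simp)

section \<open>Completeness of the matching\<close>

lemma dup_id_surj:
  "even (first_id_run t) \<Longrightarrow> first_id_run t \<noteq> 0 \<Longrightarrow> \<exists>s. dup_id s = t \<and> odd (first_id_run s)"
proof (induction t rule: tail_induct)
  case (Idt t)
  then obtain t' where "t = Idt t'" by (cases t) auto
  with Idt show ?case by (intro exI[of _ t]) auto
next
  case (Be i j t)
  then obtain s where "dup_id s = t" "odd (first_id_run s)" by auto
  then show ?case by (intro exI[of _ "Be i j s"]) simp
qed simp

lemma upper_up_lower:
  assumes "upper w"
  shows "\<exists>v. lower v \<and> up v = w"
proof (cases w)
  case (Sy c t)
  show ?thesis
  proof (cases "first_id_run t = 0")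
    case False
    then obtain s where "dup_id s = t" "odd (first_id_run s)"
      using assms Sy dup_id_surj[of t] by auto
    then show ?thesis using Sy by (intro exI[of _ "Sy c s"]) (auto elim: oddE)
  next
    case True
    then obtain j q where c: "c = U" and t: "t = Be R2 j q"
      and j: "case j of R1 \<Rightarrow> \<not> fixed_parity R2 q | R2 \<Rightarrow> \<not> (\<exists>w. q = Cl U w)
        | R3 \<Rightarrow> \<not> fixed_parity (head_row q) q \<and> \<not> (\<exists>w. q = Be R3 R2 (Cl U w))"
      using assms Sy by auto
    have q: "first_id_run q = 0" using True t by simp
    show ?thesis
    proof (cases j)
      case R1
      then show ?thesis using Sy c t j q by (intro exI[of _ "Sy U q"]) simp
    next
      case R2
      then show ?thesis using Sy c t j q by (intro exI[of _ "Sy N q"]) simp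
    next
      case R3
      show ?thesis
      proof (cases q)
        case (Cl c w)
        then show ?thesis using j R3 by (cases c) auto
      next
        case (Be i l p)
        then have l: "l = ecol i" and p: "fixed_parity i p" using j R3 by auto
        \<comment> \<open>The only conflict with the preference of \<open>head_row\<close> for row 1
          is \<open>i = R3\<close> in front of the cup \<open>U\<close>, which is the leading letter
          of \<open>y\<close> and excluded from \<open>upper\<close>.\<close>
        have "head_row p = i"
        proof (cases p)
          case (Cl c w)
          then show ?thesis using p j R3 Be l by (cases i) auto
        qed (use p in auto)
        then show ?thesis
          using Sy c t R3 Be l p q by (intro exI[of _ "Sy U (Be R2 R3 p)"]) simp
      qed (use q in simp)
    qed
  qed
qed (use assms in simp)

text \<open>The last four cases are the critical ones, in the order \<open>x\<close>,
  \<open>x\<close>-hat, \<open>r\<close>, \<open>y\<close>.\<close>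

lemma sy_cases:
  obtains "w = Emp" | "lower w" | "upper w" | v where "w = Sy U (Cl N v)" | v where "w = Sy N (Cl U v)"
  | v where "w = Sy U (Be R2 R2 (Cl U v))" | v where "w = Sy U (Be R2 R3 (Be R3 R2 (Cl U v)))"
proof (cases w)
  case (Sy c t)
  consider "first_id_run t \<noteq> 0" | "first_id_run t = 0" "c = N" | "first_id_run t = 0" "c = U"
    by (cases c) auto
  then show ?thesis
  proof cases
    case 3
    show ?thesis
    proof (cases "fixed_parity R2 t")
      case True
      show ?thesis
      proof (cases t)
        case (Be i j q)
        then show ?thesis using that 3 Sy True by (cases j) auto
      qed (use that 3 Sy True in auto)
    qed (use that 3 Sy in auto)
  qed (use that Sy in auto)
qed (use that in simp)

lemma not_lower_if_upper: "upper w \<Longrightarrow> \<not> lower w"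
  by (cases w) (auto split: if_splits row.splits, (metis row.exhaust)+)

lemma upper_up: "lower w \<Longrightarrow> upper (up w)"
proof (cases w)
  case (Sy c t)
  assume low: "lower w"
  show ?thesis
  proof (cases "first_id_run t = 0")
    case True
    then show ?thesis using low Sy by (cases c) (auto split: if_splits)
  qed (use low Sy first_id_run_dup_id[of t] in auto)
qed simp

lemma tail_deg_dup_id: "first_id_run t \<noteq> 0 \<Longrightarrow> tail_deg (dup_id t) = Suc (tail_deg t)"
  by (induction t rule: tail_induct) auto

lemma sy_deg_up: "lower w \<Longrightarrow> sy_deg (up w) = Suc (sy_deg w)"
proof (cases w)
  case (Sy c t)
  assume "lower w"
  then show ?thesis using Sy by (cases c) (auto simp: tail_deg_dup_id)
qed simp

section \<open>The free algebra\<close>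

lemma free_dga_eq: "free_dga a = monoid_dga word_deg (\<lambda>w. diff_letters a (letters w))"
  by (simp add: free_dga_def monoid_dga_def)

lemma word_deg_simps: "word_deg 0 = 0" "word_deg (v + w) = word_deg v + word_deg w"
  "word_deg (Word (g # l)) = gen_deg g + word_deg (Word l)" "word_deg (Word []) = 0"
  by (simp_all add: word_deg_def zero_word_def plus_word_def)

lemma one_eq_basis: "(1 :: 'k::monoid_add \<Rightarrow>\<^sub>0 'r::comm_ring_1) = basis 0"
  by simp

lemma keys_diff_gen: "keys (diff_gen a g) \<subseteq> {v. Suc (word_deg v) = gen_deg g}"
  for a :: "'r::comm_ring_1"
proof (cases g)
  case Y
  have "gen X * gen Xhat = (basis (Word [X, Xhat]) :: 'r free_alg)"
    by (simp add: gen_def basis_mult plus_word_def)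
  then show ?thesis unfolding Y diff_gen.simps
    by (intro keys_diff_subset keys_scale_subset) (auto simp: gen_def word_deg_def)
next
  case R
  then show ?thesis
    by (simp, intro keys_diff_subset) (auto simp: gen_def word_deg_def)
qed (auto intro!: keys_scale_subset simp: word_deg_simps)

lemma keys_diff_letters:
  "keys (diff_letters a l) \<subseteq> {v. Suc (word_deg v) = word_deg (Word l)}"
proof (induction l)
  case (Cons g l)
  have "keys (diff_gen a g * basis (Word l)) \<subseteq> {v. Suc (word_deg v) = word_deg (Word (g # l))}"
    by (rule keys_mult_subset[OF keys_diff_gen keys_basis]) (auto simp: word_deg_simps)
  moreover have "keys (gen g * diff_letters a l) \<subseteq> {v. Suc (word_deg v) = word_deg (Word (g # l))}"
    unfolding gen_def
    by (rule keys_mult_subset[OF keys_basis Cons]) (auto simp: word_deg_simps)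
  ultimately show ?case
    by (simp add: keys_add_subset keys_scale_subset)
qed simp

lemma diff_letters_append:
  "diff_letters a (v @ w) = diff_letters a v * basis (Word w)
     + scale ((-1) ^ word_deg (Word v)) (basis (Word v) * diff_letters a w)"
proof (induction v)
  case Nil
  then show ?case by (simp add: word_deg_simps flip: zero_word_def)
next
  case (Cons g v)
  have 1: "basis (Word (v @ w)) = (basis (Word v) * basis (Word w) :: 'a free_alg)"
    by (simp add: basis_mult plus_word_def)
  have 2: "basis (Word (g # v)) = (gen g * basis (Word v) :: 'a free_alg)"
    by (simp add: basis_mult plus_word_def gen_def)
  show ?case
    by (simp add: Cons 1 2 word_deg_simps scale.scale_right_distrib scale_mult_left scale_mult_right
        distrib_left distrib_right mult.assoc power_add)
qed

lemma graded_derivation_free: "graded_derivation word_deg (\<lambda>w. diff_letters a (letters w))"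
proof
  fix v w :: "gen word"
  show "keys (diff_letters a (letters w)) \<subseteq> {v. Suc (word_deg v) = word_deg w}"
    using keys_diff_letters[of a "letters w"] by simp
  show "diff_letters a (letters (v + w)) = diff_letters a (letters v) * basis w
      + scale ((-1) ^ word_deg v) (basis v * diff_letters a (letters w))"
    using diff_letters_append[of a "letters v" "letters w"] by (simp add: plus_word_def)
qed (simp_all add: word_deg_simps)

abbreviation free_diff :: "'r::comm_ring_1 \<Rightarrow> 'r free_alg \<Rightarrow> 'r free_alg" where
  "free_diff a \<equiv> lin (\<lambda>w. diff_letters a (letters w))"

lemmas free_diff_mult = graded_derivation.lin_\<delta>_mult[OF graded_derivation_free]

lemma free_diff_gen: "free_diff a (gen g) = diff_gen a g"
  by (simp add: gen_def flip: zero_word_def)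

lemma keys_gen: "keys (gen g) \<subseteq> {w. word_deg w = gen_deg g}"
  by (auto simp: gen_def word_deg_def)

lemma free_diff_gen_mult:
  "free_diff a (gen g * u) = diff_gen a g * u + scale ((-1) ^ gen_deg g) (gen g * free_diff a u)"
  using free_diff_mult[OF keys_gen] by (simp add: free_diff_gen)

lemma free_diff_one: "free_diff a 1 = 0"
  by (simp add: one_eq_basis zero_word_def del: single_one)

lemma free_diff_diff_gen: "free_diff a (diff_gen a g) = 0"
proof (cases g)
  case Y
  then show ?thesis
    by (simp add: lin_simps free_diff_gen_mult free_diff_gen scale_mult_left scale_mult_right
        scale.scale_right_diff_distrib mult.commute)
qed (simp_all add: lin_simps free_diff_one free_diff_gen)

lemma free_diff_diff: "free_diff a (diff_letters a l) = 0"
proof (induction l)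
  case (Cons g l)
  have "free_diff a (diff_gen a g * basis (Word l)) =
      scale ((-1) ^ (gen_deg g - 1)) (diff_gen a g * diff_letters a l)"
    using free_diff_mult[of "diff_gen a g" "gen_deg g - 1" a "basis (Word l)"] keys_diff_gen[of a g]
    by (force simp: free_diff_diff_gen)
  moreover have "free_diff a (gen g * diff_letters a l) = diff_gen a g * diff_letters a l"
    by (simp add: free_diff_gen_mult Cons)
  \<comment> \<open>All generators have positive degree, so the truncated subtraction is
    exact.\<close>
  moreover have "(-1 :: 'a) ^ gen_deg g = - ((-1) ^ (gen_deg g - 1))"
    by (cases g) simp_all
  ultimately show ?case
    by (simp add: lin_simps)
qed (simp add: lin_zero)

lemma dg_algebra_free: "dg_algebra (free_dga a)"
  unfolding free_dga_eq
  by (rule graded_derivation.dg_algebra_monoid_dga[OF graded_derivation_free]) (rule free_diff_diff)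


section \<open>The comparison map to the model\<close>

primrec mgen :: "gen \<Rightarrow> (sy \<Rightarrow>\<^sub>0 'r::comm_ring_1)" where
  "mgen X = basis (Sy U (Cl N Emp))"
| "mgen Xhat = basis (Sy N (Cl U Emp))"
| "mgen R = basis (Sy U (Be R2 R2 (Cl U Emp)))"
| "mgen Y = basis (Sy U (Be R2 R1 (Be R1 R2 (Cl U Emp)))) + basis (Sy U (Be R2 R3 (Be R3 R2 (Cl U Emp))))
     - basis (Sy U (Be R2 R1 (Be R3 R2 (Cl U Emp)))) - basis (Sy U (Be R2 R3 (Be R1 R2 (Cl U Emp))))"

definition model_map :: "'r::comm_ring_1 free_alg \<Rightarrow> (sy \<Rightarrow>\<^sub>0 'r)" where
  "model_map = lin (\<lambda>w. prod_list (map mgen (letters w)))"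

lemma model_map_basis: "model_map (basis w) = prod_list (map mgen (letters w))"
  by (simp add: model_map_def)

lemma linear_map_model: "linear_map model_map"
  unfolding model_map_def by (rule linear_map_lin)

lemmas model_map_simps = module_hom.add[OF linear_map_model] module_hom.scale[OF linear_map_model]
  module_hom.diff[OF linear_map_model] module_hom.zero[OF linear_map_model]

lemma model_map_mult: "model_map (u * v) = model_map u * model_map v"
proof -
  have "model_map (basis w * v) = model_map (basis w) * model_map v" for w
    by (rule linear_map_eqI[of "\<lambda>v. model_map (basis w * v)" "\<lambda>v. model_map (basis w) * model_map v"])
      (simp_all add: linear_map_mult_left linear_map_id linear_map_comp[OF linear_map_model] linear_map_model
        basis_mult model_map_basis plus_word_def)
  then show ?thesis
    using linear_map_eqI[of "\<lambda>u. model_map (u * v)" "\<lambda>u. model_map u * model_map v" u]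
    by (simp add: linear_map_mult_right linear_map_id linear_map_comp[OF linear_map_model] linear_map_model)
qed

lemma model_map_gen: "model_map (gen g) = mgen g"
  by (simp add: gen_def model_map_basis)

lemma model_map_one: "model_map 1 = 1"
  by (simp add: one_eq_basis model_map_basis zero_word_def del: single_one)

abbreviation loop_diff :: "'r::comm_ring_1 \<Rightarrow> (sy \<Rightarrow>\<^sub>0 'r) \<Rightarrow> (sy \<Rightarrow>\<^sub>0 'r)" where
  "loop_diff a \<equiv> lin (sy_diff a)"

lemmas loop_diff_mult = graded_derivation.lin_\<delta>_mult[OF graded_derivation_sy]

lemma keys_mgen: "keys (mgen g) \<subseteq> {w. sy_deg w = gen_deg g}"
  by (cases g; simp only: mgen.simps; (intro keys_diff_subset keys_add_subset)?; simp)

lemma basis_Emp: "basis Emp = 1"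
  by (simp flip: zero_sy_def)

text \<open>For \<open>Y\<close> the signs make the terms from the first and from the last bar
  cancel in pairs. On the middle bar equal rows give a loop and \<open>MBe R2 R2\<close>, which adds
  up to \<open>- 2 a r\<close>; rows 1 and 3 give \<open>N\<close> on both sides, which is twice the
  product of \<open>x\<close> and \<open>x\<close>-hat.\<close>

lemma loop_diff_mgen: "loop_diff a (mgen g) = model_map (diff_gen a g)"
proof (cases g)
  case Y
  have XX: "basis (Sy U (Cl N Emp)) * basis (Sy N (Cl U Emp)) = (basis (Sy U (Cl N (Sy N (Cl U Emp)))) :: sy \<Rightarrow>\<^sub>0 'a)"
    by (simp add: basis_mult)
  have "loop_diff a (mgen Y) = scale 2 (mgen X * mgen Xhat) - scale (2 * a) (mgen R)"
    by (simp add: XX lin_simps row_cup_loops_def row_loops_def)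
      (rule poly_mapping_eqI, simp add: lookup_add lookup_minus algebra_simps)
  then show ?thesis using Y by (simp add: model_map_simps model_map_mult model_map_gen)
qed (simp_all add: model_map_simps model_map_gen model_map_one lin_simps cup_loops_def row_cup_loops_def
    basis_Emp)

declare mgen.simps [simp del]

lemma loop_diff_mgen_mult:
  "loop_diff a (mgen g * u) = loop_diff a (mgen g) * u + scale ((-1) ^ gen_deg g) (mgen g * loop_diff a u)"
  by (rule loop_diff_mult[OF keys_mgen])

lemma loop_diff_model_map: "loop_diff a (model_map u) = model_map (free_diff a u)"
proof -
  have "loop_diff a (model_map (basis (Word l))) = model_map (diff_letters a l)" for l
  proof (induction l)
    case (Cons g l)
    then show ?case
      by (simp add: model_map_basis loop_diff_mgen_mult loop_diff_mgen model_map_simps model_map_mult model_map_gen)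
  qed (simp add: model_map_basis model_map_simps, simp add: lin_zero flip: basis_Emp)
  then have "loop_diff a (model_map (basis w)) = model_map (free_diff a (basis w))" for w
    by (cases w) simp
  then show ?thesis
    by - (rule linear_map_eqI[of "\<lambda>u. loop_diff a (model_map u)" "\<lambda>u. model_map (free_diff a u)"],
      auto intro: linear_map_comp linear_map_model linear_map_lin)
qed


section \<open>The matching on the algebra\<close>

text \<open>Writing \<open>T\<close> for the image of the free algebra, \<open>combs P\<close> is the left \<open>T\<close>-module generated by the
  basis elements in \<open>P\<close>: so \<open>combs {Emp}\<close> is \<open>T\<close> itself, and \<open>combs {w. upper w}\<close> plays the role
  of \<open>Q\<close>.\<close>

definition comb :: "(gen \<Rightarrow> (sy \<Rightarrow>\<^sub>0 'r::comm_ring_1)) \<Rightarrow> (sy \<Rightarrow>\<^sub>0 'r)" where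
  "comb f = mgen X * f X + mgen Xhat * f Xhat + mgen R * f R + mgen Y * f Y"

inductive_set combs :: "sy set \<Rightarrow> (sy \<Rightarrow>\<^sub>0 'r::comm_ring_1) set" for P :: "sy set" where
  combs_zero: "0 \<in> combs P"
| combs_step: "keys s \<subseteq> P \<Longrightarrow> (\<And>g. f g \<in> combs P) \<Longrightarrow> comb f + s \<in> combs P"

lemma comb_zero: "comb (\<lambda>g. 0) = 0"
  by (simp add: comb_def)

lemma comb_add: "comb f + comb h = comb (\<lambda>g. f g + h g)"
  by (simp add: comb_def distrib_left algebra_simps)

lemma comb_scale: "scale c (comb f) = comb (\<lambda>g. scale c (f g))"
  by (simp add: comb_def scale.scale_right_distrib scale_mult_right)

lemma comb_single: "mgen g * u = comb (\<lambda>h. if h = g then u else 0)"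
  by (cases g) (simp_all add: comb_def)

lemma combs_elim:
  assumes "u \<in> combs P"
  obtains f s where "u = comb f + s" "keys s \<subseteq> P" "\<And>g. f g \<in> combs P"
  using assms
proof (cases rule: combs.cases)
  case combs_zero
  then show ?thesis using that[of "\<lambda>g. 0" 0] by (simp add: comb_zero combs.combs_zero)
qed (use that in blast)

lemma combs_keys: "keys s \<subseteq> P \<Longrightarrow> s \<in> combs P"
  using combs_step[of s P "\<lambda>g. 0"] by (simp add: comb_zero combs_zero)

lemma combs_mgen_mult: "u \<in> combs P \<Longrightarrow> mgen g * u \<in> combs P"
  using combs_step[of 0 P "\<lambda>h. if h = g then u else 0"] by (simp add: comb_single combs_zero)

lemma combs_add: "u \<in> combs P \<Longrightarrow> v \<in> combs P \<Longrightarrow> u + v \<in> combs P"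
proof (induction arbitrary: v rule: combs.induct)
  case (combs_step s f)
  obtain h s' where v: "v = comb h + s'" "keys s' \<subseteq> P" "\<And>g. h g \<in> combs P"
    using combs_elim[OF combs_step.prems] by blast
  have "comb f + s + v = comb (\<lambda>g. f g + h g) + (s + s')"
    by (simp add: v comb_add[symmetric])
  also have "\<dots> \<in> combs P"
    using combs_step v by (intro combs.combs_step keys_add_subset) auto
  finally show ?case .
qed simp

lemma combs_scale: "u \<in> combs P \<Longrightarrow> scale c u \<in> combs P"
proof (induction rule: combs.induct)
  case (combs_step s f)
  have "scale c (comb f + s) = comb (\<lambda>g. scale c (f g)) + scale c s"
    by (simp add: comb_scale scale.scale_right_distrib)
  then show ?case
    using combs_step by (auto intro!: combs.combs_step keys_scale_subset)
qed (simp add: combs.combs_zero)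

lemma combs_uminus: "u \<in> combs P \<Longrightarrow> - u \<in> combs P"
  using combs_scale[of u P "-1"] by simp

lemma combs_diff: "u \<in> combs P \<Longrightarrow> v \<in> combs P \<Longrightarrow> u - v \<in> combs P"
  using combs_add[OF _ combs_uminus, of u P v] by simp

lemma combs_mono: "u \<in> combs P \<Longrightarrow> P \<subseteq> P' \<Longrightarrow> u \<in> combs P'"
proof (induction rule: combs.induct)
  case (combs_step s f)
  then show ?case by (intro combs.combs_step) auto
qed (rule combs.combs_zero)

text \<open>The differentials of the generators are the coefficients that the Leibniz rule puts in
  front of an element of \<open>combs P\<close>.\<close>

lemma combs_model_map_mult: "u \<in> combs P \<Longrightarrow> model_map (diff_gen a g) * u \<in> combs P"
  by (cases g)
    (auto simp: model_map_simps model_map_mult model_map_gen model_map_one scale_mult_left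
      left_diff_distrib mult.assoc intro!: combs_diff combs_scale combs_mgen_mult)

text \<open>The only term of \<open>mgen g * basis v\<close> that is not
  \<open>upper\<close>.\<close>

primrec lead :: "gen \<Rightarrow> sy \<Rightarrow> sy" where
  "lead X v = Sy U (Cl N v)"
| "lead Xhat v = Sy N (Cl U v)"
| "lead R v = Sy U (Be R2 R2 (Cl U v))"
| "lead Y v = Sy U (Be R2 R3 (Be R3 R2 (Cl U v)))"

lemma lead_inject: "lead g v = lead h w \<longleftrightarrow> g = h \<and> v = w"
  by (cases g; cases h) auto

definition critical :: "sy \<Rightarrow> bool" where
  "critical w \<longleftrightarrow> (\<exists>g v. w = lead g v)"

lemma not_critical: "upper w \<Longrightarrow> \<not> critical w" "lower w \<Longrightarrow> \<not> critical w" "\<not> critical Emp"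
proof -
  have "\<not> upper (lead g v) \<and> \<not> lower (lead g v) \<and> lead g v \<noteq> Emp" for g v
    by (cases g) simp_all
  then show "upper w \<Longrightarrow> \<not> critical w" "lower w \<Longrightarrow> \<not> critical w" "\<not> critical Emp"
    by (auto simp: critical_def) metis
qed

lemma cases_critical:
  obtains "w = Emp" | "lower w" | "upper w" | g v where "w = lead g v"
  by (cases w rule: sy_cases) (metis lead.simps)+

lemma mgen_mult_basis:
  "mgen g * basis v - basis (lead g v) \<in> {u :: sy \<Rightarrow>\<^sub>0 'r::comm_ring_1. keys u \<subseteq> {w. upper w}}"
proof (cases g)
  case Y
  have "mgen Y * basis v - basis (lead Y v) = (basis (Sy U (Be R2 R1 (Be R1 R2 (Cl U v))))
      - basis (Sy U (Be R2 R1 (Be R3 R2 (Cl U v)))) - basis (Sy U (Be R2 R3 (Be R1 R2 (Cl U v)))) :: sy \<Rightarrow>\<^sub>0 'r)"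
    by (simp add: mgen.simps distrib_right left_diff_distrib basis_mult)
  also have "keys \<dots> \<subseteq> {w. upper w}"
    by (intro keys_diff_subset) simp_all
  finally show ?thesis using Y by simp
qed (simp_all add: mgen.simps basis_mult)

text \<open>A left inverse to multiplication by \<open>mgen g\<close>. It sees only leading symbols,
  so it ignores the \<open>upper\<close> terms and recovers each coefficient of a
  \<open>comb\<close>; this is the uniqueness of such expressions.\<close>

definition strip :: "gen \<Rightarrow> (sy \<Rightarrow>\<^sub>0 'r::comm_ring_1) \<Rightarrow> (sy \<Rightarrow>\<^sub>0 'r)" where
  "strip g = lin (\<lambda>w. if \<exists>v. w = lead g v then basis (THE v. w = lead g v) else 0)"

lemma linear_map_strip: "linear_map (strip g)"
  unfolding strip_def by (rule linear_map_lin)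

lemma strip_lead: "strip g (basis (lead h v)) = (if g = h then basis v else 0)"
  by (auto simp: strip_def lead_inject)

lemma strip_eq_0:
  assumes "\<And>w. w \<in> keys s \<Longrightarrow> \<not> critical w"
  shows "strip g s = 0"
proof (rule linear_map_eqI[OF linear_map_strip linear_map_zero])
  fix w assume "w \<in> keys s"
  with assms show "strip g (basis w) = 0"
    by (auto simp: strip_def critical_def)
qed

lemma strip_mgen_mult: "strip g (mgen h * u) = (if g = h then u else 0)"
proof -
  have "strip g (mgen h * basis w) = (if g = h then basis w else 0)" for w
  proof -
    have "strip g (mgen h * basis w) =
        strip g (basis (lead h w)) + strip g (mgen h * basis w - basis (lead h w))"
      by (simp flip: module_hom.add[OF linear_map_strip])
    also have "strip g (mgen h * basis w - basis (lead h w)) = 0"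
      using mgen_mult_basis[of h w] not_critical by (intro strip_eq_0) blast
    finally show ?thesis by (simp add: strip_lead)
  qed
  then show ?thesis
    by - (rule linear_map_eqI[of "\<lambda>u. strip g (mgen h * u)" "\<lambda>u. if g = h then u else 0"];
      cases "g = h"; simp add: linear_map_comp[OF linear_map_strip] linear_map_mult_left linear_map_id linear_map_zero)
qed

lemma strip_comb:
  assumes "\<And>w. w \<in> keys s \<Longrightarrow> \<not> critical w"
  shows "strip g (comb f + s) = f g"
  by (cases g) (simp_all add: comb_def module_hom.add[OF linear_map_strip] strip_mgen_mult
      strip_eq_0[OF assms])

lemma keys_mgen_mult:
  fixes u :: "sy \<Rightarrow>\<^sub>0 'r::comm_ring_1"
  shows "keys (mgen g * u) \<subseteq> {w. critical w \<or> upper w}"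
proof -
  have "keys (mgen g * basis v :: sy \<Rightarrow>\<^sub>0 'r) \<subseteq> {w. critical w \<or> upper w}" for v
  proof -
    have "keys (basis (lead g v) + (mgen g * basis v - basis (lead g v)) :: sy \<Rightarrow>\<^sub>0 'r)
        \<subseteq> {w. critical w \<or> upper w}"
      using mgen_mult_basis[of g v] by (intro keys_add_subset) (auto simp: critical_def)
    then show ?thesis by simp
  qed
  then have "keys (lin (\<lambda>v. mgen g * basis v) u) \<subseteq> {w. critical w \<or> upper w}"
    by (intro keys_lin_subset[OF order.refl])
  then show ?thesis
    by (subst linear_map_eq_lin[of "\<lambda>u. mgen g * u"]) (simp_all add: linear_map_mult_left linear_map_id)
qed

lemma keys_comb: "keys (comb f) \<subseteq> {w. critical w \<or> upper w}"
  unfolding comb_def by (intro keys_add_subset keys_mgen_mult)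

lemma loop_diff_comb:
  "loop_diff a (comb f) = comb (\<lambda>g. scale ((-1) ^ gen_deg g) (loop_diff a (f g)))
     + (model_map (diff_gen a X) * f X + model_map (diff_gen a Xhat) * f Xhat
      + model_map (diff_gen a R) * f R + model_map (diff_gen a Y) * f Y)"
  by (simp add: comb_def lin_simps loop_diff_mgen_mult loop_diff_mgen scale_mult_right del: gen_deg.simps)

text \<open>Triangularity: if \<open>x\<close> is a key of \<open>s\<close> whose partner has
  maximal rank, no other key contributes to the coefficient of that partner in the differential, and
  \<open>x\<close> contributes its own coefficient up to sign.\<close>

lemma upper_eq_0:
  fixes s :: "sy \<Rightarrow>\<^sub>0 'r::comm_ring_1"
  assumes s: "keys s \<subseteq> {w. upper w}" and d: "\<And>w. w \<in> keys (loop_diff a s) \<Longrightarrow> \<not> lower w"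
  shows "s = 0"
proof (rule ccontr)
  assume "s \<noteq> 0"
  define low where "low x = (SOME v. lower v \<and> up v = x)" for x
  have low: "lower (low x) \<and> up (low x) = x" if "x \<in> keys s" for x
    unfolding low_def by (rule someI_ex) (use upper_up_lower s that in auto)
  have "finite (rank ` low ` keys s)" "rank ` low ` keys s \<noteq> {}"
    using \<open>s \<noteq> 0\<close> by auto
  then have "Max (rank ` low ` keys s) \<in> rank ` low ` keys s"
    by (rule Max_in)
  then obtain x where x: "x \<in> keys s" "rank (low x) = Max (rank ` low ` keys s)"
    by (metis imageE)
  have max: "rank (low y) \<le> rank (low x)" if "y \<in> keys s" for y
    using that x(2) by simp
  have lookup: "Poly_Mapping.lookup (sy_diff a y) (low x) = 0" if y: "y \<in> keys s" "y \<noteq> x" for y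
  proof -
    have "lower (low y)" "up (low y) = y" using low[OF y(1)] by simp_all
    from sy_diff_up[OF this(1), of a] this(2) obtain \<epsilon> r
      where r: "sy_diff a y = scale \<epsilon> (basis (low y)) + r" "keys r \<subseteq> below (low y)" by metis
    have "low x \<notin> keys r"
      using r(2) max[OF y(1)] low[OF x(1)] by (force simp: below_def)
    moreover have "low y \<noteq> low x" using low[OF y(1)] low[OF x(1)] y(2) by metis
    ultimately show ?thesis by (simp add: r(1) lookup_add lookup_single in_keys_iff)
  qed
  have "lower (low x)" "up (low x) = x" using low[OF x(1)] by simp_all
  from sy_diff_up[OF this(1), of a] this(2) obtain \<epsilon> r where \<epsilon>: "\<epsilon> \<in> {1, -1}"
    and r: "sy_diff a x = scale \<epsilon> (basis (low x)) + r" "keys r \<subseteq> below (low x)" by metis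
  have "low x \<notin> keys r"
    using r(2) low[OF x(1)] by (force simp: below_def)
  then have lookup_x: "Poly_Mapping.lookup (sy_diff a x) (low x) = \<epsilon>"
    by (simp add: r(1) lookup_add in_keys_iff)
  have "Poly_Mapping.lookup (loop_diff a s) (low x) =
      (\<Sum>y\<in>keys s. Poly_Mapping.lookup s y * Poly_Mapping.lookup (sy_diff a y) (low x))"
    by (simp add: lin_def lookup_sum)
  also have "\<dots> = Poly_Mapping.lookup s x * \<epsilon>"
    using x(1) lookup lookup_x by (subst sum.remove[of _ x]) (auto intro!: sum.neutral)
  finally have "Poly_Mapping.lookup (loop_diff a s) (low x) \<noteq> 0"
    using x(1) \<epsilon> by (auto simp: in_keys_iff)
  then show False using d low[OF x(1)] by (auto simp: in_keys_iff)
qed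

text \<open>Up to elements of \<open>?K\<close> the differential acts on \<open>comb f\<close>
  through the coefficients \<open>f g\<close>. Products with generators have no \<open>lower\<close>
  keys, so neither has \<open>loop_diff a s\<close>, which forces \<open>s = 0\<close>; after that
  \<open>strip\<close> shows that every \<open>f g\<close> satisfies the same hypothesis.\<close>

lemma combs_upper_eq_0:
  fixes q :: "sy \<Rightarrow>\<^sub>0 'r::comm_ring_1"
  assumes "q \<in> combs {w. upper w}" and "loop_diff a q \<in> combs (insert Emp {w. upper w})"
  shows "q = 0"
  using assms
proof (induction rule: combs.induct)
  case (combs_step s f)
  let ?K = "combs (insert Emp {w. upper w}) :: (sy \<Rightarrow>\<^sub>0 'r) set"
  let ?e = "\<lambda>g. model_map (diff_gen a g) * f g"
  let ?h = "\<lambda>g. scale ((-1) ^ gen_deg g) (loop_diff a (f g))"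
  have "f g \<in> ?K" for g
    using combs_step(2) by (rule combs_mono) auto
  then have "?e X + ?e Xhat + ?e R + ?e Y \<in> ?K"
    by (intro combs_add combs_model_map_mult)
  then have "loop_diff a (comb f + s) - (?e X + ?e Xhat + ?e R + ?e Y) \<in> ?K"
    by (rule combs_diff[OF combs_step.prems])
  then have "comb ?h + loop_diff a s \<in> ?K"
    unfolding lin_add loop_diff_comb by (simp add: algebra_simps)
  then obtain h s' where h: "comb ?h + loop_diff a s = comb h + s'"
      "keys s' \<subseteq> insert Emp {w. upper w}" "\<And>g. h g \<in> ?K"
    using combs_elim by blast
  have s'_critical: "\<not> critical w" if "w \<in> keys s'" for w
    using h(2) that not_critical by blast
  have "loop_diff a s = comb h - comb ?h + s'"
    using h(1) by (simp add: algebra_simps)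
  also have "keys \<dots> \<subseteq> {w. critical w \<or> upper w \<or> w = Emp}"
  proof (intro keys_add_subset keys_diff_subset)
    show "keys (comb h) \<subseteq> {w. critical w \<or> upper w \<or> w = Emp}" "keys (comb ?h) \<subseteq> {w. critical w \<or> upper w \<or> w = Emp}"
      using keys_comb[of h] keys_comb[of ?h] by blast+
  qed (use h(2) in auto)
  finally have "\<not> lower w" if "w \<in> keys (loop_diff a s)" for w
    using that not_critical not_lower_if_upper[of w] by (auto simp del: lower.simps) (use lower.simps(1) in blast)
  then have s: "s = 0" by (rule upper_eq_0[OF combs_step(1)])
  have "f g = 0" for g
  proof -
    have "?h g = h g"
    proof -
      have "strip g (comb ?h + 0) = ?h g" by (rule strip_comb) simp
      moreover have "strip g (comb h + s') = h g" by (rule strip_comb) (rule s'_critical)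
      ultimately show ?thesis using h(1) s by (simp add: lin_zero)
    qed
    moreover have "(-1 :: 'r) ^ gen_deg g * (-1) ^ gen_deg g = 1"
      by (cases g) simp_all
    ultimately have "scale ((-1) ^ gen_deg g) (h g) = loop_diff a (f g)"
      by (metis scale.scale_scale scale.scale_one)
    then have "loop_diff a (f g) \<in> ?K"
      using combs_scale[OF h(3), of "(-1) ^ gen_deg g" g] by simp
    then show ?thesis by (rule combs_step.IH)
  qed
  then have "f = (\<lambda>g. 0)" by auto
  with s show ?case by (simp add: comb_zero)
qed simp


section \<open>The image of the free algebra\<close>

lemma combs_sum: "(\<And>i. i \<in> I \<Longrightarrow> f i \<in> combs P) \<Longrightarrow> sum f I \<in> combs P"
  by (induction I rule: infinite_finite_induct) (auto intro: combs_add combs_zero)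

lemma model_map_in_combs: "model_map u \<in> combs {Emp}"
proof -
  have "prod_list (map mgen l) \<in> (combs {Emp} :: (sy \<Rightarrow>\<^sub>0 'a) set)" for l
    by (induction l) (simp_all add: combs_mgen_mult, simp add: combs_keys flip: basis_Emp)
  then show ?thesis
    unfolding model_map_def lin_def by (intro combs_sum combs_scale)
qed

lemma combs_in_range_model_map: "v \<in> combs {Emp} \<Longrightarrow> v \<in> range model_map"
proof (induction rule: combs.induct)
  case combs_zero
  then show ?case by (metis model_map_simps(4) rangeI)
next
  case (combs_step s f)
  obtain t where t: "f g = model_map (t g)" for g
    using combs_step(3) unfolding image_iff by metis
  have "s = scale (Poly_Mapping.lookup s Emp) 1"
  proof (rule poly_mapping_eqI)
    fix w
    show "Poly_Mapping.lookup s w = Poly_Mapping.lookup (scale (Poly_Mapping.lookup s Emp) 1) w"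
      unfolding basis_Emp[symmetric] using combs_step(1)
      by (cases "w = Emp") (auto simp: lookup_single_not_eq in_keys_iff)
  qed
  then have "comb f + s = model_map (gen X * t X + gen Xhat * t Xhat + gen R * t R + gen Y * t Y
      + scale (Poly_Mapping.lookup s Emp) 1)"
    by (simp add: comb_def t model_map_simps model_map_mult model_map_gen model_map_one)
  then show ?case by (rule range_eqI)
qed

text \<open>The counterpart of \<open>strip\<close> on the side of the free algebra.\<close>

definition tl_word :: "gen \<Rightarrow> 'r::comm_ring_1 free_alg \<Rightarrow> 'r free_alg" where
  "tl_word g = lin (\<lambda>w. case letters w of [] \<Rightarrow> 0 | h # l \<Rightarrow> if h = g then basis (Word l) else 0)"

lemma linear_map_tl_word: "linear_map (tl_word g)"
  unfolding tl_word_def by (rule linear_map_lin)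

lemma free_alg_decomp:
  fixes u :: "'r::comm_ring_1 free_alg"
  shows "u = gen X * tl_word X u + gen Xhat * tl_word Xhat u + gen R * tl_word R u + gen Y * tl_word Y u
     + scale (Poly_Mapping.lookup u (Word [])) 1" (is "u = ?f u")
proof -
  have "linear_map (\<lambda>u :: 'r free_alg. scale (Poly_Mapping.lookup u (Word [])) (1 :: 'r free_alg))"
    by (intro linear_mapI) (simp_all add: lookup_add scale.scale_left_distrib)
  then have "linear_map ?f"
    by (intro linear_map_add linear_map_mult_left linear_map_tl_word)
  moreover have "basis (Word l) = ?f (basis (Word l))" for l
  proof (cases l)
    case Nil
    then show ?thesis by (simp add: tl_word_def one_eq_basis zero_word_def del: single_one)
  next
    case (Cons g l')
    then show ?thesis
      by (cases g) (simp_all add: tl_word_def gen_def basis_mult plus_word_def lookup_single)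
  qed
  then have "basis w = ?f (basis w)" for w by (cases w) simp
  ultimately show ?thesis by (rule linear_map_eqI[OF linear_map_id])
qed

text \<open>Applying \<open>strip g\<close> to the image of \<open>u\<close> gives the image of
  \<open>tl_word g u\<close>, whose words are shorter; the bound \<open>n\<close> on the lengths
  makes this an induction.\<close>

lemma model_map_eq_0:
  fixes u :: "'r::comm_ring_1 free_alg"
  assumes "model_map u = 0"
  shows "u = 0"
proof -
  have "(\<forall>w\<in>keys u. length (letters w) < n) \<Longrightarrow> model_map u = 0 \<Longrightarrow> u = 0" for n
    and u :: "'r free_alg"
  proof (induction n arbitrary: u)
    case 0
    then show ?case by simp
  next
    case (Suc n)
    let ?s = "scale (Poly_Mapping.lookup u (Word [])) 1 :: sy \<Rightarrow>\<^sub>0 'r"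
    have "keys ?s \<subseteq> {Emp}"
      by (intro keys_scale_subset) (simp flip: basis_Emp)
    then have s: "\<not> critical w" if "w \<in> keys ?s" for w
      using that not_critical by blast
    have "0 = model_map (gen X * tl_word X u + gen Xhat * tl_word Xhat u + gen R * tl_word R u
        + gen Y * tl_word Y u + scale (Poly_Mapping.lookup u (Word [])) 1)"
      using Suc.prems(2) by (simp flip: free_alg_decomp)
    also have "\<dots> = comb (\<lambda>g. model_map (tl_word g u)) + ?s"
      by (simp add: comb_def model_map_simps model_map_mult model_map_gen model_map_one)
    finally have eq: "comb (\<lambda>g. model_map (tl_word g u)) + ?s = 0" by simp
    have tl: "tl_word g u = 0" for g
    proof (rule Suc.IH)
      show "model_map (tl_word g u) = 0"
        using strip_comb[of ?s g "\<lambda>g. model_map (tl_word g u)"] s eq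
        by (simp add: module_hom.zero[OF linear_map_strip])
      have "keys (tl_word g u) \<subseteq> {w. length (letters w) < n}"
        unfolding tl_word_def
        by (rule keys_lin_subset[of _ "{w. length (letters w) < Suc n}"])
          (use Suc.prems(1) in \<open>auto split: list.splits\<close>)
      then show "\<forall>w\<in>keys (tl_word g u). length (letters w) < n" by auto
    qed
    have "?s = 0" using eq tl by (simp add: model_map_simps comb_zero)
    then have "Poly_Mapping.lookup u (Word []) = 0"
      by (metis basis_Emp lookup_scale lookup_single_eq lookup_zero mult.right_neutral)
    then show ?case using free_alg_decomp[of u] tl by simp
  qed
  moreover have "\<forall>w\<in>keys u. length (letters w) < Suc (Max ((\<lambda>w. length (letters w)) ` keys u))"
    by (auto simp: less_Suc_eq_le)
  ultimately show ?thesis using assms by blast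
qed

section \<open>Spanning by the free algebra, the upper symbols and their boundaries\<close>

definition decomposable :: "'r::comm_ring_1 \<Rightarrow> (sy \<Rightarrow>\<^sub>0 'r) set" where
  "decomposable a = {t + q + loop_diff a q' |t q q'.
     t \<in> combs {Emp} \<and> q \<in> combs {w. upper w} \<and> q' \<in> combs {w. upper w}}"

lemma decomposableI:
  "t \<in> combs {Emp} \<Longrightarrow> q \<in> combs {w. upper w} \<Longrightarrow> q' \<in> combs {w. upper w} \<Longrightarrow>
    u = t + q + loop_diff a q' \<Longrightarrow> u \<in> decomposable a"
  unfolding decomposable_def by blast

lemma decomposable_add: "u \<in> decomposable a \<Longrightarrow> v \<in> decomposable a \<Longrightarrow> u + v \<in> decomposable a"
proof -
  assume "u \<in> decomposable a" "v \<in> decomposable a"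
  then obtain t q q' s p p' where *: "t \<in> combs {Emp}" "q \<in> combs {w. upper w}" "q' \<in> combs {w. upper w}"
    "s \<in> combs {Emp}" "p \<in> combs {w. upper w}" "p' \<in> combs {w. upper w}"
    "u = t + q + loop_diff a q'" "v = s + p + loop_diff a p'"
    unfolding decomposable_def by blast
  then show ?thesis
    by (intro decomposableI[of "t + s" "q + p" "q' + p'"] combs_add) (simp_all add: lin_add)
qed

lemma decomposable_scale: "u \<in> decomposable a \<Longrightarrow> scale c u \<in> decomposable a"
proof -
  assume "u \<in> decomposable a"
  then obtain t q q' where *: "t \<in> combs {Emp}" "q \<in> combs {w. upper w}" "q' \<in> combs {w. upper w}"
    "u = t + q + loop_diff a q'"
    unfolding decomposable_def by blast
  then show ?thesis
    by (intro decomposableI[of "scale c t" "scale c q" "scale c q'"] combs_scale)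
      (simp_all add: lin_scale scale.scale_right_distrib)
qed

lemma decomposable_diff: "u \<in> decomposable a \<Longrightarrow> v \<in> decomposable a \<Longrightarrow> u - v \<in> decomposable a"
  using decomposable_add[of u a "scale (-1) v"] decomposable_scale[of v a "-1"] by simp

lemma decomposable_sum: "(\<And>i. i \<in> I \<Longrightarrow> f i \<in> decomposable a) \<Longrightarrow> sum f I \<in> decomposable a"
  by (induction I rule: infinite_finite_induct)
    (auto intro: decomposable_add decomposableI[of 0 0 0] combs_zero simp: lin_zero)

lemma decomposable_keys:
  assumes "\<And>w. w \<in> keys u \<Longrightarrow> basis w \<in> decomposable a"
  shows "u \<in> decomposable a"
proof -
  have "lin basis u \<in> decomposable a"
    unfolding lin_def using assms by (intro decomposable_sum decomposable_scale)
  then show ?thesis by (simp add: lin_basis_id)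
qed

lemma decomposable_upper: "keys u \<subseteq> {w. upper w} \<Longrightarrow> u \<in> decomposable a"
  by (intro decomposableI[of 0 u 0] combs_keys combs_zero) (simp_all add: lin_zero)

lemma decomposable_loop_diff_upper: "keys u \<subseteq> {w. upper w} \<Longrightarrow> loop_diff a u \<in> decomposable a"
  by (intro decomposableI[of 0 0 u] combs_keys combs_zero) simp_all

text \<open>The Leibniz rule exchanges \<open>mgen g * loop_diff a q'\<close> for a boundary, at the
  cost of a term in which the differential of the generator multiplies \<open>q'\<close>.\<close>

lemma decomposable_mgen_mult:
  assumes "u \<in> decomposable a"
  shows "mgen g * u \<in> decomposable a"
proof -
  obtain t q q' where *: "t \<in> combs {Emp}" "q \<in> combs {w. upper w}" "q' \<in> combs {w. upper w}"
    "u = t + q + loop_diff a q'"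
    using assms unfolding decomposable_def by blast
  let ?e = "(-1 :: 'a) ^ gen_deg g"
  have "?e * ?e = 1" by (cases g) simp_all
  then have "mgen g * loop_diff a q' = loop_diff a (scale ?e (mgen g * q'))
      - scale ?e (model_map (diff_gen a g) * q')"
    by (simp add: lin_scale loop_diff_mgen_mult loop_diff_mgen scale.scale_right_distrib)
  then have "mgen g * u = mgen g * t + (mgen g * q - scale ?e (model_map (diff_gen a g) * q'))
      + loop_diff a (scale ?e (mgen g * q'))"
    by (simp add: *(4) distrib_left)
  then show ?thesis
    by (rule decomposableI[rotated 3]; intro combs_mgen_mult combs_diff combs_scale combs_model_map_mult *)
qed

text \<open>A critical symbol is reduced to its remainder behind the first letter, which has smaller
  degree. A \<open>lower\<close> symbol is, up to sign, the boundary of its partner minus terms of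
  the same degree that are not \<open>lower\<close> or have smaller rank. Hence an induction on rank
  inside one on degree.\<close>

lemma decomposable_basis: "basis w \<in> decomposable a"
proof (induction "sy_deg w" arbitrary: w rule: less_induct)
  case less
  have not_lower: "basis v \<in> decomposable a" if v: "sy_deg v = sy_deg w" "\<not> lower v" for v
  proof (cases v rule: cases_critical)
    case 1
    then show ?thesis
      by (intro decomposableI[of "basis Emp" 0 0] combs_keys combs_zero) (simp_all add: lin_zero)
  next
    case 3
    then show ?thesis by (intro decomposable_upper) simp
  next
    case (4 g v')
    have "sy_deg v' < sy_deg w" using v(1) 4 by (cases g) simp_all
    then have "mgen g * basis v' \<in> decomposable a"
      by (intro decomposable_mgen_mult less)
    moreover have "mgen g * basis v' - basis v \<in> decomposable a"
      unfolding 4 using mgen_mult_basis[of g v'] by (intro decomposable_upper) simp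
    ultimately have "mgen g * basis v' - (mgen g * basis v' - basis v) \<in> decomposable a"
      by (rule decomposable_diff)
    then show ?thesis by simp
  qed (use v in simp)
  have "sy_deg v = sy_deg w \<Longrightarrow> basis v \<in> decomposable a" for v
  proof (induction "rank v" arbitrary: v rule: less_induct)
    case (less v)
    show ?case
    proof (cases "lower v")
      case False
      with less.prems show ?thesis by (rule not_lower)
    next
      case True
      then obtain \<epsilon> r where \<epsilon>: "\<epsilon> \<in> {1, -1}" and r: "sy_diff a (up v) = scale \<epsilon> (basis v) + r"
        "keys r \<subseteq> below v"
        using sy_diff_up[of v a] by metis
      have "basis x \<in> decomposable a" if x: "x \<in> keys r" for x
      proof -
        have deg: "sy_deg x = sy_deg w"
        proof -
          \<comment> \<open>The map \<open>up\<close> raises the degree by one and the differential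
            lowers it again.\<close>
          have "keys r \<subseteq> {x. sy_deg x = sy_deg v}"
          proof -
            have "keys (sy_diff a (up v) - scale \<epsilon> (basis v)) \<subseteq> {x. sy_deg x = sy_deg v}"
              using keys_sy_diff(2)[of a "up v"] sy_deg_up[OF True]
              by (intro keys_diff_subset keys_scale_subset) auto
            then show ?thesis by (simp add: r(1))
          qed
          with x less.prems show ?thesis by auto
        qed
        show ?thesis
        proof (cases "lower x")
          case True
          then show ?thesis using x r(2) deg by (intro less.hyps) (auto simp: below_def)
        qed (use deg not_lower in blast)
      qed
      then have "r \<in> decomposable a" by (rule decomposable_keys)
      moreover have "sy_diff a (up v) \<in> decomposable a"
        using decomposable_loop_diff_upper[of "basis (up v)" a] upper_up[OF True] by simp
      ultimately have "scale \<epsilon> (sy_diff a (up v) - r) \<in> decomposable a"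
        by (intro decomposable_scale decomposable_diff)
      moreover have "\<epsilon> * \<epsilon> = 1" using \<epsilon> by auto
      ultimately show ?thesis by (simp add: r(1))
    qed
  qed
  then show ?case by simp
qed

lemma decomposable_UNIV: "u \<in> decomposable a"
  by (rule decomposable_keys) (rule decomposable_basis)

section \<open>Quasi-isomorphisms\<close>

context dg_algebra
begin

lemma homog_subset_total: "homog A n \<subseteq> total A"
  unfolding total_def using module.span_superset[OF module_scal] by blast

lemma subspace_total: "module.subspace (scal A) (total A)"
  unfolding total_def by (rule module.subspace_span[OF module_scal])

lemma diff_uminus: "u \<in> total A \<Longrightarrow> diff A (- u) = - diff A u"
  using diff_scal[of u "-1"] module.scale_minus_left[OF module_scal, of 1]
    module.scale_one[OF module_scal] by simp

lemma homog_diff: "u \<in> homog A n \<Longrightarrow> v \<in> homog A n \<Longrightarrow> u - v \<in> homog A n"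
  by (rule module.subspace_diff[OF module_scal subspace_homog])

lemma diff_minus: "u \<in> homog A n \<Longrightarrow> v \<in> homog A n \<Longrightarrow> diff A (u - v) = diff A u - diff A v"
proof -
  assume "u \<in> homog A n" "v \<in> homog A n"
  then have "u \<in> total A" "v \<in> total A" "- v \<in> total A"
    using homog_subset_total[of n] module.subspace_neg[OF module_scal subspace_total, of v] by auto
  then show ?thesis using diff_add[of u "- v"] by (simp add: diff_uminus)
qed

lemma boundaries_diff: "u \<in> boundaries A n \<Longrightarrow> v \<in> boundaries A n \<Longrightarrow> u - v \<in> boundaries A n"
proof -
  assume "u \<in> boundaries A n" "v \<in> boundaries A n"
  then obtain x y where "x \<in> homog A (Suc n)" "y \<in> homog A (Suc n)" "u = diff A x" "v = diff A y"
    by (auto simp: boundaries_def)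
  then show ?thesis
    using diff_minus[of x "Suc n" y] homog_diff[of x "Suc n" y]
    by (auto simp: boundaries_def intro: image_eqI[of _ "diff A" "x - y"])
qed

lemma zero_boundary: "0 \<in> boundaries A n"
  using boundaries_diff[of "diff A 0" n "diff A 0"] module.subspace_0[OF module_scal subspace_homog]
  by (force simp: boundaries_def)

lemma equiv_homologous: "equiv (cycles A n) (homologous A n)"
proof (rule equivI)
  show "homologous A n \<subseteq> cycles A n \<times> cycles A n" by (auto simp: homologous_def)
  show "refl_on (cycles A n) (homologous A n)"
    by (auto simp: refl_on_def homologous_def zero_boundary)
  show "sym (homologous A n)"
  proof (rule symI)
    fix u v assume uv: "(u, v) \<in> homologous A n"
    then have "u - v \<in> boundaries A n" by (simp add: homologous_def)
    then have "0 - (u - v) \<in> boundaries A n" by (rule boundaries_diff[OF zero_boundary])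
    with uv show "(v, u) \<in> homologous A n" by (auto simp: homologous_def)
  qed
  show "trans (homologous A n)"
  proof (rule transI)
    fix u v w assume uv: "(u, v) \<in> homologous A n" and vw: "(v, w) \<in> homologous A n"
    then have "u - v \<in> boundaries A n" "v - w \<in> boundaries A n" by (simp_all add: homologous_def)
    then have "(u - v) - (0 - (v - w)) \<in> boundaries A n"
      by (intro boundaries_diff[of "u - v"] boundaries_diff[OF zero_boundary])
    with uv vw show "(u, w) \<in> homologous A n" by (auto simp: homologous_def)
  qed
qed

lemma cycles_diff: "u \<in> cycles A n \<Longrightarrow> v \<in> cycles A n \<Longrightarrow> u - v \<in> cycles A n"
  by (auto simp: cycles_def homog_diff diff_minus)

end

context dga_hom
begin

lemma hom_minus: "u \<in> homog A n \<Longrightarrow> v \<in> homog A n \<Longrightarrow> f (u - v) = f u - f v"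
proof -
  assume "u \<in> homog A n" "v \<in> homog A n"
  then have "u - v \<in> total A" "v \<in> total A"
    using A.homog_diff[of u n v] A.homog_subset_total[of n] by auto
  then show ?thesis using hom_add[of "u - v" v] by simp
qed

lemma hom_cycles: "w \<in> cycles A n \<Longrightarrow> f w \<in> cycles B n"
proof -
  assume w: "w \<in> cycles A n"
  have "0 \<in> homog A n" by (rule module.subspace_0[OF A.module_scal A.subspace_homog])
  then have "f 0 = 0" using hom_minus[of 0 n 0] by simp
  then show ?thesis
    using w hom_diff[of w] hom_homog[of w n] A.homog_subset_total[of n] by (auto simp: cycles_def)
qed

lemma hom_boundaries: "w \<in> boundaries A n \<Longrightarrow> f w \<in> boundaries B n"
  using hom_homog hom_diff A.homog_subset_total by (force simp: boundaries_def)

lemma homology_map_class: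
  assumes "w \<in> cycles A n"
  shows "homology_map B f n (homologous A n `` {w}) = homologous B n `` {f w}"
proof -
  have "(f w, f v) \<in> homologous B n" if "(w, v) \<in> homologous A n" for v
  proof -
    have "f w - f v \<in> boundaries B n"
      using that hom_minus[of w n v] hom_boundaries[of "w - v" n] by (auto simp: homologous_def cycles_def)
    then show ?thesis using that hom_cycles by (auto simp: homologous_def)
  qed
  moreover have "(w, w) \<in> homologous A n"
    using A.equiv_homologous assms by (auto simp: equiv_def refl_on_def)
  ultimately show ?thesis
    unfolding homology_map_def using equivE[OF B.equiv_homologous[of n]] by (auto dest: symD transD)
qed

lemma quasi_isoI:
  assumes surj: "\<And>n z. z \<in> cycles B n \<Longrightarrow> \<exists>w\<in>cycles A n. z - f w \<in> boundaries B n"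
    and inj: "\<And>n w. w \<in> cycles A n \<Longrightarrow> f w \<in> boundaries B n \<Longrightarrow> w \<in> boundaries A n"
  shows "dga_quasi_iso A B f"
proof -
  have "bij_betw (homology_map B f n) (homology A n) (homology B n)" for n
  proof (rule bij_betw_imageI)
    show "inj_on (homology_map B f n) (homology A n)"
    proof (rule inj_onI)
      fix c c' assume "c \<in> homology A n" "c' \<in> homology A n" "homology_map B f n c = homology_map B f n c'"
      then obtain w w' where w: "w \<in> cycles A n" "w' \<in> cycles A n"
        "c = homologous A n `` {w}" "c' = homologous A n `` {w'}"
        "homologous B n `` {f w} = homologous B n `` {f w'}"
        by (auto simp: homology_def homology_map_class elim!: quotientE)
      then have "(f w, f w') \<in> homologous B n"
        using eq_equiv_class[OF _ B.equiv_homologous] hom_cycles by blast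
      then have "f (w - w') \<in> boundaries B n"
        using w hom_minus[of w n w'] by (auto simp: homologous_def cycles_def)
      then have "(w, w') \<in> homologous A n"
        using w inj[of "w - w'" n] A.cycles_diff by (auto simp: homologous_def)
      then show "c = c'"
        unfolding w by (rule equiv_class_eq[OF A.equiv_homologous])
    qed
    show "homology_map B f n ` homology A n = homology B n"
    proof (intro equalityI subsetI)
      fix c assume "c \<in> homology_map B f n ` homology A n"
      then show "c \<in> homology B n"
        using hom_cycles by (auto simp: homology_def homology_map_class intro!: quotientI elim!: quotientE)
    next
      fix c assume "c \<in> homology B n"
      then obtain z where z: "z \<in> cycles B n" "c = homologous B n `` {z}"
        by (auto simp: homology_def elim!: quotientE)
      then obtain w where w: "w \<in> cycles A n" "z - f w \<in> boundaries B n" using surj by blast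
      then have "(z, f w) \<in> homologous B n"
        using z hom_cycles by (auto simp: homologous_def)
      then have "c = homology_map B f n (homologous A n `` {w})"
        unfolding z homology_map_class[OF w(1)] by (rule equiv_class_eq[OF B.equiv_homologous])
      then show "c \<in> homology_map B f n ` homology A n"
        using w by (auto simp: homology_def intro: quotientI)
    qed
  qed
  then show ?thesis
    using dga_hom_axioms by (simp add: dga_quasi_iso_def)
qed

end

text \<open>The algebra of planar loops is only part of its ambient module of combinations of
  arbitrary lists, so the model maps onto \<open>total B\<close> and not onto the whole
  type.\<close>

lemma dg_algebra_transport:
  assumes A: "dg_algebra A" and B: "module (scal B)" and tot: "total A = UNIV" "total B = range h"
    and inj: "inj h" and add: "\<And>u v. h (u + v) = h u + h v"
    and sc: "\<And>c u. h (scal A c u) = scal B c (h u)"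
    and hom: "\<And>n. homog B n = h ` homog A n"
    and prd: "\<And>u v. prd B (h u) (h v) = h (prd A u v)"
    and unt: "unt B = h (unt A)" and dif: "\<And>u. diff B (h u) = h (diff A u)"
  shows "dg_algebra B"
proof -
  interpret A: dg_algebra A by (rule A)
  have zero: "h 0 = 0" using add[of 0 0] by simp
  have h_sum: "h (sum f I) = (\<Sum>i\<in>I. h (f i))" for f and I :: "nat set"
    by (induction I rule: infinite_finite_induct) (auto simp: add zero)
  show ?thesis
  proof (rule dg_algebra.intro)
    show "module (scal B)" by (rule B)
    show "module.subspace (scal B) (homog B n)" for n
      using A.subspace_homog[of n]
      by (auto simp: module.subspace_def[OF B] module.subspace_def[OF A.module_scal] hom
          add[symmetric] sc[symmetric] zero intro: image_eqI[of _ h 0])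
  next
    fix f and N n :: nat
    assume f: "\<And>n. f n \<in> homog B n" "(\<Sum>n\<le>N. f n) = 0" "n \<le> N"
    show "f n = 0"
    proof -
      obtain f' where f': "\<And>n. f' n \<in> homog A n" "\<And>n. f n = h (f' n)"
        using f(1) unfolding hom image_iff by metis
      then have "h (\<Sum>n\<le>N. f' n) = h 0" using f(2) by (simp add: h_sum zero)
      then have "(\<Sum>n\<le>N. f' n) = 0" using inj by (simp add: inj_eq)
      then show ?thesis using A.direct_sum[of f' N n] f' f(3) by (simp add: zero)
    qed
  next
    fix u v m n
    assume "u \<in> homog B m" "v \<in> homog B n"
    then show "prd B u v \<in> homog B (m + n)"
      using A.prd_homog by (auto simp: hom prd)
  next
    fix u v m
    assume "u \<in> homog B m" "v \<in> total B"
    then show "diff B (prd B u v) = prd B (diff B u) v + scal B ((-1) ^ m) (prd B u (diff B v))"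
      using A.leibniz tot by (auto simp: hom prd dif add sc)
  qed (use A.prd_add_left A.prd_add_right A.prd_scal_left A.prd_scal_right A.prd_assoc A.unt_homog
      A.unt_left A.unt_right A.diff_add A.diff_scal A.diff_homog_0 A.diff_homog_Suc A.diff_diff tot
      in \<open>auto simp: hom prd unt dif zero simp flip: add sc\<close>)
qed


section \<open>The comparison map is a quasi-isomorphism\<close>

text \<open>The decomposition into \<open>t\<close>, \<open>q\<close> and the boundary of
  \<open>q'\<close> does not mention degrees; projecting afterwards makes its pieces
  homogeneous.\<close>

definition part :: "('k \<Rightarrow> nat) \<Rightarrow> nat \<Rightarrow> ('k \<Rightarrow>\<^sub>0 'r::comm_ring_1) \<Rightarrow> ('k \<Rightarrow>\<^sub>0 'r)" where
  "part deg n = lin (\<lambda>w. if deg w = n then basis w else 0)"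

lemma linear_map_part: "linear_map (part deg n)"
  unfolding part_def by (rule linear_map_lin)

lemma keys_part: "keys (part deg n u) \<subseteq> {w. deg w = n}"
  unfolding part_def by (rule keys_lin_subset[OF order.refl]) auto

lemma part_homog: "keys u \<subseteq> {w. deg w = m} \<Longrightarrow> part deg n u = (if m = n then u else 0)"
  using linear_map_eqI[of "part deg n" "\<lambda>u. if m = n then u else 0" u] linear_map_part[of deg n]
    linear_map_id linear_map_zero by (cases "m = n") (auto simp: part_def subset_iff)

text \<open>The number \<open>k\<close> is the drop in degree caused by \<open>h\<close>: it is 0
  for the comparison map and 1 for the differentials.\<close>

lemma part_commute:
  assumes h: "linear_map h" and deg: "\<And>w. keys (h (basis w)) \<subseteq> {v. deg' v + k = deg w}"
  shows "part deg' n (h u) = h (part deg (n + k) u)"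
proof (rule linear_map_eqI[of "\<lambda>u. part deg' n (h u)" "\<lambda>u. h (part deg (n + k) u)"])
  fix w assume "w \<in> keys u"
  have part_basis: "part deg (n + k) (basis w) = (if deg w = n + k then basis w else 0)"
    by (simp add: part_def)
  show "part deg' n (h (basis w)) = h (part deg (n + k) (basis w))"
  proof (cases "k \<le> deg w")
    case True
    have "part deg' n (h (basis w)) = (if deg w - k = n then h (basis w) else 0)"
      by (rule part_homog) (use deg[of w] True in fastforce)
    then show ?thesis
      using True module_hom.zero[OF h] unfolding part_basis by auto
  next
    case False
    then have "h (basis w) = 0" using deg[of w] by auto
    then show ?thesis
      using False module_hom.zero[OF h] module_hom.zero[OF linear_map_part] unfolding part_basis by auto
  qed
qed (rule linear_map_comp[OF linear_map_part h], rule linear_map_comp[OF h linear_map_part])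

lemma keys_model_map_basis: "keys (model_map (basis w)) \<subseteq> {v. sy_deg v = word_deg w}"
proof -
  have "keys (model_map (basis (Word l))) \<subseteq> {v. sy_deg v = word_deg (Word l)}" for l
  proof (induction l)
    case Nil
    then show ?case by (simp add: model_map_basis word_deg_simps zero_sy_def)
  next
    case (Cons g l)
    then show ?case
      using keys_mult_subset[OF keys_mgen[of g] Cons] by (simp add: model_map_basis word_deg_simps deg_plus)
  qed
  then show ?thesis by (cases w) simp
qed

lemma keys_model_map:
  assumes "keys u \<subseteq> {w. word_deg w = n}"
  shows "keys (model_map u) \<subseteq> {v. sy_deg v = n}"
  by (subst linear_map_eq_lin[OF linear_map_model], rule keys_lin_subset[OF assms])
    (use keys_model_map_basis in auto)

lemma part_model_map: "part sy_deg n (model_map u) = model_map (part word_deg n u)"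
proof -
  have "part sy_deg n (model_map u) = model_map (part word_deg (n + 0) u)"
    by (rule part_commute[OF linear_map_model]) (simp add: keys_model_map_basis)
  then show ?thesis by simp
qed

lemma part_loop_diff: "part sy_deg n (loop_diff a u) = loop_diff a (part sy_deg (Suc n) u)"
  using part_commute[where h = "loop_diff a" and deg' = sy_deg and deg = sy_deg and k = 1 and n = n and u = u]
    linear_map_lin[of "sy_diff a"] keys_sy_diff(2)[of a] by simp

lemma part_free_diff: "part word_deg n (free_diff a u) = free_diff a (part word_deg (Suc n) u)"
  using part_commute[where h = "free_diff a" and deg' = word_deg and deg = word_deg and k = 1 and n = n and u = u]
    linear_map_lin[of "\<lambda>w. diff_letters a (letters w)"] keys_diff_letters[of a "letters _"] by simp

lemma free_diff_degree_0: "keys u \<subseteq> {w. word_deg w = 0} \<Longrightarrow> free_diff a u = 0"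
  using keys_lin_subset[of u "{w. word_deg w = 0}" "\<lambda>w. diff_letters a (letters w)" "{}"]
    keys_diff_letters[of a "letters _"] by fastforce

lemma loop_diff_loop_diff: "loop_diff a (loop_diff a u) = 0"
  by (simp add: lin_lin diff_diff) (simp add: lin_def)

lemma model_map_in_combs_upper: "model_map u \<in> combs (insert Emp {w. upper w})"
  by (rule combs_mono[OF model_map_in_combs]) auto

lemma decomposition:
  obtains t q q' where "u = model_map t + q + loop_diff a q'" "q \<in> combs {w. upper w}"
  using decomposable_UNIV[of u a] combs_in_range_model_map unfolding decomposable_def by blast

lemma model_map_eq_loop_diff:
  assumes "model_map t = loop_diff a q" "q \<in> combs {w. upper w}"
  shows "t = 0"
  using combs_upper_eq_0[OF assms(2), of a] assms(1) model_map_in_combs_upper[of t] model_map_eq_0[of t]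
  by (simp add: lin_zero)

text \<open>Applying the differential to a decomposition of \<open>z\<close> removes the boundary
  and leaves \<open>loop_diff a q\<close> in the image of the free algebra, so that both
  \<open>q\<close> and the differential of \<open>t\<close> vanish.\<close>

lemma model_cycle:
  assumes z: "keys z \<subseteq> {w. sy_deg w = n}" and dz: "loop_diff a z = 0"
  obtains t u where "keys t \<subseteq> {w. word_deg w = n}" "free_diff a t = 0"
    "keys u \<subseteq> {w. sy_deg w = Suc n}" "z = model_map t + loop_diff a u"
proof -
  obtain t q q' where eq: "z = model_map t + q + loop_diff a q'" and q: "q \<in> combs {w. upper w}"
    by (rule decomposition)
  have "model_map (free_diff a t) + loop_diff a q = 0"
    using dz by (simp add: eq lin_add loop_diff_loop_diff loop_diff_model_map)
  then have "model_map (- free_diff a t) = loop_diff a q"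
    by (simp add: module_hom.neg[OF linear_map_model] minus_unique)
  then have dt: "free_diff a t = 0" and "loop_diff a q = 0"
    using model_map_eq_loop_diff[OF _ q, of "- free_diff a t" a] by (auto simp: model_map_simps)
  then have "q = 0"
    using combs_upper_eq_0[OF q, of a] by (simp add: combs_zero)
  have "z = part sy_deg n z" using part_homog[OF z] by simp
  also have "\<dots> = model_map (part word_deg n t) + loop_diff a (part sy_deg (Suc n) q')"
    by (simp add: eq \<open>q = 0\<close> module_hom.add[OF linear_map_part] part_model_map part_loop_diff)
  finally have "z = \<dots>" .
  moreover have "free_diff a (part word_deg n t) = 0"
  \<comment> \<open>In degree 0 there is no lower degree from which to project, but there the
    differential vanishes anyway.\<close>
  proof (cases n)
    case 0
    then show ?thesis using keys_part[of word_deg 0 t] by (intro free_diff_degree_0) simp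
  next
    case (Suc m)
    then show ?thesis by (simp add: dt module_hom.zero[OF linear_map_part] flip: part_free_diff)
  qed
  ultimately show ?thesis
    using that[of "part word_deg n t" "part sy_deg (Suc n) q'"] keys_part[of word_deg n t]
      keys_part[of sy_deg "Suc n" q'] by simp
qed

lemma model_boundary:
  assumes t: "keys t \<subseteq> {w. word_deg w = n}" and u: "model_map t = loop_diff a u"
  obtains s where "keys s \<subseteq> {w. word_deg w = Suc n}" "t = free_diff a s"
proof -
  obtain s q q' where eq: "u = model_map s + q + loop_diff a q'" and q: "q \<in> combs {w. upper w}"
    by (rule decomposition)
  have "model_map (t - free_diff a s) = loop_diff a q"
    by (simp add: u eq model_map_simps lin_add loop_diff_loop_diff loop_diff_model_map)
  then have "t = free_diff a s"
    using model_map_eq_loop_diff[OF _ q] by fastforce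
  moreover have "t = part word_deg n t" using part_homog[OF t] by simp
  ultimately have "t = free_diff a (part word_deg (Suc n) s)"
    using part_free_diff[of n a s] by simp
  then show ?thesis
    using that[of "part word_deg (Suc n) s"] keys_part[of word_deg "Suc n" s] by simp
qed

section \<open>Symbols as lists of diagrams\<close>

declare mid_arcs.simps [simp del] cup_arcs.simps [simp del]

text \<open>Composition through the object \<open>0\<close> glues a cup to what follows; before
  \<open>Emp\<close> it is composed with the empty diagram and so remains the last diagram.\<close>

primrec tail_symb :: "tail \<Rightarrow> symb" and sy_symb :: "sy \<Rightarrow> symb" where
  "tail_symb (Cl c w) = join (diag (cup_arcs Lft c)) (hd (sy_symb w)) # tl (sy_symb w)"
| "tail_symb (Idt t) = diag (mid_arcs MId) # tail_symb t"
| "tail_symb (Be i j t) = diag (mid_arcs (MBe i j)) # tail_symb t"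
| "sy_symb Emp = [{}]"
| "sy_symb (Sy c t) = diag (cup_arcs Rgt c) # tail_symb t"

lemma tail_symb_Cl: "tail_symb (Cl c Emp) = [diag (cup_arcs Lft c)]"
  "tail_symb (Cl c (Sy k t)) = diag (mid_arcs (MCl c k)) # tail_symb t"
  by (simp_all only: tail_symb.simps sy_symb.simps list.sel join_cup_cup)

lemma tail_cases:
  obtains c where "t = Cl c Emp" | c k s where "t = Cl c (Sy k s)" | s where "t = Idt s"
  | i j s where "t = Be i j s"
  by (metis tail.exhaust sy.exhaust)

text \<open>Induction along the list of diagrams: a \<open>Cl\<close> and the cup after it are
  consumed together, since they form one diagram.\<close>

lemma tail_induct_step [case_names End Cl Idt Be]:
  assumes "\<And>c. P (Cl c Emp)" "\<And>c k t. P t \<Longrightarrow> P (Cl c (Sy k t))" "\<And>t. P t \<Longrightarrow> P (Idt t)"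
    "\<And>i j t. P t \<Longrightarrow> P (Be i j t)"
  shows "P t"
proof (induction "size t" arbitrary: t rule: less_induct)
  case less
  show ?case
  proof (cases t rule: tail_cases)
    case (2 c k s)
    then show ?thesis using less[of s] assms(2) by simp
  next
    case (3 s)
    then show ?thesis using less[of s] assms(3) by simp
  next
    case (4 i j s)
    then show ?thesis using less[of s] assms(4) by simp
  qed (use assms(1) in simp)
qed

lemma tail_symb_neq_Nil [simp]: "tail_symb t \<noteq> []" "[] \<noteq> tail_symb t"
  by (cases t; simp)+

lemmas tail_symb_simps = tail_symb_Cl tail_symb.simps(2,3)

declare tail_symb.simps(1) [simp del]

lemma length_tail_symb: "length (tail_symb t) = tail_deg t"
  by (induction t rule: tail_induct_step) (simp_all add: tail_symb_simps)

definition tail_symbols :: "symb set" where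
  "tail_symbols = {s. s \<noteq> [] \<and> set (butlast s) \<subseteq> tl_diagrams 4 4 \<and> last s \<in> tl_diagrams 4 0}"

lemma tail_symb_in: "tail_symb t \<in> tail_symbols"
  by (induction t rule: tail_induct_step)
    (auto simp: tail_symbols_def tail_symb_simps tl_4_0 tl_4_4)

lemma tail_symb_surj: "s \<in> tail_symbols \<Longrightarrow> s \<in> range tail_symb"
proof (induction s)
  case (Cons x s)
  show ?case
  proof (cases "s = []")
    case True
    then obtain c where "x = diag (cup_arcs Lft c)"
      using Cons.prems by (auto simp: tail_symbols_def tl_4_0)
    then show ?thesis using True by (intro range_eqI[of _ _ "Cl c Emp"]) (simp add: tail_symb_simps)
  next
    case False
    then obtain m where m: "x = diag (mid_arcs m)"
      using Cons.prems by (auto simp: tail_symbols_def tl_4_4)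
    have "s \<in> tail_symbols" using False Cons.prems by (auto simp: tail_symbols_def)
    then obtain t where t: "s = tail_symb t" using Cons.IH by auto
    show ?thesis
    proof (cases m)
      case MId
      then show ?thesis using m t by (intro range_eqI[of _ _ "Idt t"]) simp
    next
      case (MBe i j)
      then show ?thesis using m t by (intro range_eqI[of _ _ "Be i j t"]) simp
    next
      case (MCl c k)
      then show ?thesis using m t
        by (intro range_eqI[of _ _ "Cl c (Sy k t)"]) (simp add: tail_symb_simps)
    qed
  qed
qed (simp add: tail_symbols_def)

lemma symbols_0: "symbols 0 = {[{}]}"
  by (auto simp: symbols_def tl_0_0 length_Suc_conv)

lemma tail_symbols_iff:
  assumes "length s = Suc n"
  shows "s \<in> tail_symbols \<longleftrightarrow> (\<forall>j\<le>n. s ! j \<in> tl_diagrams 4 (if j = n then 0 else 4))"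
proof -
  have "s \<noteq> []" using assms by auto
  moreover from this have "last s = s ! n" using assms by (simp add: last_conv_nth)
  moreover have "set (butlast s) \<subseteq> tl_diagrams 4 4 \<longleftrightarrow> (\<forall>j<n. s ! j \<in> tl_diagrams 4 4)"
    using assms by (auto simp: subset_iff in_set_conv_nth nth_butlast)
  ultimately show ?thesis
    by (auto simp: tail_symbols_def le_less)
qed

lemma symbols_Suc:
  "symbols (Suc p) = {x # s |x s. x \<in> tl_diagrams 0 4 \<and> s \<in> tail_symbols \<and> length s = Suc p}"
proof -
  have "x # s \<in> symbols (Suc p) \<longleftrightarrow> x \<in> tl_diagrams 0 4 \<and> s \<in> tail_symbols"
    if "length s = Suc p" for x s
  proof -
    have "(\<forall>i\<le>Suc p. Q i) \<longleftrightarrow> Q 0 \<and> (\<forall>j\<le>p. Q (Suc j))" for Q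
      by (metis Suc_le_mono le0 not0_implies_Suc)
    then show ?thesis
      using that by (simp add: symbols_def tail_symbols_iff[OF that] cong: if_cong)
  qed
  moreover have "\<exists>x s'. s = x # s' \<and> length s' = Suc p" if "s \<in> symbols (Suc p)" for s
    using that by (simp add: symbols_def length_Suc_conv)
  ultimately show ?thesis by (intro equalityI subsetI) (clarsimp, metis, auto)
qed

lemma symbols_eq: "symbols p = sy_symb ` {w. sy_deg w = p}"
proof (cases p)
  case 0
  have "{w. sy_deg w = 0} = {Emp}"
  proof -
    have "sy_deg w = 0 \<longleftrightarrow> w = Emp" for w
      by (cases w; simp; rename_tac t; case_tac t; simp)
    then show ?thesis by auto
  qed
  then show ?thesis using 0 by (simp add: symbols_0)
next
  case (Suc n)
  have "{w. sy_deg w = Suc n} = {Sy c t |c t. tail_deg t = Suc n}"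
  proof -
    have "sy_deg w = Suc n \<longleftrightarrow> (\<exists>c t. w = Sy c t \<and> tail_deg t = Suc n)" for w
      by (cases w) auto
    then show ?thesis by auto
  qed
  moreover have "symbols (Suc n) = {diag (cup_arcs Rgt c) # tail_symb t |c t. tail_deg t = Suc n}"
    using tail_symb_surj tail_symb_in by (fastforce simp: symbols_Suc tl_0_4 length_tail_symb[symmetric])
  ultimately show ?thesis using Suc by force
qed

lemma same_diag_iff: "same_diag M M' \<longleftrightarrow> diag M = diag M'"
proof
  assume eq: "diag M = diag M'"
  have "(p, q) \<in> set (opp M')" if "(p, q) \<in> set M" "diag M = diag M'"
    for p q and M M' :: "(node \<times> node) list"
  proof -
    have "{p, q} \<in> diag M" using that by (auto simp: diag_def)
    then show ?thesis using that by (simp add: in_opp)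
  qed
  then show "same_diag M M'"
    using eq by (auto simp: same_diag_def list_all_iff List.member_iff)
qed (rule same_diagD)

lemma mid_diagram_inject: "diag (mid_arcs m) = diag (mid_arcs n) \<longleftrightarrow> m = n"
proof -
  have "list_all (\<lambda>m. list_all (\<lambda>n. m = n \<or> \<not> same_diag (mid_arcs m) (mid_arcs n)) mids) mids"
    by code_simp
  then show ?thesis by (auto simp: list_all_iff set_mids same_diag_iff)
qed

lemma cup_diagram_inject: "diag (cup_arcs Lft c) = diag (cup_arcs Lft k) \<longleftrightarrow> c = k"
  "diag (cup_arcs Rgt c) = diag (cup_arcs Rgt k) \<longleftrightarrow> c = k"
proof -
  have "list_all (\<lambda>c. list_all (\<lambda>k. c = k \<or> \<not> same_diag (cup_arcs Lft c) (cup_arcs Lft k) \<and>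
      \<not> same_diag (cup_arcs Rgt c) (cup_arcs Rgt k)) cups) cups"
    by code_simp
  then show "diag (cup_arcs Lft c) = diag (cup_arcs Lft k) \<longleftrightarrow> c = k"
    "diag (cup_arcs Rgt c) = diag (cup_arcs Rgt k) \<longleftrightarrow> c = k"
    by (auto simp: list_all_iff set_cups same_diag_iff)
qed

lemma tail_symb_inject: "tail_symb t = tail_symb s \<Longrightarrow> t = s"
proof (induction t arbitrary: s rule: tail_induct_step)
  case (End c)
  then show ?case
    by (cases s rule: tail_cases) (simp_all add: tail_symb_simps cup_diagram_inject)
next
  case (Cl c k t)
  then show ?case
    by (cases s rule: tail_cases) (simp_all add: tail_symb_simps mid_diagram_inject)
next
  case (Idt t)
  then show ?case
    by (cases s rule: tail_cases) (simp_all add: tail_symb_simps mid_diagram_inject)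
next
  case (Be i j t)
  then show ?case
    by (cases s rule: tail_cases) (simp_all add: tail_symb_simps mid_diagram_inject)
qed

lemma inj_sy_symb: "inj sy_symb"
proof (rule injI)
  fix v w assume "sy_symb v = sy_symb w"
  then show "v = w"
    by (cases v; cases w) (auto simp: cup_diagram_inject tail_symb_inject)
qed

lemma juxtapose_Cons: "s \<noteq> [] \<Longrightarrow> juxtapose (x # s) t = x # juxtapose s t"
  by (simp add: juxtapose_def)

lemma juxtapose_end: "juxtapose [diag (cup_arcs Lft c)] (sy_symb w) = tail_symb (Cl c w)"
  by (simp add: juxtapose_def tail_symb.simps)

lemma tail_symb_plus: "tail_symb (plus_tail t w) = juxtapose (tail_symb t) (sy_symb w)"
proof (induction t rule: tail_induct_step)
  case (End c)
  then show ?case by (simp add: juxtapose_end tail_symb_simps)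
qed (simp_all add: tail_symb_simps juxtapose_Cons)

lemma sy_symb_plus: "sy_symb (v + w) = juxtapose (sy_symb v) (sy_symb w)"
proof (cases v)
  case Emp
  have "juxtapose [{}] (sy_symb w) = sy_symb w"
    by (cases w) (simp_all add: juxtapose_def join_cup_cup)
  then show ?thesis using Emp by simp
qed (simp add: tail_symb_plus juxtapose_Cons)

text \<open>The other bars of the list are those of its tail with indices shifted by one, hence the
  minus sign; this is the recursion of \<open>tail_diff\<close>.\<close>

lemma diff_symb_Cons: "diff_symb a (x # y # s) = scale (a ^ loops x y) (basis (join x y # s))
    - lin (\<lambda>t. basis (x # t)) (diff_symb a (y # s))"
proof -
  have "delete_bar a 0 (x # y # s) = scale (a ^ loops x y) (basis (join x y # s))"
    by (simp add: delete_bar_def)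
  moreover have "delete_bar a (Suc i) (x # y # s) = lin (\<lambda>t. basis (x # t)) (delete_bar a i (y # s))" for i
    by (simp add: delete_bar_def lin_scale)
  ultimately show ?thesis
    by (simp add: diff_symb_def sum.lessThan_Suc_shift lin_sum lin_scale sum_negf del: sum.lessThan_Suc)
qed

lemma diff_symb_single: "diff_symb a [x] = 0"
  by (simp add: diff_symb_def)

primrec mid_act :: "'r::comm_ring_1 \<Rightarrow> mid \<Rightarrow> tail \<Rightarrow> (tail \<Rightarrow>\<^sub>0 'r)" where
  "mid_act a MId t = basis t"
| "mid_act a (MBe i j) t = be_act a i j t"
| "mid_act a (MCl c k) t = lin (\<lambda>w. basis (Cl c w)) (cup_act a k t)"

lemma row_loops_far: "far j k \<Longrightarrow> row_loops j k = 0"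
  by (cases j; cases k) (simp_all add: row_loops_def)

lemma mid_act_symb:
  assumes "tail_symb t = x # s"
  shows "lin (\<lambda>t. basis (tail_symb t)) (mid_act a m t) =
    scale (a ^ loops (diag (mid_arcs m)) x) (basis (join (diag (mid_arcs m)) x # s))"
  using assms
  by (cases t rule: tail_cases; cases m)
    (auto simp: tail_symb_simps join_mid loops_mid join_cup_mid lin_simps row_loops_far)

lemma cup_act_symb:
  assumes "tail_symb t = x # s"
  shows "lin (\<lambda>w. basis (sy_symb w)) (cup_act a c t) =
    scale (a ^ loops (diag (cup_arcs Rgt c)) x) (basis (join (diag (cup_arcs Rgt c)) x # s))"
  using assms
  by (cases t rule: tail_cases)
    (auto simp: tail_symb_simps join_cup_mid join_cup_cup lin_simps)

lemma diff_tail_symb: "diff_symb a (tail_symb t) = lin (\<lambda>t. basis (tail_symb t)) (tail_diff a t)"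
proof (induction t rule: tail_induct_step)
  case (End c)
  then show ?case by (simp add: tail_symb_simps diff_symb_single lin_zero)
next
  case (Cl c k t)
  obtain x s where xs: "tail_symb t = x # s" by (cases "tail_symb t") auto
  then show ?case
    using Cl mid_act_symb[OF xs, of a "MCl c k"]
    by (simp add: tail_symb_simps diff_symb_Cons lin_simps lin_lin xs)
next
  case (Idt t)
  obtain x s where xs: "tail_symb t = x # s" by (cases "tail_symb t") auto
  then show ?case
    using Idt mid_act_symb[OF xs, of a MId]
    by (simp add: tail_symb_simps diff_symb_Cons lin_simps lin_lin xs)
next
  case (Be i j t)
  obtain x s where xs: "tail_symb t = x # s" by (cases "tail_symb t") auto
  then show ?case
    using Be mid_act_symb[OF xs, of a "MBe i j"]
    by (simp add: tail_symb_simps diff_symb_Cons lin_simps lin_lin xs)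
qed

lemma diff_sy_symb: "diff_symb a (sy_symb w) = lin (\<lambda>w. basis (sy_symb w)) (sy_diff a w)"
proof (cases w)
  case Emp
  then show ?thesis by (simp add: diff_symb_single lin_zero)
next
  case (Sy c t)
  obtain x s where xs: "tail_symb t = x # s" by (cases "tail_symb t") auto
  then show ?thesis
    using Sy cup_act_symb[OF xs, of a c] diff_tail_symb[of a t]
    by (simp add: diff_symb_Cons lin_simps lin_lin)
qed


section \<open>The comparison with the algebra of planar loops\<close>

definition symb_map :: "(sy \<Rightarrow>\<^sub>0 'r::comm_ring_1) \<Rightarrow> (symb \<Rightarrow>\<^sub>0 'r)" where
  "symb_map = lin (\<lambda>w. basis (sy_symb w))"

lemma symb_map_basis: "symb_map (basis w) = basis (sy_symb w)"
  by (simp add: symb_map_def)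

lemma linear_map_symb: "linear_map symb_map"
  unfolding symb_map_def by (rule linear_map_lin)

lemma keys_symb_map: "keys u \<subseteq> A \<Longrightarrow> keys (symb_map u) \<subseteq> sy_symb ` A"
  unfolding symb_map_def by (rule keys_lin_basisI) auto

lemma symb_map_surj:
  fixes u :: "symb \<Rightarrow>\<^sub>0 'r::comm_ring_1"
  assumes "keys u \<subseteq> sy_symb ` A"
  shows "u \<in> symb_map ` {v. keys v \<subseteq> A}"
proof
  let ?v = "lin (\<lambda>s. basis (inv sy_symb s)) u"
  show "u = symb_map ?v"
    unfolding symb_map_def lin_lin lin_basis
    by (subst lin_basis_id[of u, symmetric], rule lin_cong) (use assms in \<open>auto simp: f_inv_into_f\<close>)
  have "keys ?v \<subseteq> A"
    by (rule keys_lin_basisI[OF assms]) (auto simp: inv_f_f[OF inj_sy_symb])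
  then show "?v \<in> {v. keys v \<subseteq> A}" by simp
qed

lemma inj_symb_map: "inj (symb_map :: (sy \<Rightarrow>\<^sub>0 'r::comm_ring_1) \<Rightarrow> _)"
proof (rule inj_on_inverseI)
  show "lin (\<lambda>s. basis (inv sy_symb s)) (symb_map u) = u" for u :: "sy \<Rightarrow>\<^sub>0 'r"
    by (simp add: symb_map_def lin_lin inv_f_f[OF inj_sy_symb] lin_basis_id)
qed

lemma planar_loops_simps [simp]:
  "homog (planar_loops a) p = {u. keys u \<subseteq> symbols p}"
  "scal (planar_loops a) = scale"
  "prd (planar_loops a) u v = lin (\<lambda>s. lin (\<lambda>t. basis (juxtapose s t)) v) u"
  "unt (planar_loops a) = basis [{}]"
  "diff (planar_loops a) = lin (diff_symb a)"
  by (simp_all add: planar_loops_def)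

lemma homog_planar_loops:
  "homog (planar_loops a) n = symb_map ` homog (monoid_dga sy_deg (sy_diff a)) n"
proof (intro equalityI subsetI)
  fix u assume "u \<in> homog (planar_loops a) n"
  then show "u \<in> symb_map ` homog (monoid_dga sy_deg (sy_diff a)) n"
    using symb_map_surj[of u "{w. sy_deg w = n}"] by (simp add: symbols_eq)
next
  fix u assume "u \<in> symb_map ` homog (monoid_dga sy_deg (sy_diff a)) n"
  then obtain v where "u = symb_map v" "keys v \<subseteq> {w. sy_deg w = n}" by auto
  then show "u \<in> homog (planar_loops a) n"
    using keys_symb_map[of v "{w. sy_deg w = n}"] by (simp add: symbols_eq)
qed

lemma total_planar_loops: "total (planar_loops a) = range symb_map"
proof -
  have "(\<Union>n. symbols n) = range sy_symb" by (auto simp: symbols_eq)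
  then have "total (planar_loops a) = {u. keys u \<subseteq> range sy_symb}"
    by (simp add: total_def span_keys)
  also have "\<dots> = range symb_map"
    using keys_symb_map[of _ UNIV] symb_map_surj[of _ UNIV] by auto
  finally show ?thesis .
qed

lemma prd_planar_loops: "prd (planar_loops a) (symb_map u) (symb_map v) = symb_map (u * v)"
proof -
  have "prd (planar_loops a) (symb_map u) (symb_map v) = lin (\<lambda>w. lin (\<lambda>w'. basis (sy_symb (w + w'))) v) u"
    by (simp add: symb_map_def lin_lin sy_symb_plus)
  also have "\<dots> = symb_map (u * v)"
  proof (rule linear_map_eqI[OF linear_map_lin])
    show "linear_map (\<lambda>u. symb_map (u * v))"
      by (intro linear_map_comp[OF linear_map_symb] linear_map_mult_right linear_map_id)
    show "lin (\<lambda>w. lin (\<lambda>w'. basis (sy_symb (w + w'))) v) (basis w) = symb_map (basis w * v)" for w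
      by (simp add: symb_map_def basis_mult_lin lin_lin)
  qed
  finally show ?thesis .
qed

lemma diff_planar_loops: "diff (planar_loops a) (symb_map u) = symb_map (loop_diff a u)"
  by (simp add: symb_map_def lin_lin diff_sy_symb)

lemma unt_planar_loops: "unt (planar_loops a) = symb_map 1"
  by (simp add: symb_map_basis flip: basis_Emp)

lemma dg_algebra_planar_loops: "dg_algebra (planar_loops a)"
proof (rule dg_algebra_transport[OF dg_algebra_sy[of a] _ _ total_planar_loops inj_symb_map])
  show "module (scal (planar_loops a))" by (simp add: scale.module_axioms)
qed (simp_all only: homog_planar_loops prd_planar_loops diff_planar_loops unt_planar_loops
    total_monoid_dga monoid_dga_simps planar_loops_simps(2) module_hom.add[OF linear_map_symb]
    module_hom.scale[OF linear_map_symb])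

definition comparison :: "'r::comm_ring_1 free_alg \<Rightarrow> (symb \<Rightarrow>\<^sub>0 'r)" where
  "comparison u = symb_map (model_map u)"

lemma dga_hom_comparison: "dga_hom (free_dga a) (planar_loops a) comparison"
proof (intro dga_hom.intro dga_hom_axioms.intro)
  show "dg_algebra (free_dga a)" by (rule dg_algebra_free)
  show "dg_algebra (planar_loops a)" by (rule dg_algebra_planar_loops)
  show "comparison (prd (free_dga a) u v) = prd (planar_loops a) (comparison u) (comparison v)" for u v
    by (simp only: comparison_def prd_planar_loops model_map_mult free_dga_eq monoid_dga_simps)
  show "comparison (unt (free_dga a)) = unt (planar_loops a)"
    by (simp only: comparison_def unt_planar_loops model_map_one free_dga_eq monoid_dga_simps)
  show "comparison (diff (free_dga a) u) = diff (planar_loops a) (comparison u)" for u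
    by (simp only: comparison_def diff_planar_loops loop_diff_model_map free_dga_eq monoid_dga_simps)
  show "comparison u \<in> homog (planar_loops a) n" if "u \<in> homog (free_dga a) n" for u n
    using that keys_model_map[of u n] unfolding comparison_def homog_planar_loops
    by (auto simp: free_dga_eq)
qed (simp_all add: comparison_def free_dga_eq model_map_simps module_hom.add[OF linear_map_symb]
    module_hom.scale[OF linear_map_symb])

lemma quasi_iso_comparison: "dga_quasi_iso (free_dga a) (planar_loops a) comparison"
proof (rule dga_hom.quasi_isoI[OF dga_hom_comparison])
  fix n and z :: "symb \<Rightarrow>\<^sub>0 'a"
  assume "z \<in> cycles (planar_loops a) n"
  then obtain v where v: "z = symb_map v" "keys v \<subseteq> {w. sy_deg w = n}" "symb_map (loop_diff a v) = symb_map 0"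
    unfolding cycles_def homog_planar_loops
    by (auto simp: diff_planar_loops[unfolded planar_loops_simps] module_hom.zero[OF linear_map_symb])
  have "loop_diff a v = 0" by (rule injD[OF inj_symb_map v(3)])
  then obtain t u where t: "keys t \<subseteq> {w. word_deg w = n}" "free_diff a t = 0"
    and u: "keys u \<subseteq> {w. sy_deg w = Suc n}" "v = model_map t + loop_diff a u"
    using model_cycle[OF v(2)] by metis
  have "z - comparison t = diff (planar_loops a) (symb_map u)"
    unfolding diff_planar_loops by (simp add: v(1) u(2) comparison_def module_hom.add[OF linear_map_symb])
  then have "z - comparison t \<in> boundaries (planar_loops a) n"
    unfolding boundaries_def homog_planar_loops using u(1) by auto
  then show "\<exists>w\<in>cycles (free_dga a) n. z - comparison w \<in> boundaries (planar_loops a) n"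
    using t by (auto simp: cycles_def free_dga_eq)
next
  fix n and t :: "'a free_alg"
  assume t: "t \<in> cycles (free_dga a) n" and "comparison t \<in> boundaries (planar_loops a) n"
  then obtain u where "symb_map (model_map t) = diff (planar_loops a) (symb_map u)"
    unfolding boundaries_def homog_planar_loops comparison_def by auto
  then have "model_map t = loop_diff a u"
    unfolding diff_planar_loops by (rule injD[OF inj_symb_map])
  then obtain s where "keys s \<subseteq> {w. word_deg w = Suc n}" "t = free_diff a s"
    using t model_boundary[of t n a u] by (auto simp: cycles_def free_dga_eq)
  then show "t \<in> boundaries (free_dga a) n"
    by (auto simp: boundaries_def free_dga_eq)
qed


section \<open>The involutions\<close>

lemma image_diag: "(`) ((`) f) (diag M) = diag (map (map_prod f f) M)"
  by (simp add: diag_def image_image split_def)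

primrec row_flip :: "row \<Rightarrow> row" where
  "row_flip R1 = R3" | "row_flip R2 = R2" | "row_flip R3 = R1"

text \<open>Both cups are symmetric from top to bottom, so \<open>MCl\<close> is fixed.\<close>

primrec mid_ud :: "mid \<Rightarrow> mid" where
  "mid_ud MId = MId" | "mid_ud (MBe i j) = MBe (row_flip i) (row_flip j)" | "mid_ud (MCl c k) = MCl c k"

primrec mid_lr :: "mid \<Rightarrow> mid" where
  "mid_lr MId = MId" | "mid_lr (MBe i j) = MBe j i" | "mid_lr (MCl c k) = MCl k c"

lemma flip_diagrams:
  "(`) ((`) flip_ud) (diag (mid_arcs m)) = diag (mid_arcs (mid_ud m))"
  "(`) ((`) flip_lr) (diag (mid_arcs m)) = diag (mid_arcs (mid_lr m))"
  "(`) ((`) flip_ud) (diag (cup_arcs Lft c)) = diag (cup_arcs Lft c)"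
  "(`) ((`) flip_ud) (diag (cup_arcs Rgt c)) = diag (cup_arcs Rgt c)"
  "(`) ((`) flip_lr) (diag (cup_arcs Lft c)) = diag (cup_arcs Rgt c)"
  "(`) ((`) flip_lr) (diag (cup_arcs Rgt c)) = diag (cup_arcs Lft c)"
proof -
  have "list_all (\<lambda>m. same_diag (map (map_prod flip_ud flip_ud) (mid_arcs m)) (mid_arcs (mid_ud m)) \<and>
      same_diag (map (map_prod flip_lr flip_lr) (mid_arcs m)) (mid_arcs (mid_lr m))) mids"
    by code_simp
  then show "(`) ((`) flip_ud) (diag (mid_arcs m)) = diag (mid_arcs (mid_ud m))"
    "(`) ((`) flip_lr) (diag (mid_arcs m)) = diag (mid_arcs (mid_lr m))"
    unfolding image_diag by (simp_all add: list_all_iff set_mids same_diag_iff)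
  have "list_all (\<lambda>c. same_diag (map (map_prod flip_ud flip_ud) (cup_arcs Lft c)) (cup_arcs Lft c) \<and>
      same_diag (map (map_prod flip_ud flip_ud) (cup_arcs Rgt c)) (cup_arcs Rgt c) \<and>
      same_diag (map (map_prod flip_lr flip_lr) (cup_arcs Lft c)) (cup_arcs Rgt c) \<and>
      same_diag (map (map_prod flip_lr flip_lr) (cup_arcs Rgt c)) (cup_arcs Lft c)) cups"
    by code_simp
  then show "(`) ((`) flip_ud) (diag (cup_arcs Lft c)) = diag (cup_arcs Lft c)"
    "(`) ((`) flip_ud) (diag (cup_arcs Rgt c)) = diag (cup_arcs Rgt c)"
    "(`) ((`) flip_lr) (diag (cup_arcs Lft c)) = diag (cup_arcs Rgt c)"
    "(`) ((`) flip_lr) (diag (cup_arcs Rgt c)) = diag (cup_arcs Lft c)"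
    unfolding image_diag by (simp_all add: list_all_iff set_cups same_diag_iff)
qed

primrec tail_ud :: "tail \<Rightarrow> tail" and sy_ud :: "sy \<Rightarrow> sy" where
  "tail_ud (Cl c w) = Cl c (sy_ud w)"
| "tail_ud (Idt t) = Idt (tail_ud t)"
| "tail_ud (Be i j t) = Be (row_flip i) (row_flip j) (tail_ud t)"
| "sy_ud Emp = Emp"
| "sy_ud (Sy c t) = Sy c (tail_ud t)"

lemma sy_ud_plus: "tail_ud (plus_tail t v) = plus_tail (tail_ud t) (sy_ud v)"
  "sy_ud (w + v) = sy_ud w + sy_ud v"
  by (induction t and w) simp_all

lemma tail_symb_ud: "tail_symb (tail_ud t) = map (image (image flip_ud)) (tail_symb t)"
  by (induction t rule: tail_induct_step) (simp_all add: tail_symb_simps flip_diagrams)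

lemma sy_symb_ud: "sy_symb (sy_ud w) = map (image (image flip_ud)) (sy_symb w)"
  by (cases w) (simp_all add: tail_symb_ud flip_diagrams)

text \<open>The tail \<open>s\<close> collects the reversal of the part of the symbol that has been read.\<close>

primrec tail_lr :: "tail \<Rightarrow> tail \<Rightarrow> sy" and sy_lr_onto :: "sy \<Rightarrow> sy \<Rightarrow> sy" where
  "tail_lr (Cl c w) s = sy_lr_onto w (Sy c s)"
| "tail_lr (Idt t) s = tail_lr t (Idt s)"
| "tail_lr (Be i j t) s = tail_lr t (Be j i s)"
| "sy_lr_onto Emp v = v"
| "sy_lr_onto (Sy c t) v = tail_lr t (Cl c v)"

definition sy_lr :: "sy \<Rightarrow> sy" where
  "sy_lr w = sy_lr_onto w Emp"

text \<open>Reversal never looks into the accumulated part, so anything appended to it can be split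
  off. This turns the accumulator into a product and makes \<open>sy_lr\<close> an
  anti-automorphism.\<close>

lemma sy_lr_onto_eq: "tail_lr t (plus_tail s v) = tail_lr t s + v" "sy_lr_onto w (u + v) = sy_lr_onto w u + v"
proof (induction t and w arbitrary: s v and u v)
  case (Cl c w)
  show ?case using Cl[of "Sy c s" v] by simp
next
  case (Idt t)
  show ?case using Idt[of "Idt s" v] by simp
next
  case (Be i j t)
  show ?case using Be[of "Be j i s" v] by simp
next
  case (Sy c t)
  show ?case using Sy[of "Cl c u" v] by simp
qed simp

lemma sy_lr_onto: "sy_lr_onto w v = sy_lr w + v"
  using sy_lr_onto_eq(2)[of w 0 v] by (simp add: sy_lr_def zero_sy_def)

lemma sy_lr_plus: "tail_lr (plus_tail t v) s = sy_lr v + tail_lr t s" "sy_lr (w + v) = sy_lr v + sy_lr w"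
proof -
  have "tail_lr (plus_tail t v) s = sy_lr v + tail_lr t s" "sy_lr_onto (w + v) u = sy_lr v + sy_lr_onto w u" for u
    by (induction t and w arbitrary: s and u) (simp_all add: sy_lr_onto[of v])
  then show "tail_lr (plus_tail t v) s = sy_lr v + tail_lr t s" "sy_lr (w + v) = sy_lr v + sy_lr w"
    by (simp_all add: sy_lr_def)
qed

lemma sy_symb_tail_lr: "sy_symb (tail_lr t s) = rev (map (image (image flip_lr)) (tail_symb t)) @ tail_symb s"
  by (induction t arbitrary: s rule: tail_induct_step) (simp_all add: tail_symb_simps flip_diagrams)

lemma sy_symb_lr: "sy_symb (sy_lr w) = rev (map (image (image flip_lr)) (sy_symb w))"
  by (cases w) (simp_all add: sy_lr_def sy_symb_tail_lr tail_symb_simps flip_diagrams)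

lemma loops_ud_symb_map: "loops_ud (symb_map u) = symb_map (lin (\<lambda>w. basis (sy_ud w)) u)"
  by (simp add: loops_ud_def symb_map_def lin_lin sy_symb_ud)

lemma loops_lr_symb_map: "loops_lr (symb_map u) = symb_map (lin (\<lambda>w. basis (sy_lr w)) u)"
  by (simp add: loops_lr_def symb_map_def lin_lin sy_symb_lr)

lemma lin_ud_mult: "lin (\<lambda>w. basis (sy_ud w)) (u * v) = lin (\<lambda>w. basis (sy_ud w)) u * lin (\<lambda>w. basis (sy_ud w)) v"
  for u v :: "sy \<Rightarrow>\<^sub>0 'r::comm_ring_1"
proof -
  let ?h = "lin (\<lambda>w. basis (sy_ud w)) :: _ \<Rightarrow> (sy \<Rightarrow>\<^sub>0 'r)"
  have "?h (basis w * v) = ?h (basis w) * ?h v" for w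
    by (simp add: basis_mult_lin lin_lin sy_ud_plus)
  moreover have "linear_map (\<lambda>u. ?h (u * v))" "linear_map (\<lambda>u. ?h u * ?h v)"
    by (intro linear_map_comp[OF linear_map_lin] linear_map_mult_right linear_map_id linear_map_lin)+
  ultimately show ?thesis by (intro linear_map_eqI[of "\<lambda>u. ?h (u * v)" "\<lambda>u. ?h u * ?h v" u])
qed

lemma lin_lr_mult: "lin (\<lambda>w. basis (sy_lr w)) (u * v) = lin (\<lambda>w. basis (sy_lr w)) v * lin (\<lambda>w. basis (sy_lr w)) u"
  for u v :: "sy \<Rightarrow>\<^sub>0 'r::comm_ring_1"
proof -
  let ?h = "lin (\<lambda>w. basis (sy_lr w)) :: _ \<Rightarrow> (sy \<Rightarrow>\<^sub>0 'r)"
  have "?h (basis w * v) = ?h v * ?h (basis w)" for w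
    by (simp add: basis_mult_lin mult_basis lin_lin sy_lr_plus)
  moreover have "linear_map (\<lambda>u. ?h (u * v))" "linear_map (\<lambda>u. ?h v * ?h u)"
    by (intro linear_map_comp[OF linear_map_lin] linear_map_mult_right linear_map_mult_left linear_map_id linear_map_lin)+
  ultimately show ?thesis by (intro linear_map_eqI[of "\<lambda>u. ?h (u * v)" "\<lambda>u. ?h v * ?h u" u])
qed

text \<open>In \<open>Y\<close> the flip exchanges the two positive terms and the two negative
  ones.\<close>

lemma lin_ud_mgen: "lin (\<lambda>w. basis (sy_ud w)) (mgen g) = mgen g"
  by (cases g) (simp_all add: mgen.simps lin_simps)

text \<open>In \<open>Y\<close> the reversal fixes each positive term and exchanges the two negative
  ones.\<close>

lemma lin_lr_mgen: "lin (\<lambda>w. basis (sy_lr w)) (mgen g) = mgen (swap_gen g)"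
  by (cases g) (simp_all add: mgen.simps lin_simps sy_lr_def)

lemma comparison_ud: "loops_ud (comparison u) = comparison u"
proof -
  let ?h = "lin (\<lambda>w. basis (sy_ud w)) :: _ \<Rightarrow> (sy \<Rightarrow>\<^sub>0 'a)"
  have "?h (prod_list (map mgen l)) = prod_list (map mgen l)" for l
    by (induction l) (simp_all add: lin_ud_mult lin_ud_mgen, simp flip: basis_Emp)
  then have "?h (model_map u) = model_map u"
    by (simp add: model_map_def lin_lin)
  then show ?thesis by (simp add: comparison_def loops_ud_symb_map)
qed

lemma comparison_lr: "loops_lr (comparison u) = comparison (free_lr u)"
proof -
  let ?h = "lin (\<lambda>w. basis (sy_lr w)) :: _ \<Rightarrow> (sy \<Rightarrow>\<^sub>0 'a)"
  have "?h (prod_list (map mgen l)) = prod_list (map mgen (rev (map swap_gen l)))" for l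
    by (induction l) (simp_all add: lin_lr_mult lin_lr_mgen, simp add: sy_lr_def flip: basis_Emp)
  then have "?h (model_map u) = model_map (free_lr u)"
    by (simp add: model_map_def free_lr_def lin_lin)
  then show ?thesis by (simp add: comparison_def loops_lr_symb_map)
qed

lemma d\<beta>_numeral:
  "diag (mid_arcs (MBe R2 R2)) = d\<beta> 2 2" "diag (mid_arcs (MBe R2 R1)) = d\<beta> 2 1"
  "diag (mid_arcs (MBe R1 R2)) = d\<beta> 1 2" "diag (mid_arcs (MBe R2 R3)) = d\<beta> 2 3"
  "diag (mid_arcs (MBe R3 R2)) = d\<beta> 3 2"
  using d\<beta>_eq[of R2 R2] d\<beta>_eq[of R2 R1] d\<beta>_eq[of R1 R2] d\<beta>_eq[of R2 R3] d\<beta>_eq[of R3 R2]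
  by simp_all

theorem theorem1p1:
  fixes a :: "'r::comm_ring_1"
  shows "\<exists>\<phi> :: 'r free_alg \<Rightarrow> (symb \<Rightarrow>\<^sub>0 'r).
    dga_quasi_iso (free_dga a) (planar_loops a) \<phi> \<and>
    (\<forall>u. \<phi> (free_ud u) = loops_ud (\<phi> u)) \<and>
    (\<forall>u. \<phi> (free_lr u) = loops_lr (\<phi> u)) \<and>
    \<phi> (gen X) = basis [dU Rgt, dN Lft] \<and>
    \<phi> (gen Xhat) = basis [dN Rgt, dU Lft] \<and>
    \<phi> (gen R) = basis [dU Rgt, d\<beta> 2 2, dU Lft] \<and>
    \<phi> (gen Y) =
      basis [dU Rgt, d\<beta> 2 1, d\<beta> 1 2, dU Lft] + basis [dU Rgt, d\<beta> 2 3, d\<beta> 3 2, dU Lft]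
      - basis [dU Rgt, d\<beta> 2 1, d\<beta> 3 2, dU Lft] - basis [dU Rgt, d\<beta> 2 3, d\<beta> 1 2, dU Lft]"
proof (intro exI[of _ comparison] conjI allI)
  show "dga_quasi_iso (free_dga a) (planar_loops a) comparison"
    by (rule quasi_iso_comparison)
  show "comparison (free_ud u) = loops_ud (comparison u)" for u :: "'r free_alg"
    by (simp add: free_ud_def comparison_ud)
  show "comparison (free_lr u) = loops_lr (comparison u)" for u :: "'r free_alg"
    by (simp add: comparison_lr)
qed (simp_all add: comparison_def model_map_gen mgen.simps symb_map_basis tail_symb_simps dU_eq dN_eq d\<beta>_numeral
    module_hom.add[OF linear_map_symb] module_hom.diff[OF linear_map_symb])

end
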